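(* Let $X$ be a smooth projective toric variety of dimension $n\ge 2$ defined by a fan $\Sigma$, let $N=|\Sigma(1)|$, and let $A\colon\mathbb{Z}^{\Sigma(1)}=\mathbb{Z}^N\to\operatorname{Pic}(X)\cong\mathbb{Z}^{N-n}$ be the surjection in the natural exact sequence $0\to \mathbf{M}\xrightarrow{B}\mathbb{Z}^{\Sigma(1)}\xrightarrow{A}\operatorname{Pic}(X)\to 0$. Then $\mathcal{Z}_X=\operatorname{Spec}\bigoplus_{p\ge0}H^0(X,\mathrm{Sym}^pT_X)$ is isomorphic to the toric hyper-Kähler variety $\mathcal{Y}(A,0,0)$.
   Context: We work over $\mathbb{C}$. $\Sigma(1)$ is the set of one-dimensional cones (rays) of $\Sigma$; $\mathbf{M}$ is the lattice of characters of the torus of $X$; $B$ sends $\mathbf{m}$ to $(\langle \mathbf{v}_\rho,\mathbf{m}\rangle)_{\rho\in\Sigma(1)}$, where $\mathbf{v}_\rho$ is the primitive generator of $\rho$; $A$ sends the basis vector indexed by $\rho$ to the class of the toric divisor $D_\rho$. After choosing a basis of $\operatorname{Pic}(X)$, $A=[\mathbf{a}_1,\dots,\mathbf{a}_N]$ is an $(N-n)\times N$ integer matrix. Toric hyper-Kähler variety: the matrix $A$ determines an action of the torus $\mathbb{T}^{N-n}=(\mathbb{C}^\times)^{N-n}$ on $T^*\mathbb{C}^N=\mathbb{C}^{2N}$ with coordinates $(z_1,\dots,z_N,w_1,\dots,w_N)$ by $$\mathbf{t}\cdot(z_1,\dots,z_N,w_1,\dots,w_N)=(\mathbf{t}^{\mathbf{a}_1}z_1,\dots,\mathbf{t}^{\mathbf{a}_N}z_N,\mathbf{t}^{-\mathbf{a}_1}w_1,\dots,\mathbf{t}^{-\mathbf{a}_N}w_N),$$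 where $\mathbf{t}^{\mathbf{a}_i}=t_1^{a_{1,i}}\cdots t_{N-n}^{a_{N-n,i}}$ for $\mathbf{a}_i=(a_{j,i})_j$. The moment map is $\Phi\colon\mathbb{C}^{2N}\to\mathbb{C}^{N-n}$, $(z,w)\mapsto\sum_{i=1}^N\mathbf{a}_iz_iw_i$. For a rational character $\theta$ of $\mathbb{T}^{N-n}$ and $\xi\in\mathbb{C}^{N-n}$, $\mathcal{Y}(A,\theta,\xi)=\Phi^{-1}(\xi)^{\theta}/\!\!/\mathbb{T}^{N-n}$, where $\Phi^{-1}(\xi)^\theta$ is the open subset of $\theta$-semistable points. In particular, for $\theta=0$, $\xi=0$ all points are semistable and $\mathcal{Y}(A,0,0)=\Phi^{-1}(0)/\!\!/\mathbb{T}^{N-n}$ is the spectrum of the ring of $\mathbb{T}^{N-n}$-invariant regular functions on $\Phi^{-1}(0)$. *)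

theory Defs
  imports
    "HOL-Analysis.Analysis"
    "HOL-Algebra.Module"
    "HOL-Algebra.QuotRing"
    "HOL-Algebra.Product_Groups"
    "HOL-Library.Poly_Mapping"
    "HOL-Library.Multiset"
begin

section \<open>Fans in \<open>\<real>\<^sup>n\<close> with lattice \<open>\<int>\<^sup>n\<close>\<close>

text \<open>
  The lattice \<open>N\<close> of one-parameter subgroups and its dual, the character lattice \<open>M\<close>, are both
  \<open>int ^ 'n\<close>, paired by the dot product; cones live in \<open>N\<close> tensored with the reals.
\<close>

definition lat :: "int ^ 'n \<Rightarrow> real ^ 'n" where
  "lat v = (\<chi> i. real_of_int (v $ i))"

definition rational_cone :: "(real ^ 'n) set \<Rightarrow> bool" where
  "rational_cone \<sigma> \<longleftrightarrow>
     (\<exists>S. finite S \<and> \<sigma> = {\<Sum>s\<in>S. c s *\<^sub>R lat s | c. \<forall>s\<in>S. (0::real) \<le> c s})"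

definition strongly_convex :: "(real ^ 'n) set \<Rightarrow> bool" where
  "strongly_convex \<sigma> \<longleftrightarrow> \<sigma> \<inter> uminus ` \<sigma> = {0}"

text \<open>The library's \<open>face_of\<close> admits the empty face, which is not a cone.\<close>

definition fan :: "(real ^ 'n) set set \<Rightarrow> bool" where
  "fan \<Sigma> \<longleftrightarrow> finite \<Sigma> \<and> \<Sigma> \<noteq> {} \<and>
     (\<forall>\<sigma>\<in>\<Sigma>. rational_cone \<sigma> \<and> strongly_convex \<sigma>) \<and>
     (\<forall>\<sigma>\<in>\<Sigma>. \<forall>\<tau>. \<tau> face_of \<sigma> \<and> \<tau> \<noteq> {} \<longrightarrow> \<tau> \<in> \<Sigma>) \<and>
     (\<forall>\<sigma>\<in>\<Sigma>. \<forall>\<tau>\<in>\<Sigma>. (\<sigma> \<inter> \<tau>) face_of \<sigma> \<and> (\<sigma> \<inter> \<tau>) face_of \<tau>)"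

definition rays :: "(real ^ 'n) set set \<Rightarrow> (real ^ 'n) set set" where
  "rays \<Sigma> = {\<rho> \<in> \<Sigma>. dim \<rho> = 1}"

definition prim_gen :: "(real ^ 'n) set \<Rightarrow> int ^ 'n" where
  "prim_gen \<rho> = (THE v. v \<noteq> 0 \<and> lat v \<in> \<rho> \<and>
     (\<forall>u. lat u \<in> \<rho> \<longrightarrow> (\<exists>k::nat. u = (\<chi> i. int k * v $ i))))"

definition pair_int :: "int ^ 'n \<Rightarrow> int ^ 'n \<Rightarrow> int" where
  "pair_int v m = (\<Sum>i\<in>UNIV. v $ i * m $ i)"


section \<open>The toric variety of a fan\<close>

text \<open>
  A complex variety in the classical sense: its set of closed points with the Zariski topology,
  together with the predicate ``\<open>f\<close> is a regular function on \<open>U\<close>''. Regularity on \<open>U\<close> never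
  depends on the values of \<open>f\<close> outside \<open>U\<close>.
\<close>

record 'p variety =
  vtop :: "'p topology"
  regular :: "'p set \<Rightarrow> ('p \<Rightarrow> complex) \<Rightarrow> bool"

text \<open>\<open>dual_monoid \<sigma>\<close> is the semigroup of lattice points of the dual cone.\<close>

definition dual_monoid :: "(real ^ 'n) set \<Rightarrow> (int ^ 'n) set" where
  "dual_monoid \<sigma> = {m. \<forall>u\<in>\<sigma>. 0 \<le> u \<bullet> lat m}"

type_synonym 'n laurent = "(int ^ 'n) \<Rightarrow>\<^sub>0 complex"

text \<open>
  The coordinate ring of the affine chart of \<open>\<sigma>\<close> is the semigroup algebra of \<open>dual_monoid \<sigma>\<close>,
  here a subring of the ring \<open>'n laurent\<close> of Laurent polynomials.
\<close>

definition chart_ring :: "(real ^ 'n) set \<Rightarrow> 'n::finite laurent set" where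
  "chart_ring \<sigma> = {f. Poly_Mapping.keys f \<subseteq> dual_monoid \<sigma>}"

definition lconst :: "complex \<Rightarrow> 'n::finite laurent" where
  "lconst c = Poly_Mapping.single 0 c"

text \<open>Closed points of the chart are monoid homomorphisms to the multiplicative monoid \<open>\<complex>\<close>.\<close>

definition chart_points :: "(real ^ 'n) set \<Rightarrow> (int ^ 'n \<Rightarrow> complex) set" where
  "chart_points \<sigma> = {\<gamma> \<in> extensional (dual_monoid \<sigma>). \<gamma> 0 = 1 \<and>
     (\<forall>m\<in>dual_monoid \<sigma>. \<forall>m'\<in>dual_monoid \<sigma>. \<gamma> (m + m') = \<gamma> m * \<gamma> m')}"

definition chart_eval :: "(int ^ 'n \<Rightarrow> complex) \<Rightarrow> 'n::finite laurent \<Rightarrow> complex" where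
  "chart_eval \<gamma> f = (\<Sum>m\<in>Poly_Mapping.keys f. Poly_Mapping.lookup f m * \<gamma> m)"

text \<open>The charts of \<open>\<sigma>\<close> and \<open>\<tau>\<close> are glued along the chart of \<open>\<sigma> \<inter> \<tau>\<close>.\<close>

type_synonym 'n chart_pt = "(real ^ 'n) set \<times> (int ^ 'n \<Rightarrow> complex)"

definition glue :: "(real ^ 'n) set set \<Rightarrow> ('n::finite chart_pt \<times> 'n::finite chart_pt) set" where
  "glue \<Sigma> = {((\<sigma>, \<gamma>), (\<tau>, \<delta>)) | \<sigma> \<gamma> \<tau> \<delta>.
     \<sigma> \<in> \<Sigma> \<and> \<tau> \<in> \<Sigma> \<and> \<gamma> \<in> chart_points \<sigma> \<and> \<delta> \<in> chart_points \<tau> \<and>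
     (\<exists>\<epsilon>\<in>chart_points (\<sigma> \<inter> \<tau>).
        restrict \<epsilon> (dual_monoid \<sigma>) = \<gamma> \<and> restrict \<epsilon> (dual_monoid \<tau>) = \<delta>)}"

definition toric_pt :: "(real ^ 'n) set set \<Rightarrow> (real ^ 'n) set \<Rightarrow> (int ^ 'n \<Rightarrow> complex) \<Rightarrow> 'n::finite chart_pt set" where
  "toric_pt \<Sigma> \<sigma> \<gamma> = glue \<Sigma> `` {(\<sigma>, \<gamma>)}"

text \<open>Regular functions are locally quotients of elements of the chart rings.\<close>

definition toric_variety :: "(real ^ 'n) set set \<Rightarrow> 'n::finite chart_pt set variety" where
  "toric_variety \<Sigma> = \<lparr>
     vtop = topology_generated_by
       {{toric_pt \<Sigma> \<sigma> \<gamma> | \<gamma>. \<gamma> \<in> chart_points \<sigma> \<and> chart_eval \<gamma> f \<noteq> 0}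
         | \<sigma> f. \<sigma> \<in> \<Sigma> \<and> f \<in> chart_ring \<sigma>},
     regular = (\<lambda>U f. \<forall>\<sigma>\<in>\<Sigma>. \<forall>\<gamma>\<in>chart_points \<sigma>. toric_pt \<Sigma> \<sigma> \<gamma> \<in> U \<longrightarrow>
       (\<exists>g\<in>chart_ring \<sigma>. \<exists>h\<in>chart_ring \<sigma>. chart_eval \<gamma> h \<noteq> 0 \<and>
          (\<forall>\<gamma>'\<in>chart_points \<sigma>. toric_pt \<Sigma> \<sigma> \<gamma>' \<in> U \<and> chart_eval \<gamma>' h \<noteq> 0 \<longrightarrow>
             f (toric_pt \<Sigma> \<sigma> \<gamma>') = chart_eval \<gamma>' g / chart_eval \<gamma>' h)))\<rparr>"

text \<open>
  Zariski tangent space at a closed point of a chart, as point derivations of its coordinate ring.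
  The variety has dimension \<open>CARD('n)\<close>, so it is smooth iff all tangent spaces have that dimension.
\<close>

definition tangent_space ::
    "(real ^ 'n) set \<Rightarrow> (int ^ 'n \<Rightarrow> complex) \<Rightarrow> ('n::finite laurent \<Rightarrow> complex) set" where
  "tangent_space \<sigma> \<gamma> = {\<delta> \<in> extensional (chart_ring \<sigma>).
     (\<forall>f\<in>chart_ring \<sigma>. \<forall>g\<in>chart_ring \<sigma>. \<delta> (f + g) = \<delta> f + \<delta> g) \<and>
     (\<forall>c. \<forall>f\<in>chart_ring \<sigma>. \<delta> (lconst c * f) = c * \<delta> f) \<and>
     (\<forall>f\<in>chart_ring \<sigma>. \<forall>g\<in>chart_ring \<sigma>.
        \<delta> (f * g) = chart_eval \<gamma> f * \<delta> g + chart_eval \<gamma> g * \<delta> f)}"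

definition smooth_toric :: "(real ^ 'n) set set \<Rightarrow> bool" where
  "smooth_toric \<Sigma> \<longleftrightarrow> (\<forall>x\<in>topspace (vtop (toric_variety \<Sigma>)). \<forall>(\<sigma>, \<gamma>)\<in>x.
     \<exists>b::'n \<Rightarrow> 'n::finite laurent \<Rightarrow> complex. range b \<subseteq> tangent_space \<sigma> \<gamma> \<and>
       (\<forall>\<delta>\<in>tangent_space \<sigma> \<gamma>. \<exists>!c::'n \<Rightarrow> complex.
          \<delta> = (\<lambda>f\<in>chart_ring \<sigma>. \<Sum>i\<in>UNIV. c i * b i f)))"


section \<open>Projective varieties\<close>

definition closed_subvariety :: "'p variety \<Rightarrow> 'p set \<Rightarrow> 'p variety" where
  "closed_subvariety Y Z = \<lparr>
     vtop = subtopology (vtop Y) Z,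
     regular = (\<lambda>U f. \<forall>x\<in>U. \<exists>W g. openin (vtop Y) W \<and> x \<in> W \<and> regular Y W g \<and>
       (\<forall>y\<in>W \<inter> U. f y = g y))\<rparr>"

definition variety_iso :: "'p variety \<Rightarrow> 'q variety \<Rightarrow> bool" where
  "variety_iso X Y \<longleftrightarrow> (\<exists>h. homeomorphic_map (vtop X) (vtop Y) h \<and>
     (\<forall>V f. openin (vtop Y) V \<longrightarrow>
        (regular Y V f \<longleftrightarrow> regular X {x \<in> topspace (vtop X). h x \<in> V} (\<lambda>x. f (h x)))))"

text \<open>Homogeneous polynomials of degree \<open>d\<close> in the variables \<open>0, \<dots>, k\<close>.\<close>

definition hom_poly :: "nat \<Rightarrow> nat \<Rightarrow> ((nat \<Rightarrow>\<^sub>0 nat) \<Rightarrow>\<^sub>0 complex) set" where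
  "hom_poly k d = {F. \<forall>\<alpha>\<in>Poly_Mapping.keys F. Poly_Mapping.keys \<alpha> \<subseteq> {..k} \<and>
     (\<Sum>i\<le>k. Poly_Mapping.lookup \<alpha> i) = d}"

definition poly_eval :: "((nat \<Rightarrow>\<^sub>0 nat) \<Rightarrow>\<^sub>0 complex) \<Rightarrow> (nat \<Rightarrow> complex) \<Rightarrow> complex" where
  "poly_eval F v = (\<Sum>\<alpha>\<in>Poly_Mapping.keys F. Poly_Mapping.lookup F \<alpha> *
     (\<Prod>i\<in>Poly_Mapping.keys \<alpha>. v i ^ Poly_Mapping.lookup \<alpha> i))"

text \<open>A point of projective \<open>k\<close>-space is the set of nonzero vectors on a line.\<close>

definition proj_points :: "nat \<Rightarrow> (nat \<Rightarrow> complex) set set" where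
  "proj_points k = {{(\<lambda>i. c * v i) | c. c \<noteq> 0} | v. (\<forall>i>k. v i = 0) \<and> (\<exists>i\<le>k. v i \<noteq> 0)}"

definition proj_space :: "nat \<Rightarrow> (nat \<Rightarrow> complex) set variety" where
  "proj_space k = \<lparr>
     vtop = topology_generated_by
       {{L \<in> proj_points k. \<forall>v\<in>L. poly_eval F v \<noteq> 0} | F d. F \<in> hom_poly k d},
     regular = (\<lambda>U f. \<forall>L\<in>U. \<exists>d. \<exists>F\<in>hom_poly k d. \<exists>G\<in>hom_poly k d.
       (\<forall>v\<in>L. poly_eval G v \<noteq> 0) \<and>
       (\<forall>L'\<in>U. \<forall>v\<in>L'. poly_eval G v \<noteq> 0 \<longrightarrow> f L' = poly_eval F v / poly_eval G v))\<rparr>"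

definition projective :: "'p variety \<Rightarrow> bool" where
  "projective X \<longleftrightarrow> (\<exists>k Z. closedin (vtop (proj_space k)) Z \<and>
     variety_iso X (closed_subvariety (proj_space k) Z))"


section \<open>The Picard group\<close>

text \<open>
  A line bundle is given by a trivializing neighbourhood \<open>U x\<close> of each point \<open>x\<close> and
  transition functions \<open>g x y\<close> with \<open>s\<^sub>x = g x y * s\<^sub>y\<close> for the local expressions of a section.
  \<open>Pic X\<close> consists of isomorphism classes of such data under the tensor product.
\<close>

type_synonym 'p line_bundle = "('p \<Rightarrow> 'p set) \<times> ('p \<Rightarrow> 'p \<Rightarrow> 'p \<Rightarrow> complex)"

definition reg_unit :: "'p variety \<Rightarrow> 'p set \<Rightarrow> ('p \<Rightarrow> complex) \<Rightarrow> bool" where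
  "reg_unit X U f \<longleftrightarrow> regular X U f \<and> (\<forall>q\<in>U. f q \<noteq> 0)"

definition line_bundles :: "'p variety \<Rightarrow> 'p line_bundle set" where
  "line_bundles X = (let P = topspace (vtop X) in {(U, g).
     (\<forall>x\<in>P. openin (vtop X) (U x) \<and> x \<in> U x) \<and>
     (\<forall>x\<in>P. \<forall>y\<in>P. reg_unit X (U x \<inter> U y) (g x y)) \<and>
     (\<forall>x\<in>P. \<forall>y\<in>P. \<forall>z\<in>P. \<forall>q\<in>U x \<inter> U y \<inter> U z. g x z q = g x y q * g y z q)})"

definition lb_iso :: "'p variety \<Rightarrow> ('p line_bundle \<times> 'p line_bundle) set" where
  "lb_iso X = (let P = topspace (vtop X) in {((U, g), (U', g')) | U g U' g'.
     (U, g) \<in> line_bundles X \<and> (U', g') \<in> line_bundles X \<and>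
     (\<exists>V h. (\<forall>x\<in>P. openin (vtop X) (V x) \<and> x \<in> V x \<and> V x \<subseteq> U x \<inter> U' x \<and>
                    reg_unit X (V x) (h x)) \<and>
            (\<forall>x\<in>P. \<forall>y\<in>P. \<forall>q\<in>V x \<inter> V y. g' x y q * h y q = h x q * g x y q))})"

fun lb_tensor :: "'p line_bundle \<Rightarrow> 'p line_bundle \<Rightarrow> 'p line_bundle" where
  "lb_tensor (U, g) (U', g') = ((\<lambda>x. U x \<inter> U' x), (\<lambda>x y q. g x y q * g' x y q))"

definition Pic :: "'p variety \<Rightarrow> 'p line_bundle set monoid" where
  "Pic X = \<lparr>
     carrier = line_bundles X // lb_iso X,
     monoid.mult = (\<lambda>A B. lb_iso X `` {lb_tensor a b | a b. a \<in> A \<and> b \<in> B}),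
     one = lb_iso X `` {((\<lambda>_. topspace (vtop X)), (\<lambda>_ _ _. 1))}\<rparr>"

text \<open>
  The class of the line bundle \<open>O(D)\<close> of an effective (reduced, locally principal) divisor \<open>D\<close>:
  all transition data \<open>g x y = f x / f y\<close> coming from local generators \<open>f x\<close> of the
  ideal of \<open>D\<close>.
\<close>

definition divisor_class :: "'p variety \<Rightarrow> 'p set \<Rightarrow> 'p line_bundle set" where
  "divisor_class X D = (let P = topspace (vtop X) in {(U, g) \<in> line_bundles X. \<exists>f.
     (\<forall>x\<in>P. regular X (U x) (f x) \<and>
        (\<forall>V h. openin (vtop X) V \<and> V \<subseteq> U x \<and> regular X V h \<longrightarrow>
           ((\<forall>q\<in>V \<inter> D. h q = 0) \<longleftrightarrow> (\<exists>k. regular X V k \<and> (\<forall>q\<in>V. h q = k q * f x q))))) \<and>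
     (\<forall>x\<in>P. \<forall>y\<in>P. \<forall>q\<in>U x \<inter> U y. f x q = g x y q * f y q)})"

text \<open>The prime divisor of a ray is the closure of the torus orbit belonging to the ray.\<close>

definition toric_divisor :: "(real ^ 'n) set set \<Rightarrow> (real ^ 'n) set \<Rightarrow> 'n::finite chart_pt set set" where
  "toric_divisor \<Sigma> \<rho> = vtop (toric_variety \<Sigma>) closure_of
     {toric_pt \<Sigma> \<rho> \<gamma> | \<gamma>. \<gamma> \<in> chart_points \<rho> \<and>
        (\<forall>m\<in>dual_monoid \<rho>. \<gamma> m \<noteq> 0 \<longleftrightarrow> (\<forall>u\<in>\<rho>. u \<bullet> lat m = 0))}"


section \<open>The exact sequence\<close>

definition int_power_group :: "'i set \<Rightarrow> ('i \<Rightarrow> int) monoid" where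
  "int_power_group I = product_group I (\<lambda>_. integer_group)"

definition ray_map :: "(real ^ 'n) set set \<Rightarrow> int ^ 'n \<Rightarrow> ((real ^ 'n) set \<Rightarrow> int)" where
  "ray_map \<Sigma> m = (\<lambda>\<rho>\<in>rays \<Sigma>. pair_int (prim_gen \<rho>) m)"

text \<open>Multiplication with the matrix with rows \<open>0, \<dots>, r - 1\<close> and columns indexed by \<open>I\<close>.\<close>

definition matrix_map :: "nat \<Rightarrow> 'i set \<Rightarrow> (nat \<Rightarrow> 'i \<Rightarrow> int) \<Rightarrow> ('i \<Rightarrow> int) \<Rightarrow> (nat \<Rightarrow> int)" where
  "matrix_map r I A a = (\<lambda>j\<in>{..<r}. \<Sum>i\<in>I. A j i * a i)"

text \<open>\<open>0 \<rightarrow> M \<rightarrow> \<int>\<^sup>N \<rightarrow> \<int>\<^sup>r \<rightarrow> 0\<close> is exact, the maps being \<open>ray_map \<Sigma>\<close> and the matrix \<open>A\<close>.\<close>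

definition exact_ray_sequence :: "(real ^ 'n) set set \<Rightarrow> nat \<Rightarrow> (nat \<Rightarrow> (real ^ 'n) set \<Rightarrow> int) \<Rightarrow> bool" where
  "exact_ray_sequence \<Sigma> r A \<longleftrightarrow>
     inj (ray_map \<Sigma>) \<and>
     range (ray_map \<Sigma>) =
       kernel (int_power_group (rays \<Sigma>)) (int_power_group {..<r}) (matrix_map r (rays \<Sigma>) A) \<and>
     matrix_map r (rays \<Sigma>) A ` carrier (int_power_group (rays \<Sigma>)) = carrier (int_power_group {..<r})"


section \<open>Affine schemes over the complex numbers\<close>

record 'a calgebra = "'a ring" +
  cconst :: "complex \<Rightarrow> 'a"

text \<open>
  A ringed space over \<open>\<complex>\<close>; \<open>sp_const U\<close> gives the \<open>\<complex>\<close>-algebra structure on the sections over \<open>U\<close>.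
\<close>

record ('p, 's) ringed_space =
  sp_top :: "'p topology"
  sp_sec :: "'p set \<Rightarrow> 's ring"
  sp_res :: "'p set \<Rightarrow> 'p set \<Rightarrow> 's \<Rightarrow> 's"
  sp_const :: "'p set \<Rightarrow> complex \<Rightarrow> 's"

text \<open>
  \<open>loc_frac R P a b\<close> is the fraction \<open>a / b\<close> in the localization of \<open>R\<close> at the prime ideal \<open>P\<close>, as an
  equivalence class of pairs.
\<close>

definition loc_frac :: "('a, 'x) ring_scheme \<Rightarrow> 'a set \<Rightarrow> 'a \<Rightarrow> 'a \<Rightarrow> ('a \<times> 'a) set" where
  "loc_frac R P a b = {(c, d). c \<in> carrier R \<and> d \<in> carrier R - P \<and>
     (\<exists>u\<in>carrier R - P. u \<otimes>\<^bsub>R\<^esub> (a \<otimes>\<^bsub>R\<^esub> d \<ominus>\<^bsub>R\<^esub> c \<otimes>\<^bsub>R\<^esub> b) = \<zero>\<^bsub>R\<^esub>)}"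

definition localization :: "('a, 'x) ring_scheme \<Rightarrow> 'a set \<Rightarrow> ('a \<times> 'a) set ring" where
  "localization R P = \<lparr>
     carrier = {loc_frac R P a b | a b. a \<in> carrier R \<and> b \<in> carrier R - P},
     monoid.mult = (\<lambda>X Y. \<Union>(a, b)\<in>X. \<Union>(c, d)\<in>Y. loc_frac R P (a \<otimes>\<^bsub>R\<^esub> c) (b \<otimes>\<^bsub>R\<^esub> d)),
     one = loc_frac R P \<one>\<^bsub>R\<^esub> \<one>\<^bsub>R\<^esub>,
     zero = loc_frac R P \<zero>\<^bsub>R\<^esub> \<one>\<^bsub>R\<^esub>,
     add = (\<lambda>X Y. \<Union>(a, b)\<in>X. \<Union>(c, d)\<in>Y.
              loc_frac R P (a \<otimes>\<^bsub>R\<^esub> d \<oplus>\<^bsub>R\<^esub> c \<otimes>\<^bsub>R\<^esub> b) (b \<otimes>\<^bsub>R\<^esub> d))\<rparr>"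

definition prime_spectrum :: "('a, 'x) ring_scheme \<Rightarrow> 'a set set" where
  "prime_spectrum R = {P. primeideal P R}"

definition spec_sections ::
    "('a, 'x) ring_scheme \<Rightarrow> 'a set set \<Rightarrow> ('a set \<Rightarrow> ('a \<times> 'a) set) set" where
  "spec_sections R U = {s \<in> (\<Pi>\<^sub>E P\<in>U. carrier (localization R P)).
     \<forall>P\<in>U. \<exists>a\<in>carrier R. \<exists>b\<in>carrier R - P. \<forall>Q\<in>U. b \<notin> Q \<longrightarrow> s Q = loc_frac R Q a b}"

definition Spec ::
    "('a, 'x) calgebra_scheme \<Rightarrow> ('a set, 'a set \<Rightarrow> ('a \<times> 'a) set) ringed_space" where
  "Spec R = \<lparr>
     sp_top = topology_generated_by {{P \<in> prime_spectrum R. f \<notin> P} | f. f \<in> carrier R},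
     sp_sec = (\<lambda>U. \<lparr>
       carrier = spec_sections R U,
       monoid.mult = (\<lambda>s t. \<lambda>P\<in>U. s P \<otimes>\<^bsub>localization R P\<^esub> t P),
       one = (\<lambda>P\<in>U. \<one>\<^bsub>localization R P\<^esub>),
       zero = (\<lambda>P\<in>U. \<zero>\<^bsub>localization R P\<^esub>),
       add = (\<lambda>s t. \<lambda>P\<in>U. s P \<oplus>\<^bsub>localization R P\<^esub> t P)\<rparr>),
     sp_res = (\<lambda>U V s. restrict s V),
     sp_const = (\<lambda>U c. \<lambda>P\<in>U. loc_frac R P (cconst R c) \<one>\<^bsub>R\<^esub>)\<rparr>"

text \<open>
  Isomorphism of ringed spaces over \<open>\<complex>\<close>. (An isomorphism of ringed spaces automatically induces
  local homomorphisms on stalks.)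
\<close>

definition ringed_space_iso :: "('p, 's) ringed_space \<Rightarrow> ('q, 't) ringed_space \<Rightarrow> bool" where
  "ringed_space_iso X Y \<longleftrightarrow> (\<exists>h \<phi>. homeomorphic_map (sp_top X) (sp_top Y) h \<and>
     (let pre = (\<lambda>V. {x \<in> topspace (sp_top X). h x \<in> V}) in
       (\<forall>V. openin (sp_top Y) V \<longrightarrow>
          \<phi> V \<in> ring_iso (sp_sec Y V) (sp_sec X (pre V)) \<and>
          (\<forall>c. \<phi> V (sp_const Y V c) = sp_const X (pre V) c)) \<and>
       (\<forall>V W. openin (sp_top Y) V \<and> openin (sp_top Y) W \<and> W \<subseteq> V \<longrightarrow>
          (\<forall>s\<in>carrier (sp_sec Y V).
             \<phi> W (sp_res Y V W s) = sp_res X (pre V) (pre W) (\<phi> V s)))))"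


section \<open>Symmetric algebras\<close>

text \<open>A subset, closed under the operations, of a ring given by a type class, as a ring record.\<close>

definition class_ring :: "'a::comm_ring_1 set \<Rightarrow> 'a ring" where
  "class_ring S = \<lparr>carrier = S, monoid.mult = (*), one = 1, zero = 0, add = (+)\<rparr>"

text \<open>
  The symmetric algebra of a module \<open>M\<close> over the subring \<open>R\<close>: the polynomial ring over \<open>R\<close> with one
  variable for each element of \<open>M\<close>, modulo the relations making \<open>M \<rightarrow> sym_alg R M\<close> linear.
  A monomial is the multiset of its variables.
\<close>

type_synonym ('r, 'm) mpoly = "'m multiset \<Rightarrow>\<^sub>0 'r"

definition sym_poly :: "'r::comm_ring_1 set \<Rightarrow> ('r, 'm) module \<Rightarrow> ('r, 'm) mpoly set" where
  "sym_poly R M = {p. range (Poly_Mapping.lookup p) \<subseteq> R \<and>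
     (\<forall>\<mu>\<in>Poly_Mapping.keys p. set_mset \<mu> \<subseteq> carrier M)}"

definition sym_var :: "'m \<Rightarrow> ('r::comm_ring_1, 'm) mpoly" where
  "sym_var D = Poly_Mapping.single {#D#} 1"

definition sym_ideal :: "'r::comm_ring_1 set \<Rightarrow> ('r, 'm) module \<Rightarrow> ('r, 'm) mpoly set" where
  "sym_ideal R M = genideal (class_ring (sym_poly R M))
     ({sym_var (D \<oplus>\<^bsub>M\<^esub> E) - (sym_var D + sym_var E) | D E. D \<in> carrier M \<and> E \<in> carrier M} \<union>
      {sym_var (r \<odot>\<^bsub>M\<^esub> D) - Poly_Mapping.single {#} r * sym_var D | r D. r \<in> R \<and> D \<in> carrier M})"

definition sym_class ::
    "'r::comm_ring_1 set \<Rightarrow> ('r, 'm) module \<Rightarrow> ('r, 'm) mpoly \<Rightarrow> ('r, 'm) mpoly set" where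
  "sym_class R M p = sym_ideal R M +>\<^bsub>class_ring (sym_poly R M)\<^esub> p"

definition sym_alg :: "'r::comm_ring_1 set \<Rightarrow> ('r, 'm) module \<Rightarrow> ('r, 'm) mpoly set ring" where
  "sym_alg R M = class_ring (sym_poly R M) Quot sym_ideal R M"

definition sym_power :: "'r::comm_ring_1 set \<Rightarrow> ('r, 'm) module \<Rightarrow> nat \<Rightarrow> ('r, 'm) mpoly set set" where
  "sym_power R M p =
     sym_class R M ` {q \<in> sym_poly R M. \<forall>\<mu>\<in>Poly_Mapping.keys q. size \<mu> = p}"


section \<open>Symmetric powers of the tangent sheaf of a toric variety\<close>

text \<open>
  \<open>T\<^sub>X\<close> is the sheaf of \<open>\<complex>\<close>-derivations of the structure sheaf: on the affine chart of \<open>\<sigma>\<close> it is the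
  quasi-coherent sheaf of the module of derivations of the coordinate ring.
\<close>

definition derivations :: "'n::finite laurent set \<Rightarrow> ('n::finite laurent, 'n::finite laurent \<Rightarrow> 'n::finite laurent) module" where
  "derivations R = \<lparr>
     carrier = {D \<in> R \<rightarrow>\<^sub>E R.
       (\<forall>f\<in>R. \<forall>g\<in>R. D (f + g) = D f + D g) \<and>
       (\<forall>c. \<forall>f\<in>R. D (lconst c * f) = lconst c * D f) \<and>
       (\<forall>f\<in>R. \<forall>g\<in>R. D (f * g) = f * D g + g * D f)},
     monoid.mult = undefined, one = undefined,
     zero = (\<lambda>f\<in>R. 0),
     add = (\<lambda>D E. \<lambda>f\<in>R. D f + E f),
     smult = (\<lambda>r D. \<lambda>f\<in>R. r * D f)\<rparr>"

type_synonym 'n sym_elt = "('n::finite laurent, 'n::finite laurent \<Rightarrow> 'n::finite laurent) mpoly set"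

abbreviation tan_sym :: "(real ^ 'n) set \<Rightarrow> 'n::finite sym_elt ring" where
  "tan_sym \<sigma> \<equiv> sym_alg (chart_ring \<sigma>) (derivations (chart_ring \<sigma>))"

text \<open>
  Restriction from the chart of \<open>\<sigma>\<close> to the chart of a face \<open>\<tau>\<close>. The coordinate ring of the latter is a
  localization, so that derivations extend uniquely.
\<close>

definition der_ext ::
    "(real ^ 'n) set \<Rightarrow> (real ^ 'n) set \<Rightarrow> ('n::finite laurent \<Rightarrow> 'n::finite laurent) \<Rightarrow> ('n::finite laurent \<Rightarrow> 'n::finite laurent)" where
  "der_ext \<sigma> \<tau> D = (THE E. E \<in> carrier (derivations (chart_ring \<tau>)) \<and>
     (\<forall>f\<in>chart_ring \<sigma>. E f = D f))"

definition sym_res :: "(real ^ 'n) set \<Rightarrow> (real ^ 'n) set \<Rightarrow> 'n::finite sym_elt \<Rightarrow> 'n::finite sym_elt" where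
  "sym_res \<sigma> \<tau> C = (\<Union>p\<in>C. sym_class (chart_ring \<tau>) (derivations (chart_ring \<tau>))
     (\<Sum>\<mu>\<in>Poly_Mapping.keys p.
        Poly_Mapping.single (image_mset (der_ext \<sigma> \<tau>) \<mu>) (Poly_Mapping.lookup p \<mu>)))"

text \<open>
  Global sections of the \<open>p\<close>-th symmetric power of the tangent sheaf: sections over all the charts
  that agree on the intersections, which are the charts of \<open>\<sigma> \<inter> \<tau>\<close>.
\<close>

definition H0_Sym :: "(real ^ 'n) set set \<Rightarrow> nat \<Rightarrow> ((real ^ 'n) set \<Rightarrow> 'n::finite sym_elt) set" where
  "H0_Sym \<Sigma> p =
     {s \<in> (\<Pi>\<^sub>E \<sigma>\<in>\<Sigma>. sym_power (chart_ring \<sigma>) (derivations (chart_ring \<sigma>)) p).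
        \<forall>\<sigma>\<in>\<Sigma>. \<forall>\<tau>\<in>\<Sigma>. sym_res \<sigma> (\<sigma> \<inter> \<tau>) (s \<sigma>) = sym_res \<tau> (\<sigma> \<inter> \<tau>) (s \<tau>)}"

text \<open>The direct sum over all \<open>p\<close>, as a graded algebra.\<close>

definition sym_section_ring :: "(real ^ 'n) set set \<Rightarrow> (nat \<Rightarrow> (real ^ 'n) set \<Rightarrow> 'n::finite sym_elt) calgebra" where
  "sym_section_ring \<Sigma> = \<lparr>
     carrier = {s. (\<forall>p. s p \<in> H0_Sym \<Sigma> p) \<and> finite {p. s p \<noteq> (\<lambda>\<sigma>\<in>\<Sigma>. \<zero>\<^bsub>tan_sym \<sigma>\<^esub>)}},
     monoid.mult = (\<lambda>s t p. \<lambda>\<sigma>\<in>\<Sigma>. \<Oplus>\<^bsub>tan_sym \<sigma>\<^esub>i\<in>{..p}. s i \<sigma> \<otimes>\<^bsub>tan_sym \<sigma>\<^esub> t (p - i) \<sigma>),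
     one = (\<lambda>p. \<lambda>\<sigma>\<in>\<Sigma>. if p = 0 then \<one>\<^bsub>tan_sym \<sigma>\<^esub> else \<zero>\<^bsub>tan_sym \<sigma>\<^esub>),
     zero = (\<lambda>p. \<lambda>\<sigma>\<in>\<Sigma>. \<zero>\<^bsub>tan_sym \<sigma>\<^esub>),
     add = (\<lambda>s t p. \<lambda>\<sigma>\<in>\<Sigma>. s p \<sigma> \<oplus>\<^bsub>tan_sym \<sigma>\<^esub> t p \<sigma>),
     cconst = (\<lambda>c p. \<lambda>\<sigma>\<in>\<Sigma>. if p = 0
       then sym_class (chart_ring \<sigma>) (derivations (chart_ring \<sigma>)) (Poly_Mapping.single {#} (lconst c))
       else \<zero>\<^bsub>tan_sym \<sigma>\<^esub>)\<rparr>"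

definition Z_scheme where
  "Z_scheme \<Sigma> = Spec (sym_section_ring \<Sigma>)"


section \<open>Affine toric hyper-Kaehler varieties\<close>

text \<open>
  The matrix \<open>A\<close> has rows \<open>0, \<dots>, r - 1\<close> and columns indexed by the finite set \<open>I\<close>. A point of
  \<open>\<complex>\<^sup>2\<^sup>N\<close> is a pair \<open>(z, w)\<close> of functions on \<open>I\<close>.
\<close>

type_synonym 'i hk_pt = "('i \<Rightarrow> complex) \<times> ('i \<Rightarrow> complex)"

definition hk_space :: "'i set \<Rightarrow> 'i hk_pt set" where
  "hk_space I = (I \<rightarrow>\<^sub>E UNIV) \<times> (I \<rightarrow>\<^sub>E UNIV)"

definition moment_map :: "(nat \<Rightarrow> 'i \<Rightarrow> int) \<Rightarrow> nat \<Rightarrow> 'i set \<Rightarrow> 'i hk_pt \<Rightarrow> (nat \<Rightarrow> complex)" where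
  "moment_map A r I = (\<lambda>(z, w). \<lambda>j\<in>{..<r}. \<Sum>i\<in>I. of_int (A j i) * z i * w i)"

definition moment_fiber ::
    "(nat \<Rightarrow> 'i \<Rightarrow> int) \<Rightarrow> nat \<Rightarrow> 'i set \<Rightarrow> (nat \<Rightarrow> complex) \<Rightarrow> 'i hk_pt set" where
  "moment_fiber A r I \<xi> = {x \<in> hk_space I. moment_map A r I x = restrict \<xi> {..<r}}"

definition torus :: "nat \<Rightarrow> (nat \<Rightarrow> complex) set" where
  "torus r = {..<r} \<rightarrow>\<^sub>E (UNIV - {0})"

definition torus_weight :: "(nat \<Rightarrow> 'i \<Rightarrow> int) \<Rightarrow> nat \<Rightarrow> (nat \<Rightarrow> complex) \<Rightarrow> 'i \<Rightarrow> complex" where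
  "torus_weight A r t i = (\<Prod>j<r. t j powi A j i)"

definition torus_act ::
    "(nat \<Rightarrow> 'i \<Rightarrow> int) \<Rightarrow> nat \<Rightarrow> 'i set \<Rightarrow> (nat \<Rightarrow> complex) \<Rightarrow> 'i hk_pt \<Rightarrow> 'i hk_pt" where
  "torus_act A r I t = (\<lambda>(z, w). (\<lambda>i\<in>I. torus_weight A r t i * z i,
                                  \<lambda>i\<in>I. inverse (torus_weight A r t i) * w i))"

inductive_set poly_functions :: "'i set \<Rightarrow> ('i hk_pt \<Rightarrow> complex) set" for I where
  const: "(\<lambda>_. c) \<in> poly_functions I"
| coord_z: "i \<in> I \<Longrightarrow> (\<lambda>(z, w). z i) \<in> poly_functions I"
| coord_w: "i \<in> I \<Longrightarrow> (\<lambda>(z, w). w i) \<in> poly_functions I"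
| add: "f \<in> poly_functions I \<Longrightarrow> g \<in> poly_functions I \<Longrightarrow> (\<lambda>x. f x + g x) \<in> poly_functions I"
| mult: "f \<in> poly_functions I \<Longrightarrow> g \<in> poly_functions I \<Longrightarrow> (\<lambda>x. f x * g x) \<in> poly_functions I"

text \<open>Invariant regular functions on the closed subvariety \<open>moment_fiber A r I \<xi>\<close> of affine space.\<close>

definition hk_invariants ::
    "(nat \<Rightarrow> 'i \<Rightarrow> int) \<Rightarrow> nat \<Rightarrow> 'i set \<Rightarrow> (nat \<Rightarrow> complex) \<Rightarrow> ('i hk_pt \<Rightarrow> complex) calgebra" where
  "hk_invariants A r I \<xi> = (let F = moment_fiber A r I \<xi> in \<lparr>
     carrier = {restrict f F | f. f \<in> poly_functions I \<and>
       (\<forall>t\<in>torus r. \<forall>x\<in>F. f (torus_act A r I t x) = f x)},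
     monoid.mult = (\<lambda>f g. \<lambda>x\<in>F. f x * g x),
     one = (\<lambda>x\<in>F. 1),
     zero = (\<lambda>x\<in>F. 0),
     add = (\<lambda>f g. \<lambda>x\<in>F. f x + g x),
     cconst = (\<lambda>c. \<lambda>x\<in>F. c)\<rparr>)"

text \<open>
  The variety \<open>Y(A, 0, \<xi>)\<close>: for the trivial character every point of the fibre is semistable, so
  the quotient is the spectrum of the invariants.
\<close>

definition toric_hyperkaehler where
  "toric_hyperkaehler A r I \<xi> = Spec (hk_invariants A r I \<xi>)"

end

theory Submission
  imports Defs
begin

text \<open>
  Both rings are identified with the same algebra of functions on \<open>T \<times> \<complex>\<^sup>n\<close>, where \<open>T\<close> is the torus
  of the toric variety and \<open>\<complex>\<^sup>n\<close> is the dual of its Lie algebra: the finite sums of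
  \<open>\<chi>\<^sup>m \<cdot> \<Prod>\<^sub>\<rho> \<langle>v\<^sub>\<rho>, y\<rangle>\<^sup>k \<cdot> q(y)\<close> with \<open>q\<close> a polynomial and \<open>k = max(0, -\<langle>v\<^sub>\<rho>, m\<rangle>)\<close>.

  A section of a symmetric power of the tangent sheaf is determined by its symbol, a function
  on \<open>T \<times> \<complex>\<^sup>n\<close>. Smoothness makes every cone part of a lattice basis, so that on the chart of a cone
  \<open>\<sigma>\<close> the derivations are free on \<open>\<chi>\<^sup>-\<^sup>u \<cdot> \<partial>\<^sub>v\<close>; the symbols are the sums above with the product taken
  over the rays of \<open>\<sigma>\<close> only. Intersecting over the charts gives all the rays, because linear forms
  belonging to rays with simultaneously negative pairings are coprime.

  An invariant polynomial on the zero fibre of the moment map is a sum of monomials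
  \<open>z\<^sup>a w\<^sup>b\<close> with \<open>a - b\<close> in the kernel of \<open>A\<close>, that is, \<open>a - b = B m\<close>. Pulling back along
  \<open>z\<^sub>\<rho> = s\<^sup>D\<close>, \<open>w\<^sub>\<rho> = \<langle>v\<^sub>\<rho>, y\<rangle> / z\<^sub>\<rho>\<close>, with \<open>D\<close> a left inverse of \<open>B\<close>, turns it into
  \<open>\<chi>\<^sup>m \<cdot> \<Prod>\<^sub>\<rho> \<langle>v\<^sub>\<rho>, y\<rangle>\<^sup>b\<close>; by exactness the fibre is cut out by \<open>z\<^sub>\<rho> w\<^sub>\<rho> = \<langle>v\<^sub>\<rho>, y\<rangle>\<close>,
  and no nonzero invariant is lost.
\<close>

section \<open>Characters and polynomial functions\<close>

text \<open>The two rings have unrelated presentations, one by residue classes glued over charts,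
  the other by functions on a fibre; realizing both as functions on one fixed space turns relations,
  gluing and invariance into statements about values. Three points shape the work. Smoothness is
  given by dimensions of tangent spaces, so lattice bases must be produced by counting independent
  tangent vectors. Opposite rays have proportional linear forms; but their generators pair with m
  with opposite signs, so at most one of the two forms occurs with a positive exponent, and only
  then is coprimality asked for. The parametrization of the fibre reaches only points with all z
  nonzero; it still separates invariants, because it determines the coefficient polynomials of an
  invariant. Independence of characters is stated for abstract functions because it is applied to
  exponents of Laurent polynomials, to monomials in derivations and to torus weights.\<close>

lemma characters_independent:
  fixes e :: "'i \<Rightarrow> 'x \<Rightarrow> complex"
  assumes "finite I"
    and "\<And>i x y. i \<in> I \<Longrightarrow> e i (f x y) = e i x * e i y"
    and "\<And>i x. i \<in> I \<Longrightarrow> e i x \<noteq> 0"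
    and "\<And>i j. i \<in> I \<Longrightarrow> j \<in> I \<Longrightarrow> i \<noteq> j \<Longrightarrow> \<exists>x. e i x \<noteq> e j x"
    and "\<And>x. (\<Sum>i\<in>I. c i * e i x) = 0"
  shows "\<forall>i\<in>I. c i = 0"
  using assms
proof (induction I arbitrary: c rule: finite_induct)
  case empty
  then show ?case by simp
next
  case (insert k I)
  \<comment> \<open>Dedekind's argument: subtract \<open>e k x\<close> times the relation at
    \<open>y\<close> from the relation at \<open>f x y\<close>. The term of \<open>k\<close> cancels
    and a relation over \<open>I\<close> remains.\<close>
  have rel: "(\<Sum>i\<in>I. (c i * (e i x - e k x)) * e i y) = 0" for x y
  proof -
    have 1: "c k * (e k x * e k y) + (\<Sum>i\<in>I. c i * (e i x * e i y)) = 0"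
      using insert.prems(4)[of "f x y"] insert.prems(1)[of _ x y] insert.hyps by simp
    have 2: "c k * e k y + (\<Sum>i\<in>I. c i * e i y) = 0"
      using insert.prems(4)[of y] insert.hyps by simp
    have "(\<Sum>i\<in>I. (c i * (e i x - e k x)) * e i y) =
       (\<Sum>i\<in>I. c i * (e i x * e i y)) - e k x * (\<Sum>i\<in>I. c i * e i y)"
      by (simp add: sum_distrib_left flip: sum_subtractf) (simp add: algebra_simps)
    also have "\<dots> = (c k * (e k x * e k y) + (\<Sum>i\<in>I. c i * (e i x * e i y)))
        - e k x * (c k * e k y + (\<Sum>i\<in>I. c i * e i y))"
      by (simp add: algebra_simps)
    finally show ?thesis using 1 2 by simp
  qed
  have "\<forall>i\<in>I. c i * (e i x - e k x) = 0" for x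
    by (rule insert.IH[where c = "\<lambda>i. c i * (e i x - e k x)"]) (use insert.prems rel in auto)
  moreover have "\<exists>x. e i x \<noteq> e k x" if "i \<in> I" for i
    using insert.prems(3)[of i k] that insert.hyps by auto
  ultimately have I: "\<forall>i\<in>I. c i = 0" by fastforce
  have "c k = 0"
    using insert.prems(4) insert.prems(2)[of k] insert.hyps I by auto
  then show ?case using I by simp
qed

text \<open>Serves both pairings: of a character with a point \<open>a\<close> of the Lie algebra,
  which gives \<open>chi\<close>, and of a one-parameter subgroup with a covector
  \<open>y\<close>.\<close>

definition cpair :: "int ^ 'n \<Rightarrow> complex ^ 'n \<Rightarrow> complex" where
  "cpair v y = (\<Sum>i\<in>UNIV. of_int (v $ i) * y $ i)"

definition cvec :: "int ^ 'n \<Rightarrow> complex ^ 'n" where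
  "cvec m = (\<chi> i. of_int (m $ i))"

lemma cpair_zero [simp]: "cpair 0 y = 0" "cpair v 0 = 0"
  by (simp_all add: cpair_def)

lemma cpair_add: "cpair (v + w) y = cpair v y + cpair w y" "cpair v (y + z) = cpair v y + cpair v z"
  by (simp_all add: cpair_def algebra_simps sum.distrib)

lemma cpair_uminus: "cpair (- v) y = - cpair v y" "cpair v (- y) = - cpair v y"
  by (simp_all add: cpair_def sum_negf)

lemma cpair_diff: "cpair (v - w) y = cpair v y - cpair w y" "cpair v (y - z) = cpair v y - cpair v z"
  by (simp_all add: cpair_def algebra_simps sum_subtractf)

lemma cpair_scale: "cpair (k *s v) y = of_int k * cpair v y" "cpair v (c *s y) = c * cpair v y"
  by (simp_all add: cpair_def sum_distrib_left algebra_simps)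

lemma cpair_sum: "cpair (sum f S) y = (\<Sum>x\<in>S. cpair (f x) y)" "cpair v (sum g S) = (\<Sum>x\<in>S. cpair v (g x))"
  by (induction S rule: infinite_finite_induct) (simp_all add: cpair_add)

lemma cpair_axis: "cpair v (axis i c) = of_int (v $ i) * c" "cpair (axis i k) y = of_int k * y $ i"
  by (simp_all add: cpair_def axis_def if_distrib if_distribR cong: if_cong)

lemma cpair_cvec: "cpair v (cvec m) = of_int (pair_int v m)"
  by (simp add: cpair_def cvec_def pair_int_def)

lemma pair_int_zero [simp]: "pair_int 0 m = 0" "pair_int v 0 = 0"
  by (simp_all add: pair_int_def)

lemma pair_int_add: "pair_int (v + w) m = pair_int v m + pair_int w m"
    "pair_int v (m + m') = pair_int v m + pair_int v m'"
  by (simp_all add: pair_int_def algebra_simps sum.distrib)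

lemma pair_int_uminus: "pair_int (- v) m = - pair_int v m" "pair_int v (- m) = - pair_int v m"
  by (simp_all add: pair_int_def sum_negf)

lemma pair_int_diff: "pair_int (v - w) m = pair_int v m - pair_int w m"
    "pair_int v (m - m') = pair_int v m - pair_int v m'"
  by (simp_all add: pair_int_def algebra_simps sum_subtractf)

lemma pair_int_scale: "pair_int (k *s v) m = k * pair_int v m" "pair_int v (k *s m) = k * pair_int v m"
  by (simp_all add: pair_int_def sum_distrib_left algebra_simps)

lemma pair_int_sum: "pair_int (sum f S) m = (\<Sum>x\<in>S. pair_int (f x) m)"
    "pair_int v (sum g S) = (\<Sum>x\<in>S. pair_int v (g x))"
  by (induction S rule: infinite_finite_induct) (simp_all add: pair_int_add)

lemma pair_int_axis: "pair_int v (axis i k) = v $ i * k" "pair_int (axis i k) m = k * m $ i"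
  by (simp_all add: pair_int_def axis_def if_distrib if_distribR cong: if_cong)

text \<open>
  The torus is parametrized by its Lie algebra, so that its characters become functions on all of
  \<open>\<complex>\<^sup>n\<close> and no restriction to nonzero coordinates is needed.
\<close>

definition chi :: "int ^ 'n \<Rightarrow> complex ^ 'n \<Rightarrow> complex" where
  "chi m a = exp (cpair m a)"

lemma chi_nonzero [simp]: "chi m a \<noteq> 0"
  by (simp add: chi_def)

lemma chi_zero [simp]: "chi 0 a = 1"
  by (simp add: chi_def)

lemma chi_add: "chi (m + m') a = chi m a * chi m' a"
  by (simp add: chi_def cpair_add exp_add)

lemma chi_add_right: "chi m (a + b) = chi m a * chi m b"
  by (simp add: chi_def cpair_add exp_add)

lemma chi_uminus: "chi (- m) a = inverse (chi m a)"
  by (simp add: chi_def cpair_uminus exp_minus)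

lemma chi_diff: "chi (m - m') a = chi m a / chi m' a"
  by (simp add: chi_def cpair_diff exp_diff)

lemma chi_scale_nat: "chi (int k *s m) a = chi m a ^ k"
  by (simp add: chi_def cpair_scale exp_of_nat_mult)

lemma chi_sum: "chi (sum f S) a = (\<Prod>x\<in>S. chi (f x) a)"
  by (induction S rule: infinite_finite_induct) (simp_all add: chi_add)

text \<open>Absolute values turn the equation into one between real exponentials, which are
  injective; this avoids the periods of the complex exponential.\<close>

lemma exp_int_ln2_inj:
  assumes "exp (of_int k * of_real (ln 2)) = (exp (of_int l * of_real (ln 2)) :: complex)"
  shows "k = l"
proof -
  have "cmod (exp (of_int k * of_real (ln 2))) = cmod (exp (of_int l * of_real (ln 2)))"
    using assms by simp
  then have "exp (of_int k * ln 2) = exp (of_int l * (ln 2 :: real))"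
    by simp
  then show ?thesis by simp
qed

lemma chi_distinct:
  assumes "m \<noteq> m'"
  shows "\<exists>a. chi m a \<noteq> chi m' a"
proof -
  obtain i where "m $ i \<noteq> m' $ i" using assms by (auto simp: vec_eq_iff)
  then have "chi m (axis i (of_real (ln 2))) \<noteq> chi m' (axis i (of_real (ln 2)))"
    using exp_int_ln2_inj by (auto simp: chi_def cpair_axis)
  then show ?thesis by blast
qed

lemma chi_independent:
  assumes "finite A" "\<And>a. (\<Sum>m\<in>A. c m * chi m a) = 0" "m \<in> A"
  shows "c m = 0"
  using characters_independent[of A chi "(+)" c] assms chi_distinct by (auto simp: chi_add_right)

section \<open>Polynomial functions of the covector and divisibility by linear forms\<close>

inductive_set ypoly :: "(complex ^ 'n \<Rightarrow> complex) set" where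
  const: "(\<lambda>_. c) \<in> ypoly"
| coord: "(\<lambda>y. y $ i) \<in> ypoly"
| add: "p \<in> ypoly \<Longrightarrow> q \<in> ypoly \<Longrightarrow> (\<lambda>y. p y + q y) \<in> ypoly"
| mult: "p \<in> ypoly \<Longrightarrow> q \<in> ypoly \<Longrightarrow> (\<lambda>y. p y * q y) \<in> ypoly"

lemma ypoly_sum: "(\<And>x. x \<in> S \<Longrightarrow> f x \<in> ypoly) \<Longrightarrow> (\<lambda>y. \<Sum>x\<in>S. f x y) \<in> ypoly"
  by (induction S rule: infinite_finite_induct) (auto intro: ypoly.intros)

lemma ypoly_prod: "(\<And>x. x \<in> S \<Longrightarrow> f x \<in> ypoly) \<Longrightarrow> (\<lambda>y. \<Prod>x\<in>S. f x y) \<in> ypoly"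
  by (induction S rule: infinite_finite_induct) (auto intro: ypoly.intros)

lemma ypoly_power: "p \<in> ypoly \<Longrightarrow> (\<lambda>y. p y ^ k) \<in> ypoly"
  by (induction k) (auto intro: ypoly.intros)

lemma ypoly_cpair: "cpair v \<in> ypoly"
  unfolding cpair_def by (intro ypoly_sum ypoly.intros)

lemma ypoly_diff: "p \<in> ypoly \<Longrightarrow> q \<in> ypoly \<Longrightarrow> (\<lambda>y. p y - q y) \<in> ypoly"
  using ypoly.add[OF _ ypoly.mult[OF ypoly.const[of "-1"]], of p q] by simp

text \<open>Restriction to lines is the bridge to one-variable polynomials, which have no zero
  divisors and are determined by their values.\<close>

lemma ypoly_line:
  assumes "p \<in> ypoly"
  shows "\<exists>P. \<forall>t. p (x + t *s d) = poly P t"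
  using assms
proof induction
  case (const c)
  show ?case by (rule exI[of _ "[:c:]"]) simp
next
  case (coord i)
  show ?case by (rule exI[of _ "[:x $ i, d $ i:]"]) simp
next
  case (add p q)
  then show ?case by (metis poly_add)
next
  case (mult p q)
  then show ?case by (metis poly_mult)
qed

text \<open>Irreducibility of affine space: on the line joining the two points both functions are
  nonzero one-variable polynomials, so their product does not vanish identically. The witness lies
  on that line, which matters for points of a hyperplane.\<close>

lemma ypoly_common_nonzero:
  assumes "p \<in> ypoly" "q \<in> ypoly" "p x \<noteq> 0" "q z \<noteq> 0"
  shows "\<exists>t. p (x + t *s (z - x)) \<noteq> 0 \<and> q (x + t *s (z - x)) \<noteq> 0"
proof -
  obtain P Q where P: "\<And>t. p (x + t *s (z - x)) = poly P t" and Q: "\<And>t. q (x + t *s (z - x)) = poly Q t"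
    using ypoly_line assms(1,2) by metis
  have "poly P 0 \<noteq> 0" using P[of 0] assms(3) by simp
  moreover have "poly Q 1 \<noteq> 0" using Q[of 1] assms(4) by simp
  ultimately have "P * Q \<noteq> 0" by auto
  then obtain t where "poly (P * Q) t \<noteq> 0"
    using poly_all_0_iff_0 by metis
  then show ?thesis using P Q by (intro exI[of _ t]) auto
qed

lemma ypoly_cancel:
  assumes "f \<in> ypoly" "p \<in> ypoly" "q \<in> ypoly" "f x \<noteq> 0" "\<And>y. f y * p y = f y * q y"
  shows "p y = q y"
proof (rule ccontr)
  assume "p y \<noteq> q y"
  with ypoly_common_nonzero[of f "\<lambda>y. p y - q y" x y] ypoly_diff assms
  show False by fastforce
qed

lemma ypoly_dvd_linear:
  assumes "p \<in> ypoly" "v \<noteq> 0" "\<And>y. cpair v y = 0 \<Longrightarrow> p y = 0"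
  shows "\<exists>q\<in>ypoly. \<forall>y. p y = cpair v y * q y"
proof -
  obtain i where i: "v $ i \<noteq> 0" using assms(2) by (auto simp: vec_eq_iff)
  \<comment> \<open>Normalized so that subtracting \<open>cpair v y *s e\<close> from
    \<open>y\<close> projects onto the hyperplane \<open>cpair v = 0\<close>.\<close>
  define e :: "complex ^ 'a" where "e = axis i (1 / of_int (v $ i))"
  have e: "cpair v e = 1" using i by (simp add: e_def cpair_axis)
  \<comment> \<open>The change of a polynomial under the projection is divisible by the linear form,
    with no assumption on its zeros: true for coordinates and inherited by sums and products, as for
    difference quotients.\<close>
  have "\<exists>q\<in>ypoly. \<forall>y. p y - p (y - cpair v y *s e) = cpair v y * q y"
    using assms(1)
  proof induction
    case (const c)
    show ?case by (rule bexI[of _ "\<lambda>_. 0"]) (auto intro: ypoly.intros)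
  next
    case (coord i)
    show ?case by (rule bexI[of _ "\<lambda>_. e $ i"]) (auto intro: ypoly.intros)
  next
    case (add p q)
    then obtain p' q' where pq: "p' \<in> ypoly" "q' \<in> ypoly"
      "\<And>y. p y - p (y - cpair v y *s e) = cpair v y * p' y"
      "\<And>y. q y - q (y - cpair v y *s e) = cpair v y * q' y" by blast
    have "p y + q y - (p (y - cpair v y *s e) + q (y - cpair v y *s e)) = cpair v y * (p' y + q' y)" for y
      using pq(3,4)[of y] by (simp add: algebra_simps)
    then show ?case using pq(1,2) by (intro bexI[of _ "\<lambda>y. p' y + q' y"]) (auto intro: ypoly.intros)
  next
    case (mult p q)
    then obtain p' q' where pq: "p' \<in> ypoly" "q' \<in> ypoly"
      "\<And>y. p y - p (y - cpair v y *s e) = cpair v y * p' y"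
      "\<And>y. q y - q (y - cpair v y *s e) = cpair v y * q' y" by blast
    have "p y * q y - p (y - cpair v y *s e) * q (y - cpair v y *s e)
        = cpair v y * (p y * q' y + p' y * (q y - cpair v y * q' y))" for y
    proof -
      have 1: "p (y - cpair v y *s e) = p y - cpair v y * p' y"
        and 2: "q (y - cpair v y *s e) = q y - cpair v y * q' y"
        using pq(3,4)[of y] by (simp_all add: algebra_simps)
      show ?thesis unfolding 1 2 by (simp add: algebra_simps)
    qed
    then show ?case using pq(1,2) mult.hyps
      by (intro bexI[of _ "\<lambda>y. p y * q' y + p' y * (q y - cpair v y * q' y)"])
         (auto intro!: ypoly.add ypoly.mult ypoly_diff ypoly_cpair)
  qed
  moreover have "p (y - cpair v y *s e) = 0" for y
    using e by (intro assms(3)) (simp add: cpair_diff cpair_scale)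
  ultimately show ?thesis by simp
qed

lemma cpair_nonzero: "v \<noteq> 0 \<Longrightarrow> \<exists>y. cpair v y \<noteq> 0"
proof -
  assume "v \<noteq> 0"
  then obtain i where "v $ i \<noteq> 0" by (auto simp: vec_eq_iff)
  then have "cpair v (axis i 1) \<noteq> 0" by (simp add: cpair_axis)
  then show ?thesis by blast
qed

text \<open>A hyperplane is irreducible as well, since the line joining two of its points stays
  inside. For \<open>w = 0\<close> the hyperplane is the whole space.\<close>

lemma ypoly_prod_nonzero:
  assumes "finite R" "\<And>\<rho>. \<rho> \<in> R \<Longrightarrow> f \<rho> \<in> ypoly"
    and "\<And>\<rho>. \<rho> \<in> R \<Longrightarrow> \<exists>y. cpair w y = 0 \<and> f \<rho> y \<noteq> 0"
  shows "\<exists>y. cpair w y = 0 \<and> (\<Prod>\<rho>\<in>R. f \<rho> y) \<noteq> 0"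
  using assms
proof (induction R rule: finite_induct)
  case empty
  then show ?case by (auto intro!: exI[of _ 0])
next
  case (insert k R)
  then obtain y where y: "cpair w y = 0" "(\<Prod>\<rho>\<in>R. f \<rho> y) \<noteq> 0" by auto
  obtain z where z: "cpair w z = 0" "f k z \<noteq> 0" using insert.prems by auto
  obtain t where "(\<Prod>\<rho>\<in>R. f \<rho> (y + t *s (z - y))) \<noteq> 0 \<and> f k (y + t *s (z - y)) \<noteq> 0"
    using ypoly_common_nonzero[of "\<lambda>y. \<Prod>\<rho>\<in>R. f \<rho> y" "f k" y z] insert.prems y z ypoly_prod[of R f] by auto
  then show ?case using insert.hyps y z
    by (intro exI[of _ "y + t *s (z - y)"]) (auto simp: cpair_add cpair_scale cpair_diff)
qed

text \<open>Powers of pairwise non-proportional linear forms are coprime. Unique factorization is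
  avoided by splitting off the factors of one new form singly: the cofactor reached so far vanishes
  on the hyperplane of that form, because the product of the other forms does not vanish identically
  there.\<close>

lemma ypoly_dvd_prod:
  assumes "finite R" "p \<in> ypoly"
    and "\<And>\<rho>. \<rho> \<in> R \<Longrightarrow> v \<rho> \<noteq> 0"
    and "\<And>\<rho> \<rho>'. \<rho> \<in> R \<Longrightarrow> \<rho>' \<in> R \<Longrightarrow> \<rho> \<noteq> \<rho>' \<Longrightarrow> k \<rho> > 0 \<Longrightarrow> k \<rho>' > 0 \<Longrightarrow>
       \<exists>y. cpair (v \<rho>) y = 0 \<and> cpair (v \<rho>') y \<noteq> 0"
    and "\<And>\<rho>. \<rho> \<in> R \<Longrightarrow> \<exists>q\<in>ypoly. \<forall>y. p y = cpair (v \<rho>) y ^ k \<rho> * q y"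
  shows "\<exists>q\<in>ypoly. \<forall>y. p y = (\<Prod>\<rho>\<in>R. cpair (v \<rho>) y ^ k \<rho>) * q y"
  using assms
proof (induction R rule: finite_induct)
  case empty
  then show ?case by auto
next
  case (insert \<rho> R)
  have "\<exists>q\<in>ypoly. \<forall>y. p y = (\<Prod>\<rho>\<in>R. cpair (v \<rho>) y ^ k \<rho>) * q y"
    by (rule insert.IH[OF insert.prems(1)]; rule insert.prems; simp)
  then obtain q where q: "q \<in> ypoly" "\<And>y. p y = (\<Prod>\<rho>\<in>R. cpair (v \<rho>) y ^ k \<rho>) * q y"
    by blast
  obtain q' where q': "q' \<in> ypoly" "\<And>y. p y = cpair (v \<rho>) y ^ k \<rho> * q' y"
    using insert.prems by blast
  let ?P = "\<lambda>y. \<Prod>\<rho>\<in>R. cpair (v \<rho>) y ^ k \<rho>"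
  have P: "?P \<in> ypoly" by (intro ypoly_prod ypoly_power ypoly_cpair)
  have "j \<le> k \<rho> \<Longrightarrow> \<exists>q\<in>ypoly. \<forall>y. p y = ?P y * cpair (v \<rho>) y ^ j * q y" for j
  proof (induction j)
    case 0
    then show ?case using q by auto
  next
    case (Suc j)
    then obtain q where q: "q \<in> ypoly" "\<And>y. p y = ?P y * cpair (v \<rho>) y ^ j * q y" by auto
    obtain x where x: "cpair (v \<rho>) x \<noteq> 0" using cpair_nonzero insert.prems by blast
    \<comment> \<open>Two factorizations of \<open>p\<close> share the factor
      \<open>cpair (v \<rho>) y ^ j\<close>; cancelling it leaves a positive power of the form on
      the left, since \<open>j < k \<rho>\<close>.\<close>
    have c: "cpair (v \<rho>) y ^ (k \<rho> - j) * q' y = ?P y * q y" for y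
    proof (rule ypoly_cancel[of "\<lambda>y. cpair (v \<rho>) y ^ j" _ _ x])
      show "cpair (v \<rho>) y ^ j * (cpair (v \<rho>) y ^ (k \<rho> - j) * q' y) = cpair (v \<rho>) y ^ j * (?P y * q y)" for y
      proof -
        have "cpair (v \<rho>) y ^ k \<rho> = cpair (v \<rho>) y ^ j * cpair (v \<rho>) y ^ (k \<rho> - j)"
          using Suc.prems by (simp flip: power_add)
        then show ?thesis using q(2)[of y] q'(2)[of y] by (simp only: mult.assoc mult.left_commute)
      qed
    qed (use x q q' P in \<open>auto intro!: ypoly.mult ypoly_power ypoly_cpair\<close>)
    have kpos: "k \<rho> > 0" using Suc.prems by simp
    have "\<exists>y. cpair (v \<rho>) y = 0 \<and> ?P y \<noteq> 0"
    proof (rule ypoly_prod_nonzero)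
      show "\<exists>y. cpair (v \<rho>) y = 0 \<and> cpair (v \<rho>') y ^ k \<rho>' \<noteq> 0" if "\<rho>' \<in> R" for \<rho>'
      proof (cases "k \<rho>' = 0")
        case True
        then show ?thesis by (auto intro!: exI[of _ 0])
      next
        case False
        then show ?thesis using insert.prems(3)[of \<rho> \<rho>'] kpos that insert.hyps by auto
      qed
    qed (use insert.hyps in \<open>auto intro: ypoly_power ypoly_cpair\<close>)
    then obtain z where z: "cpair (v \<rho>) z = 0" "?P z \<noteq> 0" by blast
    \<comment> \<open>By \<open>c\<close> the product \<open>?P y * q y\<close> vanishes on the
      hyperplane. If \<open>q y\<close> were nonzero, the line from \<open>z\<close> to
      \<open>y\<close>, which stays in the hyperplane, would contain a point where neither factor
      vanishes.\<close>
    have "q y = 0" if y: "cpair (v \<rho>) y = 0" for y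
    proof (rule ccontr)
      assume "q y \<noteq> 0"
      then obtain t where t: "?P (z + t *s (y - z)) \<noteq> 0" "q (z + t *s (y - z)) \<noteq> 0"
        using ypoly_common_nonzero[OF P q(1) z(2)] by blast
      have "cpair (v \<rho>) (z + t *s (y - z)) = 0"
        using y z by (simp add: cpair_add cpair_scale cpair_diff)
      then show False using c[of "z + t *s (y - z)"] t Suc.prems by (simp add: zero_power)
    qed
    then obtain q2 where "q2 \<in> ypoly" "\<And>y. q y = cpair (v \<rho>) y * q2 y"
      using ypoly_dvd_linear[of q "v \<rho>"] q(1) insert.prems by auto
    then show ?case using q(2) by (intro bexI[of _ q2]) (auto simp: algebra_simps)
  qed
  from this[of "k \<rho>"] show ?case using insert.hyps by (auto simp: algebra_simps)
qed

text \<open>The homogeneous components of \<open>q\<close> are the coefficients in \<open>t\<close>.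
  The degree bound is uniform in \<open>y\<close>, so only finitely many components occur.\<close>

lemma ypoly_homogeneous:
  assumes "q \<in> ypoly"
  shows "\<exists>P N. (\<forall>y t. q (t *s y) = poly (P y) t) \<and> (\<forall>i. (\<lambda>y. Polynomial.coeff (P y) i) \<in> ypoly) \<and> (\<forall>y. Polynomial.degree (P y) \<le> N)"
  using assms
proof induction
  case (const c)
  have "(\<lambda>y::complex^'a. Polynomial.coeff [:c:] i) \<in> ypoly" for i by (rule ypoly.const)
  then show ?case by (intro exI[of _ "\<lambda>_. [:c:]"] exI[of _ 0]) auto
next
  case (coord j)
  have "(\<lambda>y::complex^'a. Polynomial.coeff [:0, y $ j:] i) \<in> ypoly" for i
    by (cases i; cases "i - 1") (auto intro: ypoly.intros simp: coeff_pCons split: nat.splits)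
  then show ?case by (intro exI[of _ "\<lambda>y. [:0, y $ j:]"] exI[of _ 1]) auto
next
  case (add p q)
  then obtain P N Q M where *: "\<And>y t. p (t *s y) = poly (P y) t" "\<And>i. (\<lambda>y. Polynomial.coeff (P y) i) \<in> ypoly"
    "\<And>y. Polynomial.degree (P y) \<le> N" "\<And>y t. q (t *s y) = poly (Q y) t" "\<And>i. (\<lambda>y. Polynomial.coeff (Q y) i) \<in> ypoly"
    "\<And>y. Polynomial.degree (Q y) \<le> M" by metis
  then show ?case
    by (intro exI[of _ "\<lambda>y. P y + Q y"] exI[of _ "max N M"])
       (auto intro!: ypoly.add order_trans[OF degree_add_le_max] max.mono)
next
  case (mult p q)
  then obtain P N Q M where *: "\<And>y t. p (t *s y) = poly (P y) t" "\<And>i. (\<lambda>y. Polynomial.coeff (P y) i) \<in> ypoly"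
    "\<And>y. Polynomial.degree (P y) \<le> N" "\<And>y t. q (t *s y) = poly (Q y) t" "\<And>i. (\<lambda>y. Polynomial.coeff (Q y) i) \<in> ypoly"
    "\<And>y. Polynomial.degree (Q y) \<le> M" by metis
  then show ?case
    by (intro exI[of _ "\<lambda>y. P y * Q y"] exI[of _ "N + M"])
       (auto simp: coeff_mult intro!: ypoly.mult ypoly_sum order_trans[OF degree_mult_le] add_mono)
qed


section \<open>The algebra of symbols\<close>

text \<open>\<open>nat\<close> truncates at 0, so the exponent is the order of the pole of the
  character m along the divisor of \<rho>. Each pole has to be compensated by one factor
  \<open>cpair (v \<rho>) y\<close>, the form that accompanies a simple pole in the symbol of a
  regular vector field.\<close>

definition pole_factor :: "'k set \<Rightarrow> ('k \<Rightarrow> int ^ 'n) \<Rightarrow> int ^ 'n \<Rightarrow> complex ^ 'n \<Rightarrow> complex" where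
  "pole_factor R v m y = (\<Prod>\<rho>\<in>R. cpair (v \<rho>) y ^ nat (- pair_int (v \<rho>) m))"

type_synonym 'n symbol = "complex ^ 'n \<Rightarrow> complex ^ 'n \<Rightarrow> complex"

text \<open>Adding one term per step makes rule induction an induction over finite sums; characters
  may repeat and are collected only when coefficients have to be compared.\<close>

inductive_set symbol_algebra :: "'k set \<Rightarrow> ('k \<Rightarrow> int ^ 'n) \<Rightarrow> 'n symbol set" for R v where
  zero: "(\<lambda>a y. 0) \<in> symbol_algebra R v"
| step: "h \<in> symbol_algebra R v \<Longrightarrow> q \<in> ypoly \<Longrightarrow>
    (\<lambda>a y. h a y + chi m a * pole_factor R v m y * q y) \<in> symbol_algebra R v"

lemma pole_factor_ypoly: "pole_factor R v m \<in> ypoly"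
  unfolding pole_factor_def by (intro ypoly_prod ypoly_power ypoly_cpair)

text \<open>Pole orders are subadditive: max(0, -s - t) is at most max(0, -s) + max(0, -t). The
  surplus powers form \<open>q\<close>; this is why the terms are closed under products.\<close>

lemma pole_factor_mult:
  "\<exists>q\<in>ypoly. \<forall>y. pole_factor R v m y * pole_factor R v m' y = pole_factor R v (m + m') y * q y"
proof -
  let ?k = "\<lambda>\<rho>. nat (- pair_int (v \<rho>) m) + nat (- pair_int (v \<rho>) m') - nat (- pair_int (v \<rho>) (m + m'))"
  have "cpair (v \<rho>) y ^ nat (- pair_int (v \<rho>) m) * cpair (v \<rho>) y ^ nat (- pair_int (v \<rho>) m')
    = cpair (v \<rho>) y ^ nat (- pair_int (v \<rho>) (m + m')) * cpair (v \<rho>) y ^ ?k \<rho>" for \<rho> y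
    by (simp flip: power_add add: pair_int_add)
  then have "pole_factor R v m y * pole_factor R v m' y =
     pole_factor R v (m + m') y * (\<Prod>\<rho>\<in>R. cpair (v \<rho>) y ^ ?k \<rho>)" for y
    by (simp add: pole_factor_def flip: prod.distrib)
  then show ?thesis
    by (intro bexI[of _ "\<lambda>y. \<Prod>\<rho>\<in>R. cpair (v \<rho>) y ^ ?k \<rho>"]) (auto intro!: ypoly_prod ypoly_power ypoly_cpair)
qed

lemma pole_factor_scale:
  "pole_factor R v m (t *s y) = t ^ (\<Sum>\<rho>\<in>R. nat (- pair_int (v \<rho>) m)) * pole_factor R v m y"
  by (simp add: pole_factor_def cpair_scale power_mult_distrib prod.distrib power_sum)

lemma symbol_algebra_gen:
  "q \<in> ypoly \<Longrightarrow> (\<lambda>a y. chi m a * pole_factor R v m y * q y) \<in> symbol_algebra R v"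
  using symbol_algebra.step[OF symbol_algebra.zero, where q = q and m = m and R = R and v = v] by simp

lemma symbol_algebra_ypoly: "q \<in> ypoly \<Longrightarrow> (\<lambda>a y. q y) \<in> symbol_algebra R v"
  using symbol_algebra_gen[where q = q and m = 0 and R = R and v = v] by (simp add: pole_factor_def)

lemma symbol_algebra_add:
  assumes "g \<in> symbol_algebra R v" "h \<in> symbol_algebra R v"
  shows "(\<lambda>a y. g a y + h a y) \<in> symbol_algebra R v"
  using assms(2)
proof induction
  case zero
  then show ?case using assms(1) by simp
next
  case (step h q m)
  from symbol_algebra.step[OF step(3,2), where m = m] show ?case by (simp add: add.assoc)
qed

lemma symbol_algebra_mult:
  assumes "g \<in> symbol_algebra R v" "h \<in> symbol_algebra R v"
  shows "(\<lambda>a y. g a y * h a y) \<in> symbol_algebra R v"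
  using assms(1)
proof induction
  case zero
  then show ?case by (simp add: symbol_algebra.zero)
next
  case (step g p m)
  have "(\<lambda>a y. chi m a * pole_factor R v m y * p y * h a y) \<in> symbol_algebra R v"
    using assms(2)
  proof induction
    case zero
    then show ?case by (simp add: symbol_algebra.zero)
  next
    case (step h q m')
    obtain r where r: "r \<in> ypoly"
      "\<And>y. pole_factor R v m y * pole_factor R v m' y = pole_factor R v (m + m') y * r y"
      using pole_factor_mult by blast
    have "(\<lambda>a y. chi m a * pole_factor R v m y * p y * h a y + chi (m + m') a * pole_factor R v (m + m') y * (r y * (p y * q y)))
       \<in> symbol_algebra R v"
      using step r \<open>p \<in> ypoly\<close> by (intro symbol_algebra.step) (auto intro: ypoly.mult)
    moreover have "chi m a * pole_factor R v m y * p y * h a y + chi (m + m') a * pole_factor R v (m + m') y * (r y * (p y * q y))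
       = chi m a * pole_factor R v m y * p y * (h a y + chi m' a * pole_factor R v m' y * q y)" for a y
    proof -
      have "chi (m + m') a * pole_factor R v (m + m') y * (r y * (p y * q y))
        = chi (m + m') a * (pole_factor R v m y * pole_factor R v m' y) * (p y * q y)"
        by (simp add: r(2))
      then show ?thesis by (simp add: chi_add algebra_simps)
    qed
    ultimately show ?case by simp
  qed
  from symbol_algebra_add[OF step.IH this] show ?case by (simp add: distrib_right)
qed

lemma symbol_algebra_const: "(\<lambda>a y. c) \<in> symbol_algebra R v"
  using symbol_algebra_ypoly[OF ypoly.const] .

lemma symbol_algebra_sum:
  "(\<And>x. x \<in> S \<Longrightarrow> f x \<in> symbol_algebra R v) \<Longrightarrow> (\<lambda>a y. \<Sum>x\<in>S. f x a y) \<in> symbol_algebra R v"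
  by (induction S rule: infinite_finite_induct) (auto intro: symbol_algebra_add symbol_algebra.zero)

text \<open>One term per character, the shape to which independence of characters applies.\<close>

lemma symbol_algebra_expansion:
  assumes "h \<in> symbol_algebra R v"
  shows "\<exists>A q. finite A \<and> (\<forall>m. q m \<in> ypoly) \<and> h = (\<lambda>a y. \<Sum>m\<in>A. chi m a * pole_factor R v m y * q m y)"
  using assms
proof induction
  case zero
  then show ?case by (intro exI[of _ "{}"] exI[of _ "\<lambda>_ _. 0"]) (auto intro: ypoly.const)
next
  case (step h p k)
  from step.IH obtain A q where A: "finite A" "\<And>m. q m \<in> ypoly"
    "h = (\<lambda>a y. \<Sum>m\<in>A. chi m a * pole_factor R v m y * q m y)" by blast
  let ?q = "\<lambda>m y. (if m \<in> A then q m y else 0) + (if m = k then p y else 0)"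
  have q: "?q m \<in> ypoly" for m
    by (intro ypoly.add; cases "m \<in> A"; cases "m = k") (simp_all add: ypoly.const A step)
  have "(\<Sum>m\<in>insert k A. chi m a * pole_factor R v m y * ?q m y) =
     (\<Sum>m\<in>A. chi m a * pole_factor R v m y * q m y) + chi k a * pole_factor R v k y * p y" for a y
  proof -
    have "(\<Sum>m\<in>insert k A. chi m a * pole_factor R v m y * ?q m y) =
     (\<Sum>m\<in>insert k A. if m \<in> A then chi m a * pole_factor R v m y * q m y else 0) +
     (\<Sum>m\<in>insert k A. if m = k then chi m a * pole_factor R v m y * p y else 0)"
      unfolding sum.distrib[symmetric] by (intro sum.cong) (auto simp: algebra_simps)
    also have "(\<Sum>m\<in>insert k A. if m \<in> A then chi m a * pole_factor R v m y * q m y else 0) =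
        (\<Sum>m\<in>A. chi m a * pole_factor R v m y * q m y)"
      by (rule sum.mono_neutral_cong_right) (use A in auto)
    finally show ?thesis using A(1) by (simp add: sum.delta)
  qed
  then show ?case using A q by (intro exI[of _ "insert k A"] exI[of _ ?q]) auto
qed

lemma symbol_coefficients_unique:
  assumes "finite A" "\<And>a. (\<Sum>m\<in>A. chi m a * p m y) = 0" "m \<in> A"
  shows "p m y = 0"
  using chi_independent[of A "\<lambda>m. p m y" m] assms by (simp add: mult.commute)

lemma pole_factor_nonzero:
  assumes "finite R" "\<And>\<rho>. \<rho> \<in> R \<Longrightarrow> v \<rho> \<noteq> 0"
  shows "\<exists>y. pole_factor R v m y \<noteq> 0"
  using ypoly_prod_nonzero[of R "\<lambda>\<rho> y. cpair (v \<rho>) y ^ nat (- pair_int (v \<rho>) m)" 0] assms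
    cpair_nonzero ypoly_power[OF ypoly_cpair]
  unfolding pole_factor_def by fastforce

text \<open>The algebra is graded by degree in \<open>y\<close>: a pole factor is homogeneous, so it
  only shifts the components of \<open>q\<close>, by the number of its linear factors.\<close>

lemma symbol_algebra_homogeneous:
  assumes "h \<in> symbol_algebra R v"
  shows "\<exists>P N. (\<forall>a y t. h a (t *s y) = poly (P a y) t) \<and>
    (\<forall>i. (\<lambda>a y. Polynomial.coeff (P a y) i) \<in> symbol_algebra R v) \<and> (\<forall>a y. Polynomial.degree (P a y) \<le> N)"
  using assms
proof induction
  case zero
  then show ?case by (intro exI[of _ "\<lambda>_ _. 0"]) (auto intro: symbol_algebra.zero)
next
  case (step h q m)
  from step.IH obtain P N where P: "\<And>a y t. h a (t *s y) = poly (P a y) t"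
    "\<And>i. (\<lambda>a y. Polynomial.coeff (P a y) i) \<in> symbol_algebra R v" "\<And>a y. Polynomial.degree (P a y) \<le> N"
    by blast
  obtain Q M where Q: "\<And>y t. q (t *s y) = poly (Q y) t" "\<And>i. (\<lambda>y. Polynomial.coeff (Q y) i) \<in> ypoly"
    "\<And>y. Polynomial.degree (Q y) \<le> M" using ypoly_homogeneous[OF step(2)] by metis
  define k where "k = (\<Sum>\<rho>\<in>R. nat (- pair_int (v \<rho>) m))"
  let ?P = "\<lambda>a y. P a y + Polynomial.smult (chi m a * pole_factor R v m y) (Polynomial.monom 1 k * Q y)"
  have "(\<lambda>a y. Polynomial.coeff (?P a y) i) \<in> symbol_algebra R v" for i
    unfolding coeff_add Polynomial.coeff_smult Polynomial.coeff_monom_mult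
    by (intro symbol_algebra_add symbol_algebra_gen P; cases "i < k"; simp add: Q ypoly.const)
  moreover have "Polynomial.degree (?P a y) \<le> max N (k + M)" for a y
    by (intro order_trans[OF degree_add_le_max] max.mono P order_trans[OF degree_smult_le]
         order_trans[OF degree_mult_le] add_mono degree_monom_le Q)
  moreover have "h a (t *s y) + chi m a * pole_factor R v m (t *s y) * q (t *s y) = poly (?P a y) t" for a y t
    by (simp add: P Q pole_factor_scale k_def[symmetric] poly_monom algebra_simps)
  ultimately show ?case by (intro exI[of _ ?P] exI[of _ "max N (k + M)"]) blast
qed

lemma poly_eq_from_values: "(\<And>t::complex. poly p t = poly q t) \<Longrightarrow> p = q"
  by (metis poly_eq_poly_eq_iff ext)

lemma homogeneous_coeff:
  fixes P :: "complex ^ 'n \<Rightarrow> complex poly"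
  assumes "\<And>y t. f (t *s y) = poly (P y) t"
  shows "Polynomial.coeff (P (s *s y)) i = s ^ i * Polynomial.coeff (P y) i"
proof -
  have "P (s *s y) = pcompose (P y) [:0, s:]"
    by (rule poly_eq_from_values) (simp add: assms[symmetric] poly_pcompose mult.commute)
  then show ?thesis by (simp add: coeff_pcompose_linear)
qed

text \<open>Independence of characters makes the coefficient of each character, as a function of
  \<open>y\<close>, the same in the expansions for all rays. That one polynomial is divisible by the
  power belonging to every ray, hence by their product.\<close>

lemma symbol_algebra_Int:
  fixes v :: "'k \<Rightarrow> int ^ 'n"
  assumes R: "finite R" "R \<noteq> {}" and v: "\<And>\<rho>. \<rho> \<in> R \<Longrightarrow> v \<rho> \<noteq> 0"
    and indep: "\<And>\<rho> \<rho>' m. \<rho> \<in> R \<Longrightarrow> \<rho>' \<in> R \<Longrightarrow> \<rho> \<noteq> \<rho>' \<Longrightarrow> pair_int (v \<rho>) m < 0 \<Longrightarrow> pair_int (v \<rho>') m < 0 \<Longrightarrow>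
       \<exists>y. cpair (v \<rho>) y = 0 \<and> cpair (v \<rho>') y \<noteq> 0"
    and h: "\<And>\<rho>. \<rho> \<in> R \<Longrightarrow> h \<in> symbol_algebra {\<rho>} v"
  shows "h \<in> symbol_algebra R v"
proof -
  have "\<forall>\<rho>\<in>R. \<exists>A q. finite A \<and> (\<forall>m. q m \<in> ypoly) \<and> h = (\<lambda>a y. \<Sum>m\<in>A. chi m a * pole_factor {\<rho>} v m y * q m y)"
    using symbol_algebra_expansion[OF h] by blast
  from bchoice[OF this] obtain A where "\<forall>\<rho>\<in>R. \<exists>q. finite (A \<rho>) \<and> (\<forall>m. q m \<in> ypoly) \<and>
    h = (\<lambda>a y. \<Sum>m\<in>A \<rho>. chi m a * pole_factor {\<rho>} v m y * q m y)" ..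
  from bchoice[OF this] obtain q where A: "\<And>\<rho>. \<rho> \<in> R \<Longrightarrow> finite (A \<rho>)" "\<And>\<rho> m. \<rho> \<in> R \<Longrightarrow> q \<rho> m \<in> ypoly"
    "\<And>\<rho>. \<rho> \<in> R \<Longrightarrow> h = (\<lambda>a y. \<Sum>m\<in>A \<rho>. chi m a * pole_factor {\<rho>} v m y * q \<rho> m y)"
    by blast
  define B where "B = (\<Union>\<rho>\<in>R. A \<rho>)"
  have B: "finite B" using A R by (auto simp: B_def)
  \<comment> \<open>Extended by 0, so that all expansions run over the common index set
    \<open>B\<close> and can be subtracted.\<close>
  define c where "c = (\<lambda>\<rho> m y. if m \<in> A \<rho> then pole_factor {\<rho>} v m y * q \<rho> m y else 0)"
  have hc: "h a y = (\<Sum>m\<in>B. chi m a * c \<rho> m y)" if "\<rho> \<in> R" for \<rho> a y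
  proof -
    have "h a y = (\<Sum>m\<in>A \<rho>. chi m a * pole_factor {\<rho>} v m y * q \<rho> m y)" by (subst A(3)[OF that]) simp
    also have "\<dots> = (\<Sum>m\<in>B. chi m a * c \<rho> m y)"
      by (rule sum.mono_neutral_cong_left) (use B that in \<open>auto simp: B_def c_def\<close>)
    finally show ?thesis .
  qed
  have c_eq: "c \<rho> m y = c \<rho>' m y" if "\<rho> \<in> R" "\<rho>' \<in> R" "m \<in> B" for \<rho> \<rho>' m y
  proof -
    have "(\<Sum>m\<in>B. chi m a * (c \<rho> m y - c \<rho>' m y)) = 0" for a
      using hc[OF that(1), of a y] hc[OF that(2), of a y]
      by (simp add: right_diff_distrib sum_subtractf)
    then have "c \<rho> m y - c \<rho>' m y = 0"
      using symbol_coefficients_unique[of B "\<lambda>m y. c \<rho> m y - c \<rho>' m y" y m] B that(3) by blast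
    then show ?thesis by simp
  qed
  obtain \<rho>0 where \<rho>0: "\<rho>0 \<in> R" using R by blast
  have "\<exists>r\<in>ypoly. \<forall>y. c \<rho>0 m y = pole_factor R v m y * r y" if m: "m \<in> B" for m
    unfolding pole_factor_def
  proof (rule ypoly_dvd_prod[OF R(1)])
    show "c \<rho>0 m \<in> ypoly"
      unfolding c_def by (cases "m \<in> A \<rho>0") (use A(2)[OF \<rho>0] in \<open>auto intro!: ypoly.mult ypoly.const pole_factor_ypoly\<close>)
    show "\<exists>r\<in>ypoly. \<forall>y. c \<rho>0 m y = cpair (v \<rho>) y ^ nat (- pair_int (v \<rho>) m) * r y" if "\<rho> \<in> R" for \<rho>
    proof (cases "m \<in> A \<rho>")
      case True
      then show ?thesis using c_eq[OF \<rho>0 that m] A(2)[OF that]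
        by (intro bexI[of _ "q \<rho> m"]) (auto simp: c_def pole_factor_def)
    next
      case False
      then show ?thesis using c_eq[OF \<rho>0 that m]
        by (intro bexI[of _ "\<lambda>_. 0"]) (auto simp: c_def intro: ypoly.const)
    qed
  qed (use v indep in auto)
  then obtain r where r: "\<And>m. m \<in> B \<Longrightarrow> r m \<in> ypoly" "\<And>m y. m \<in> B \<Longrightarrow> c \<rho>0 m y = pole_factor R v m y * r m y"
    by metis
  have "h = (\<lambda>a y. \<Sum>m\<in>B. chi m a * pole_factor R v m y * r m y)"
    using hc[OF \<rho>0] r(2) by (intro ext) (auto simp: mult.assoc intro!: sum.cong)
  also have "\<dots> \<in> symbol_algebra R v"
    by (intro symbol_algebra_sum symbol_algebra_gen r)
  finally show ?thesis .
qed

text \<open>Fewer rays demand fewer linear factors; the remaining ones are absorbed into the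
  polynomial. The map \<open>f\<close> translates between the indices of a frame and the rays of a
  fan.\<close>

lemma symbol_algebra_mono:
  assumes "finite R" "inj_on f K" "f ` K \<subseteq> R" "\<And>i. i \<in> K \<Longrightarrow> w i = v (f i)"
  shows "symbol_algebra R v \<subseteq> symbol_algebra K w"
proof
  fix h assume "h \<in> symbol_algebra R v"
  then show "h \<in> symbol_algebra K w"
  proof induction
    case zero
    then show ?case by (rule symbol_algebra.zero)
  next
    case (step h q m)
    have "pole_factor R v m y = pole_factor (f ` K) v m y * pole_factor (R - f ` K) v m y" for y
      unfolding pole_factor_def using prod.subset_diff[OF assms(3,1)] by (simp add: mult.commute)
    moreover have "pole_factor (f ` K) v m y = pole_factor K w m y" for y
      unfolding pole_factor_def by (subst prod.reindex[OF assms(2)]) (simp add: assms(4))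
    ultimately have "chi m a * pole_factor R v m y * q y =
      chi m a * pole_factor K w m y * (pole_factor (R - f ` K) v m y * q y)" for a y by simp
    then have "(\<lambda>a y. h a y + chi m a * pole_factor R v m y * q y) =
      (\<lambda>a y. h a y + chi m a * pole_factor K w m y * (pole_factor (R - f ` K) v m y * q y))"
      by (simp only: mult.assoc)
    then show ?case
      using symbol_algebra.step[OF step(3) ypoly.mult[OF pole_factor_ypoly step(2)], of m "R - f ` K" v] by simp
  qed
qed

section \<open>Functoriality of the spectrum\<close>

lemma topspace_Spec: "topspace (sp_top (Spec R)) = prime_spectrum R" if "cring R" for R :: "('a, 'x) calgebra_scheme"
proof -
  have "\<one>\<^bsub>R\<^esub> \<notin> P" if "P \<in> prime_spectrum R" for P
  proof -
    interpret primeideal P R using that by (simp add: prime_spectrum_def)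
    show ?thesis using one_imp_carrier I_notcarr by blast
  qed
  moreover have "\<one>\<^bsub>R\<^esub> \<in> carrier R" using that by (simp add: cring.cring_simprules)
  ultimately show ?thesis by (auto simp: Spec_def topology_generated_by_topspace)
qed

locale cring_isomorphism = S: cring S + R: cring R
  for S :: "('b, 'y) calgebra_scheme" and R :: "('a, 'x) calgebra_scheme" +
  fixes f
  assumes iso: "f \<in> ring_iso S R"
begin

lemma hom: "f \<in> ring_hom S R" and bij: "bij_betw f (carrier S) (carrier R)"
  using iso by (auto simp: ring_iso_def)

lemma eq_iff: "x \<in> carrier S \<Longrightarrow> y \<in> carrier S \<Longrightarrow> f x = f y \<longleftrightarrow> x = y"
  using bij by (auto simp: bij_betw_def inj_on_def)

lemma surjE: assumes "z \<in> carrier R" obtains x where "x \<in> carrier S" "z = f x"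
  using assms bij by (auto simp: bij_betw_def)

sublocale ring_hom_ring S R f
  by (intro ring_hom_ringI2 S.ring_axioms R.ring_axioms hom)

lemma hom_minus: "x \<in> carrier S \<Longrightarrow> y \<in> carrier S \<Longrightarrow> f (x \<ominus>\<^bsub>S\<^esub> y) = f x \<ominus>\<^bsub>R\<^esub> f y"
  by (simp add: a_minus_def)

definition pull :: "'a set \<Rightarrow> 'b set" where
  "pull P = {x \<in> carrier S. f x \<in> P}"

definition push :: "('b \<times> 'b) set \<Rightarrow> ('a \<times> 'a) set" where
  "push X = map_prod f f ` X"

lemma pull_prime: "P \<in> prime_spectrum R \<Longrightarrow> pull P \<in> prime_spectrum S"
  unfolding prime_spectrum_def pull_def using primeideal_vimage[OF S.is_cring] by blast

lemma mem_pull: "x \<in> carrier S \<Longrightarrow> x \<in> pull P \<longleftrightarrow> f x \<in> P"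
  by (simp add: pull_def)

text \<open>Injectivity of \<open>f\<close> transports the vanishing that defines equality of
  fractions, and surjectivity supplies a preimage for each numerator, denominator and multiplier.
  Hence the image of an equivalence class is again a full class.\<close>

lemma loc_frac_push:
  assumes "a \<in> carrier S" "b \<in> carrier S"
  shows "loc_frac R P (f a) (f b) = push (loc_frac S (pull P) a b)"
proof -
  have *: "(\<exists>u\<in>carrier R - P. u \<otimes>\<^bsub>R\<^esub> (f a \<otimes>\<^bsub>R\<^esub> f d \<ominus>\<^bsub>R\<^esub> f c \<otimes>\<^bsub>R\<^esub> f b) = \<zero>\<^bsub>R\<^esub>) \<longleftrightarrow>
     (\<exists>u\<in>carrier S - pull P. u \<otimes>\<^bsub>S\<^esub> (a \<otimes>\<^bsub>S\<^esub> d \<ominus>\<^bsub>S\<^esub> c \<otimes>\<^bsub>S\<^esub> b) = \<zero>\<^bsub>S\<^esub>)" (is "?L = ?R")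
    if "c \<in> carrier S" "d \<in> carrier S" for c d
  proof -
    have e: "f u \<otimes>\<^bsub>R\<^esub> (f a \<otimes>\<^bsub>R\<^esub> f d \<ominus>\<^bsub>R\<^esub> f c \<otimes>\<^bsub>R\<^esub> f b) = \<zero>\<^bsub>R\<^esub> \<longleftrightarrow>
       u \<otimes>\<^bsub>S\<^esub> (a \<otimes>\<^bsub>S\<^esub> d \<ominus>\<^bsub>S\<^esub> c \<otimes>\<^bsub>S\<^esub> b) = \<zero>\<^bsub>S\<^esub>" if "u \<in> carrier S" for u
    proof -
      have "f u \<otimes>\<^bsub>R\<^esub> (f a \<otimes>\<^bsub>R\<^esub> f d \<ominus>\<^bsub>R\<^esub> f c \<otimes>\<^bsub>R\<^esub> f b) = f (u \<otimes>\<^bsub>S\<^esub> (a \<otimes>\<^bsub>S\<^esub> d \<ominus>\<^bsub>S\<^esub> c \<otimes>\<^bsub>S\<^esub> b))"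
        using that assms \<open>c \<in> carrier S\<close> \<open>d \<in> carrier S\<close> by (simp add: hom_minus)
      moreover have "u \<otimes>\<^bsub>S\<^esub> (a \<otimes>\<^bsub>S\<^esub> d \<ominus>\<^bsub>S\<^esub> c \<otimes>\<^bsub>S\<^esub> b) \<in> carrier S"
        using that assms \<open>c \<in> carrier S\<close> \<open>d \<in> carrier S\<close> by (simp add: S.minus_closed)
      ultimately show ?thesis using eq_iff[of _ "\<zero>\<^bsub>S\<^esub>"] by simp
    qed
    show ?thesis
    proof
      assume ?L
      then obtain u where "u \<in> carrier R - P" "u \<otimes>\<^bsub>R\<^esub> (f a \<otimes>\<^bsub>R\<^esub> f d \<ominus>\<^bsub>R\<^esub> f c \<otimes>\<^bsub>R\<^esub> f b) = \<zero>\<^bsub>R\<^esub>" by blast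
      moreover from this(1) obtain u' where "u' \<in> carrier S" "u = f u'" by (auto elim: surjE)
      ultimately show ?R using e mem_pull by blast
    next
      assume ?R
      then show ?L using e mem_pull by (metis DiffE DiffI hom_closed)
    qed
  qed
  show ?thesis
  proof (rule Set.set_eqI)
    fix p :: "'a \<times> 'a"
    obtain x y where p: "p = (x, y)" by (cases p)
    show "p \<in> loc_frac R P (f a) (f b) \<longleftrightarrow> p \<in> push (loc_frac S (pull P) a b)"
    proof
      assume L: "p \<in> loc_frac R P (f a) (f b)"
      then have "x \<in> carrier R" "y \<in> carrier R" by (auto simp: p loc_frac_def)
      then obtain c d where cd: "c \<in> carrier S" "d \<in> carrier S" "x = f c" "y = f d" by (metis surjE)
      have "(c, d) \<in> loc_frac S (pull P) a b"
        using L *[OF cd(1,2)] cd by (auto simp: p loc_frac_def mem_pull)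
      then show "p \<in> push (loc_frac S (pull P) a b)"
        unfolding p cd(3,4) push_def by force
    next
      assume "p \<in> push (loc_frac S (pull P) a b)"
      then obtain c d where "(c, d) \<in> loc_frac S (pull P) a b" "x = f c" "y = f d"
        by (auto simp: push_def p)
      then show "p \<in> loc_frac R P (f a) (f b)"
        using * by (auto simp: p loc_frac_def mem_pull)
    qed
  qed
qed

lemma localization_subset: "X \<in> carrier (localization S Q) \<Longrightarrow> X \<subseteq> carrier S \<times> carrier S"
  by (auto simp: localization_def loc_frac_def)

lemma localization_push:
  assumes "X \<in> carrier (localization S (pull P))"
  shows "push X \<in> carrier (localization R P)"
proof -
  obtain a b where "X = loc_frac S (pull P) a b" "a \<in> carrier S" "b \<in> carrier S - pull P"
    using assms by (auto simp: localization_def)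
  then have "push X = loc_frac R P (f a) (f b)" "f a \<in> carrier R" "f b \<in> carrier R - P"
    by (auto simp: loc_frac_push mem_pull)
  then show ?thesis by (auto simp: localization_def)
qed

text \<open>Sums and products of fractions are unions over all pairs of representatives, so they are
  transported directly, without a proof that they depend on the classes only.\<close>

lemma push_UN2:
  assumes "X \<subseteq> carrier S \<times> carrier S" "Y \<subseteq> carrier S \<times> carrier S"
    and "\<And>a b c d. a \<in> carrier S \<Longrightarrow> b \<in> carrier S \<Longrightarrow> c \<in> carrier S \<Longrightarrow> d \<in> carrier S \<Longrightarrow>
       F (f a) (f b) (f c) (f d) = push (G a b c d)"
  shows "(\<Union>(a, b)\<in>push X. \<Union>(c, d)\<in>push Y. F a b c d) = push (\<Union>(a, b)\<in>X. \<Union>(c, d)\<in>Y. G a b c d)"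
proof -
  have "(\<Union>(a, b)\<in>push X. \<Union>(c, d)\<in>push Y. F a b c d) = (\<Union>(a, b)\<in>X. \<Union>(c, d)\<in>Y. F (f a) (f b) (f c) (f d))"
    by (force simp: push_def)
  also have "\<dots> = (\<Union>(a, b)\<in>X. \<Union>(c, d)\<in>Y. push (G a b c d))"
    using assms by (intro SUP_cong refl; clarsimp; intro SUP_cong refl; clarsimp) blast
  finally show ?thesis by (simp add: push_def image_UN case_prod_unfold)
qed

lemma push_mult:
  assumes "X \<in> carrier (localization S (pull P))" "Y \<in> carrier (localization S (pull P))"
  shows "push (X \<otimes>\<^bsub>localization S (pull P)\<^esub> Y) = push X \<otimes>\<^bsub>localization R P\<^esub> push Y"
  using assms[THEN localization_subset] unfolding localization_def monoid.simps
  by (intro push_UN2[symmetric]) (simp_all add: loc_frac_push flip: hom_mult)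

lemma push_add:
  assumes "X \<in> carrier (localization S (pull P))" "Y \<in> carrier (localization S (pull P))"
  shows "push (X \<oplus>\<^bsub>localization S (pull P)\<^esub> Y) = push X \<oplus>\<^bsub>localization R P\<^esub> push Y"
  using assms[THEN localization_subset] unfolding localization_def ring_record_simps
  by (intro push_UN2[symmetric]) (simp_all add: loc_frac_push flip: hom_mult hom_add)

lemma push_one: "push \<one>\<^bsub>localization S (pull P)\<^esub> = \<one>\<^bsub>localization R P\<^esub>"
  using loc_frac_push[of "\<one>\<^bsub>S\<^esub>" "\<one>\<^bsub>S\<^esub>" P] by (simp add: localization_def)

definition pre :: "'b set set \<Rightarrow> 'a set set" where
  "pre V = {P \<in> prime_spectrum R. pull P \<in> V}"

definition push_section :: "'b set set \<Rightarrow> ('b set \<Rightarrow> ('b \<times> 'b) set) \<Rightarrow> 'a set \<Rightarrow> ('a \<times> 'a) set" where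
  "push_section V s = (\<lambda>P\<in>pre V. push (s (pull P)))"

lemma push_section_closed:
  assumes "s \<in> spec_sections S V"
  shows "push_section V s \<in> spec_sections R (pre V)"
proof -
  have s: "\<And>Q. Q \<in> V \<Longrightarrow> s Q \<in> carrier (localization S Q)"
    and loc: "\<And>Q. Q \<in> V \<Longrightarrow> \<exists>a\<in>carrier S. \<exists>b\<in>carrier S - Q. \<forall>Q'\<in>V. b \<notin> Q' \<longrightarrow> s Q' = loc_frac S Q' a b"
    using assms by (auto simp: spec_sections_def)
  have "\<exists>a\<in>carrier R. \<exists>b\<in>carrier R - P. \<forall>Q\<in>pre V. b \<notin> Q \<longrightarrow> push_section V s Q = loc_frac R Q a b"
    if P: "P \<in> pre V" for P
  proof -
    have "pull P \<in> V" using P by (simp add: pre_def)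
    from loc[OF this] obtain a b where ab: "a \<in> carrier S" "b \<in> carrier S - pull P"
      "\<And>Q'. Q' \<in> V \<Longrightarrow> b \<notin> Q' \<Longrightarrow> s Q' = loc_frac S Q' a b" by blast
    have "push_section V s Q = loc_frac R Q (f a) (f b)" if "Q \<in> pre V" "f b \<notin> Q" for Q
      using ab that by (simp add: push_section_def loc_frac_push pre_def mem_pull)
    then show ?thesis using ab mem_pull by (intro bexI[of _ "f a"] bexI[of _ "f b"]) auto
  qed
  then show ?thesis
    using s by (auto simp: spec_sections_def push_section_def pre_def intro!: localization_push)
qed

lemma continuous_pull: "continuous_map (sp_top (Spec R)) (sp_top (Spec S)) pull"
proof -
  have "continuous_map (sp_top (Spec R))
      (topology_generated_by {{P \<in> prime_spectrum S. x \<notin> P} | x. x \<in> carrier S}) pull"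
  proof (rule continuous_on_generated_topo)
    fix U assume "U \<in> {{P \<in> prime_spectrum S. x \<notin> P} | x. x \<in> carrier S}"
    then obtain x where x: "x \<in> carrier S" "U = {P \<in> prime_spectrum S. x \<notin> P}" by blast
    have "pull -` U \<inter> prime_spectrum R = {P \<in> prime_spectrum R. f x \<notin> P}"
      using x mem_pull pull_prime by auto
    moreover have "openin (sp_top (Spec R)) {P \<in> prime_spectrum R. f x \<notin> P}"
      unfolding Spec_def ringed_space.simps by (rule topology_generated_by_Basis) (use x in auto)
    ultimately show "openin (sp_top (Spec R)) (pull -` U \<inter> topspace (sp_top (Spec R)))"
      by (simp add: topspace_Spec R.is_cring)
  next
    show "pull ` topspace (sp_top (Spec R)) \<subseteq> \<Union> {{P \<in> prime_spectrum S. x \<notin> P} | x. x \<in> carrier S}"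
      using topspace_Spec[OF S.is_cring] pull_prime
      by (auto simp: topspace_Spec R.is_cring Spec_def topology_generated_by_topspace)
  qed
  then show ?thesis by (simp add: Spec_def)
qed

lemma push_section_mult:
  assumes "s \<in> spec_sections S V" "t \<in> spec_sections S V"
  shows "push_section V (\<lambda>P\<in>V. s P \<otimes>\<^bsub>localization S P\<^esub> t P) =
     (\<lambda>P\<in>pre V. push_section V s P \<otimes>\<^bsub>localization R P\<^esub> push_section V t P)"
proof -
  have "s P \<in> carrier (localization S P)" "t P \<in> carrier (localization S P)" if "P \<in> V" for P
    using that assms by (auto simp: spec_sections_def)
  then show ?thesis by (auto simp: push_section_def push_mult pre_def intro!: restrict_ext)
qed

lemma push_section_add:
  assumes "s \<in> spec_sections S V" "t \<in> spec_sections S V"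
  shows "push_section V (\<lambda>P\<in>V. s P \<oplus>\<^bsub>localization S P\<^esub> t P) =
     (\<lambda>P\<in>pre V. push_section V s P \<oplus>\<^bsub>localization R P\<^esub> push_section V t P)"
proof -
  have "s P \<in> carrier (localization S P)" "t P \<in> carrier (localization S P)" if "P \<in> V" for P
    using that assms by (auto simp: spec_sections_def)
  then show ?thesis by (auto simp: push_section_def push_add pre_def intro!: restrict_ext)
qed

lemma push_section_one:
  "push_section V (\<lambda>P\<in>V. \<one>\<^bsub>localization S P\<^esub>) = (\<lambda>P\<in>pre V. \<one>\<^bsub>localization R P\<^esub>)"
  by (auto simp: push_section_def push_one pre_def intro!: restrict_ext)

end

text \<open>Points are pulled back along \<open>f\<close> while fractions are pushed forward. The
  same two constructions for the inverse map \<open>g\<close> provide the inverses on points and on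
  sections.\<close>

lemma Spec_iso:
  fixes R :: "('a, 'x) calgebra_scheme" and S :: "('b, 'y) calgebra_scheme"
  assumes "cring S" "cring R" "f \<in> ring_iso S R"
    and const: "\<And>c. cconst S c \<in> carrier S" "\<And>c. f (cconst S c) = cconst R c"
  shows "ringed_space_iso (Spec R) (Spec S)"
proof -
  define g where "g = inv_into (carrier S) f"
  have bij: "bij_betw f (carrier S) (carrier R)" using assms(3) by (simp add: ring_iso_def)
  interpret F: cring_isomorphism S R f
    by (intro cring_isomorphism.intro cring_isomorphism_axioms.intro assms)
  interpret G: cring_isomorphism R S g
    unfolding g_def
    by (intro cring_isomorphism.intro cring_isomorphism_axioms.intro assms ring_iso_set_sym F.R.ring_axioms F.S.ring_axioms)
  have gf: "g (f x) = x" if "x \<in> carrier S" for x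
    unfolding g_def using bij that by (simp add: bij_betw_def)
  have fg: "f (g x) = x" if "x \<in> carrier R" for x
    unfolding g_def using bij that by (simp add: bij_betw_def f_inv_into_f)
  have sub: "P \<subseteq> carrier R" if "P \<in> prime_spectrum R" for P
    using that by (auto simp: prime_spectrum_def primeideal_def dest: ideal.Icarr)
  have sub': "P \<subseteq> carrier S" if "P \<in> prime_spectrum S" for P
    using that by (auto simp: prime_spectrum_def primeideal_def dest: ideal.Icarr)
  have GF: "G.pull (F.pull P) = P" if "P \<in> prime_spectrum R" for P
    using sub[OF that] fg by (auto simp: G.pull_def F.pull_def)
  have FG: "F.pull (G.pull P) = P" if "P \<in> prime_spectrum S" for P
    using sub'[OF that] gf by (auto simp: G.pull_def F.pull_def)
  have pp: "F.push (G.push X) = X" if "X \<subseteq> carrier R \<times> carrier R" for X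
  proof -
    have "map_prod f f (map_prod g g p) = p" if "p \<in> X" for p
      using that \<open>X \<subseteq> carrier R \<times> carrier R\<close> fg by (cases p) auto
    then show ?thesis by (simp add: F.push_def G.push_def image_image)
  qed
  have pp': "G.push (F.push X) = X" if "X \<subseteq> carrier S \<times> carrier S" for X
  proof -
    have "map_prod g g (map_prod f f p) = p" if "p \<in> X" for p
      using that \<open>X \<subseteq> carrier S \<times> carrier S\<close> gf by (cases p) auto
    then show ?thesis by (simp add: F.push_def G.push_def image_image)
  qed
  have homeo: "homeomorphic_map (sp_top (Spec R)) (sp_top (Spec S)) F.pull"
    using F.continuous_pull G.continuous_pull GF FG
    by (intro homeomorphic_maps_imp_map[of _ _ _ G.pull])
       (auto simp: homeomorphic_maps_def topspace_Spec assms)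
  have pre: "{x \<in> topspace (sp_top (Spec R)). F.pull x \<in> V} = F.pre V" for V
    by (simp add: F.pre_def topspace_Spec assms)
  have V: "V \<subseteq> prime_spectrum S" if "openin (sp_top (Spec S)) V" for V
    using openin_subset[OF that] by (simp add: topspace_Spec assms)
  have "F.push_section V \<in> ring_iso (sp_sec (Spec S) V) (sp_sec (Spec R) (F.pre V))"
    if "openin (sp_top (Spec S)) V" for V
  proof (rule ring_iso_memI)
    have VS: "V \<subseteq> prime_spectrum S" using V[OF that] .
    have GV: "G.pre (F.pre V) = V"
      using VS FG G.pull_prime by (auto simp: G.pre_def F.pre_def)
    have carrier: "s Q \<subseteq> carrier S \<times> carrier S" if "s \<in> spec_sections S V" "Q \<in> V" for s Q
      using that F.localization_subset by (auto simp: spec_sections_def)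
    have carrier': "s Q \<subseteq> carrier R \<times> carrier R" if "s \<in> spec_sections R (F.pre V)" "Q \<in> F.pre V" for s Q
      using that G.localization_subset by (auto simp: spec_sections_def)
    have inj: "G.push_section (F.pre V) (F.push_section V s) = s" if s: "s \<in> spec_sections S V" for s
    proof
      fix Q
      show "G.push_section (F.pre V) (F.push_section V s) Q = s Q"
      proof (cases "Q \<in> V")
        case True
        then have "G.pull Q \<in> F.pre V" "F.pull (G.pull Q) = Q"
          using VS FG G.pull_prime by (auto simp: F.pre_def)
        with True show ?thesis
          by (simp add: G.push_section_def F.push_section_def GV pp' carrier s)
      next
        case False
        then show ?thesis using s by (auto simp: G.push_section_def GV spec_sections_def)
      qed
    qed
    have surj: "F.push_section V (G.push_section (F.pre V) t) = t" if t: "t \<in> spec_sections R (F.pre V)" for t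
    proof
      fix P
      show "F.push_section V (G.push_section (F.pre V) t) P = t P"
      proof (cases "P \<in> F.pre V")
        case True
        then have "F.pull P \<in> V" "G.pull (F.pull P) = P"
          using GF by (auto simp: F.pre_def)
        with True show ?thesis
          by (simp add: G.push_section_def F.push_section_def GV pp carrier' t)
      next
        case False
        then show ?thesis using t by (auto simp: F.push_section_def spec_sections_def)
      qed
    qed
    show "bij_betw (F.push_section V) (carrier (sp_sec (Spec S) V)) (carrier (sp_sec (Spec R) (F.pre V)))"
      using inj surj F.push_section_closed[of _ V] G.push_section_closed[of _ "F.pre V"]
      by (intro bij_betw_byWitness[where f' = "G.push_section (F.pre V)"]) (auto simp: Spec_def GV)
  qed (auto simp: Spec_def F.push_section_closed F.push_section_mult F.push_section_add F.push_section_one)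
  moreover have "F.push_section V (sp_const (Spec S) V c) = sp_const (Spec R) (F.pre V) c"
    if "openin (sp_top (Spec S)) V" for V c
    using F.loc_frac_push[of "cconst S c" "\<one>\<^bsub>S\<^esub>"] const
    by (auto simp: Spec_def F.push_section_def F.pre_def intro!: restrict_ext)
  moreover have "F.push_section W (sp_res (Spec S) V W s) = sp_res (Spec R) (F.pre V) (F.pre W) (F.push_section V s)"
    if "W \<subseteq> V" for V W s
  proof
    fix P
    show "F.push_section W (sp_res (Spec S) V W s) P = sp_res (Spec R) (F.pre V) (F.pre W) (F.push_section V s) P"
      using that by (cases "F.pull P \<in> W") (simp_all add: Spec_def F.push_section_def F.pre_def subset_iff)
  qed
  ultimately show ?thesis
    unfolding ringed_space_iso_def Let_def
    by (intro exI[of _ F.pull] exI[of _ F.push_section]) (simp add: homeo pre)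
qed

section \<open>Lattices and rational cones\<close>

text \<open>A subgroup of a free abelian group of finite rank is free. The induction is on the set
  of coordinates that may be nonzero: the elements vanishing at \<open>a\<close> have a basis, and
  one element with least positive coordinate at \<open>a\<close> completes it.\<close>

lemma subgroup_basis:
  fixes U :: "(int ^ 'n) set"
  assumes "0 \<in> U" "\<And>x y. x \<in> U \<Longrightarrow> y \<in> U \<Longrightarrow> x - y \<in> U"
  shows "\<exists>G. finite G \<and> G \<subseteq> U \<and> (\<forall>u\<in>U. \<exists>c. u = (\<Sum>g\<in>G. c g *s g)) \<and>
    (\<forall>c. (\<Sum>g\<in>G. c g *s g) = 0 \<longrightarrow> (\<forall>g\<in>G. c g = 0))"
proof -
  have "\<exists>G. finite G \<and> G \<subseteq> U \<and> (\<forall>u\<in>U. \<exists>c. u = (\<Sum>g\<in>G. c g *s g)) \<and>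
    (\<forall>c. (\<Sum>g\<in>G. c g *s g) = 0 \<longrightarrow> (\<forall>g\<in>G. c g = 0))"
    if "finite A" "0 \<in> U" "\<And>x y. x \<in> U \<Longrightarrow> y \<in> U \<Longrightarrow> x - y \<in> U" "\<And>u i. u \<in> U \<Longrightarrow> i \<notin> A \<Longrightarrow> u $ i = 0"
    for A and U :: "(int ^ 'n) set"
    using that
  proof (induction A arbitrary: U rule: finite_induct)
    case empty
    then have "u = 0" if "u \<in> U" for u using that by (simp add: vec_eq_iff)
    then show ?case by (intro exI[of _ "{}"]) auto
  next
    case (insert a A)
    note sub = insert.prems(2) and zero = insert.prems(1)
    have add: "x + y \<in> U" if "x \<in> U" "y \<in> U" for x y
      using sub[OF that(1) sub[OF zero that(2)]] by simp
    have scale: "k *s x \<in> U" if "x \<in> U" for k x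
    proof -
      have "int n *s x \<in> U" for n
      proof (induction n)
        case (Suc n)
        have "int (Suc n) *s x = x + int n *s x" by (simp add: vec_eq_iff algebra_simps)
        then show ?case using add[OF that Suc] by simp
      qed (simp add: zero)
      moreover have "(- int n) *s x = 0 - int n *s x" for n by (simp add: vec_eq_iff)
      ultimately have "(- int n) *s x \<in> U" for n using sub[OF zero] by metis
      with \<open>\<And>n. int n *s x \<in> U\<close> show ?thesis by (cases k rule: int_cases2) metis+
    qed
    define U' where "U' = {u \<in> U. u $ a = 0}"
    have "\<exists>G. finite G \<and> G \<subseteq> U' \<and> (\<forall>u\<in>U'. \<exists>c. u = (\<Sum>g\<in>G. c g *s g)) \<and>
      (\<forall>c. (\<Sum>g\<in>G. c g *s g) = 0 \<longrightarrow> (\<forall>g\<in>G. c g = 0))"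
    proof (rule insert.IH)
      show "u $ i = 0" if "u \<in> U'" "i \<notin> A" for u i
        using that insert.prems(3)[of u i] by (cases "i = a") (auto simp: U'_def)
    qed (use zero sub in \<open>auto simp: U'_def\<close>)
    then obtain G where G: "finite G" "G \<subseteq> U'" "\<forall>u\<in>U'. \<exists>c. u = (\<Sum>g\<in>G. c g *s g)"
      "\<forall>c. (\<Sum>g\<in>G. c g *s g) = 0 \<longrightarrow> (\<forall>g\<in>G. c g = 0)" by auto
    show ?case
    proof (cases "U' = U")
      case True
      then show ?thesis using G by blast
    next
      case False
      then obtain w where w: "w \<in> U" "w $ a \<noteq> 0" by (auto simp: U'_def)
      \<comment> \<open>The least such value generates the group of all values of the coordinate
        \<open>a\<close> on \<open>U\<close>: a remainder of division by it would be a smaller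
        positive value.\<close>
      define P where "P = (\<lambda>n. n > 0 \<and> (\<exists>u\<in>U. u $ a = int n))"
      have "P (nat \<bar>w $ a\<bar>)"
      proof (cases "w $ a > 0")
        case True
        then show ?thesis using w by (auto simp: P_def intro!: bexI[of _ w])
      next
        case False
        then show ?thesis using w scale[of w "-1"] by (auto simp: P_def intro!: bexI[of _ "(-1) *s w"])
      qed
      then have "P (Least P)" by (rule LeastI)
      then obtain g0 where g0: "g0 \<in> U" "g0 $ a = int (Least P)" and pos: "Least P > 0" by (auto simp: P_def)
      define d where "d = int (Least P)"
      have dvd: "d dvd u $ a" if "u \<in> U" for u
      proof (rule ccontr)
        assume "\<not> d dvd u $ a"
        then have m: "u $ a mod d > 0" "u $ a mod d < d"
        proof -
          have "d > 0" using pos by (simp add: d_def)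
          then have "u $ a mod d \<ge> 0" by simp
          moreover have "u $ a mod d \<noteq> 0" using \<open>\<not> d dvd u $ a\<close> by (simp add: dvd_eq_mod_eq_0)
          ultimately show "u $ a mod d > 0" by linarith
          show "u $ a mod d < d" using \<open>d > 0\<close> by simp
        qed
        have "u - (u $ a div d) *s g0 \<in> U" using that scale g0 sub by blast
        moreover have "(u - (u $ a div d) *s g0) $ a = u $ a mod d"
          using g0 by (simp add: d_def minus_div_mult_eq_mod)
        ultimately have "\<exists>w\<in>U. w $ a = u $ a mod d" by blast
        then have "P (nat (u $ a mod d))" using m by (simp add: P_def)
        then have "Least P \<le> nat (u $ a mod d)" by (rule Least_le)
        then show False using m by (simp add: d_def)
      qed
      have g0G: "g0 \<notin> G" using G(2) g0 pos by (auto simp: U'_def)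
      have "\<exists>c. u = (\<Sum>g\<in>insert g0 G. c g *s g)" if u: "u \<in> U" for u
      proof -
        define k where "k = u $ a div d"
        have "u $ a = k * d" using dvd[OF u] by (simp add: k_def)
        then have "u - k *s g0 \<in> U'" using u scale sub g0 by (auto simp: U'_def d_def)
        then obtain c where c: "u - k *s g0 = (\<Sum>g\<in>G. c g *s g)" using G(3) by blast
        have "(\<Sum>g\<in>G. (c(g0 := k)) g *s g) = (\<Sum>g\<in>G. c g *s g)"
          using g0G by (intro sum.cong) auto
        then have "u = (\<Sum>g\<in>insert g0 G. (c(g0 := k)) g *s g)"
          using g0G G(1) c by (simp add: algebra_simps)
        then show ?thesis by blast
      qed
      moreover have "c g = 0" if c: "(\<Sum>g\<in>insert g0 G. c g *s g) = 0" and g: "g \<in> insert g0 G" for c g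
      proof -
        have "(\<Sum>g\<in>insert g0 G. c g *s g) $ a = c g0 * d + (\<Sum>g\<in>G. c g * g $ a)"
          using g0G G(1) g0 by (simp add: d_def)
        moreover have "(\<Sum>g\<in>G. c g * g $ a) = 0" using G(2) by (intro sum.neutral) (auto simp: U'_def)
        ultimately have c0: "c g0 = 0" using c pos by (simp add: d_def)
        then have "(\<Sum>g\<in>G. c g *s g) = 0" using c g0G G(1) by simp
        then show ?thesis using G(4)[rule_format, of c g] c0 g by blast
      qed
      ultimately show ?thesis using G g0 U'_def by (intro exI[of _ "insert g0 G"]) auto
    qed
  qed
  from this[of UNIV U] assms show ?thesis by simp
qed

section \<open>Rational cones, separation and duality with lattice points\<close>

lemma lat_add: "lat (v + w) = lat v + lat w"
  and lat_scale: "lat (k *s v) = of_int k *\<^sub>R lat v" and lat_zero [simp]: "lat 0 = 0"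
  and lat_uminus: "lat (- v) = - lat v"
  by (simp_all add: lat_def vec_eq_iff)

lemma lat_sum: "lat (sum f A) = (\<Sum>x\<in>A. lat (f x))"
  by (induction A rule: infinite_finite_induct) (simp_all add: lat_add)

lemma lat_inject: "lat v = lat w \<longleftrightarrow> v = w"
  by (simp add: lat_def vec_eq_iff)

lemma lat_inner: "lat v \<bullet> lat m = of_int (pair_int v m)"
  by (simp add: lat_def inner_vec_def pair_int_def)

text \<open>Scale \<open>a\<close> by a large integer and round every coordinate down. Rounding
  changes the product with \<open>x\<close> by at most the sum of the absolute coordinates of
  \<open>x\<close>, which the scaled value exceeds for all of the finitely many
  \<open>x\<close>.\<close>

lemma lattice_point_positive:
  fixes X :: "(real ^ 'n) set"
  assumes "finite X" "\<And>x. x \<in> X \<Longrightarrow> a \<bullet> x > 0"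
  shows "\<exists>m. \<forall>x\<in>X. x \<bullet> lat m > 0"
proof -
  have "\<forall>\<^sub>F k in sequentially. (\<Sum>i\<in>UNIV. \<bar>x $ i\<bar>) < real k * (a \<bullet> x)" if "x \<in> X" for x
  proof -
    have "filterlim (\<lambda>k. real k * (a \<bullet> x)) at_top sequentially"
      using filterlim_tendsto_pos_mult_at_top[OF tendsto_const assms(2)[OF that] filterlim_real_sequentially]
      by (simp add: mult.commute)
    then show ?thesis by (simp add: filterlim_at_top_dense)
  qed
  then have "\<forall>\<^sub>F k in sequentially. \<forall>x\<in>X. (\<Sum>i\<in>UNIV. \<bar>x $ i\<bar>) < real k * (a \<bullet> x)"
    using assms(1) by (simp add: eventually_ball_finite)
  then obtain k :: nat where k: "\<And>x. x \<in> X \<Longrightarrow> (\<Sum>i\<in>UNIV. \<bar>x $ i\<bar>) < real k * (a \<bullet> x)"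
    by (auto simp: eventually_sequentially)
  define m :: "int ^ 'n" where "m = (\<chi> i. \<lfloor>real k * a $ i\<rfloor>)"
  have "x \<bullet> lat m > 0" if "x \<in> X" for x
  proof -
    have "real k * (a \<bullet> x) - x \<bullet> lat m = (\<Sum>i\<in>UNIV. x $ i * (real k * a $ i - of_int \<lfloor>real k * a $ i\<rfloor>))"
      by (simp add: inner_vec_def lat_def m_def sum_distrib_left algebra_simps sum_subtractf)
    also have "\<dots> \<le> (\<Sum>i\<in>UNIV. \<bar>x $ i\<bar>)"
    proof (rule sum_mono)
      fix i
      have "\<bar>x $ i * (real k * a $ i - of_int \<lfloor>real k * a $ i\<rfloor>)\<bar> \<le> \<bar>x $ i\<bar> * 1"
        unfolding abs_mult by (intro mult_left_mono) linarith+
      then show "x $ i * (real k * a $ i - of_int \<lfloor>real k * a $ i\<rfloor>) \<le> \<bar>x $ i\<bar>" by linarith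
    qed
    finally show ?thesis using k[OF that] by linarith
  qed
  then show ?thesis by blast
qed

definition cone_gen :: "(int ^ 'n) set \<Rightarrow> (real ^ 'n) set" where
  "cone_gen S = {\<Sum>s\<in>S. c s *\<^sub>R lat s | c. \<forall>s\<in>S. (0::real) \<le> c s}"

lemma cone_genI: "(\<And>s. s \<in> S \<Longrightarrow> 0 \<le> c s) \<Longrightarrow> (\<Sum>s\<in>S. c s *\<^sub>R lat s) \<in> cone_gen S"
  by (auto simp: cone_gen_def)

lemma cone_gen_zero: "0 \<in> cone_gen S"
  using cone_genI[of S "\<lambda>_. 0"] by simp

lemma cone_gen_scale: "x \<in> cone_gen S \<Longrightarrow> 0 \<le> t \<Longrightarrow> t *\<^sub>R x \<in> cone_gen S"
proof -
  assume "x \<in> cone_gen S" "0 \<le> t"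
  then obtain c where "x = (\<Sum>s\<in>S. c s *\<^sub>R lat s)" "\<And>s. s \<in> S \<Longrightarrow> 0 \<le> c s" by (auto simp: cone_gen_def)
  then show ?thesis using cone_genI[of S "\<lambda>s. t * c s"] \<open>0 \<le> t\<close> by (simp add: scaleR_sum_right)
qed

lemma cone_gen_add:
  assumes "x \<in> cone_gen S" "y \<in> cone_gen S" shows "x + y \<in> cone_gen S"
proof -
  obtain c d where "x = (\<Sum>s\<in>S. c s *\<^sub>R lat s)" "y = (\<Sum>s\<in>S. d s *\<^sub>R lat s)"
    "\<forall>s\<in>S. 0 \<le> c s" "\<forall>s\<in>S. 0 \<le> d s" using assms by (auto simp: cone_gen_def)
  then show ?thesis using cone_genI[of S "\<lambda>s. c s + d s"] by (simp add: scaleR_add_left sum.distrib)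
qed

lemma cone_gen_mem: "finite S \<Longrightarrow> s \<in> S \<Longrightarrow> lat s \<in> cone_gen S"
  using cone_genI[of S "\<lambda>t. if t = s then 1 else 0"] by (simp add: if_distrib if_distribR cong: if_cong)

text \<open>The cone is the convex cone hull of a finite set, and such hulls are closed.\<close>

lemma closed_cone_gen:
  assumes "finite S" shows "closed (cone_gen S)" "convex (cone_gen S)"
proof -
  have cc: "convex_cone (cone_gen S)"
    unfolding convex_cone_iff using cone_gen_add cone_gen_scale cone_gen_zero by blast
  have "cone_gen S = convex_cone hull (lat ` S)"
  proof
    show "convex_cone hull (lat ` S) \<subseteq> cone_gen S"
      using cc cone_gen_mem[OF assms] by (intro hull_minimal) auto
    have "(\<Sum>s\<in>S. c s *\<^sub>R lat s) \<in> convex_cone hull (lat ` S)" if "\<forall>s\<in>S. 0 \<le> c s" for c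
    proof -
      have "(\<Sum>s\<in>T. c s *\<^sub>R lat s) \<in> convex_cone hull (lat ` S)" if "finite T" "T \<subseteq> S" for T
        using that
      proof (induction T rule: finite_induct)
        case empty
        then show ?case by (simp add: convex_cone_hull_contains_0)
      next
        case (insert x T)
        then have "c x *\<^sub>R lat x \<in> convex_cone hull (lat ` S)"
          using \<open>\<forall>s\<in>S. 0 \<le> c s\<close> by (intro conicD[OF conic_convex_cone_hull] hull_inc) auto
        with insert show ?case by (auto intro!: convex_cone_hull_add)
      qed
      then show ?thesis using assms by blast
    qed
    then show "cone_gen S \<subseteq> convex_cone hull (lat ` S)" by (auto simp: cone_gen_def)
  qed
  then show "closed (cone_gen S)" using closed_convex_cone_hull[of "lat ` S"] assms by simp
  show "convex (cone_gen S)" using cc by (simp add: convex_cone_def)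
qed

lemma cone_gen_nonneg:
  assumes "x \<in> cone_gen S" "\<And>s. s \<in> S \<Longrightarrow> 0 \<le> lat s \<bullet> a"
  shows "0 \<le> x \<bullet> a"
  using assms by (auto simp: cone_gen_def inner_sum_left intro!: sum_nonneg)

lemma dual_monoid_cone_gen:
  assumes "finite S"
  shows "dual_monoid (cone_gen S) = {m. \<forall>s\<in>S. 0 \<le> pair_int s m}"
proof (intro equalityI subsetI)
  fix m assume "m \<in> dual_monoid (cone_gen S)"
  then have "0 \<le> lat s \<bullet> lat m" if "s \<in> S" for s
    using cone_gen_mem[OF assms that] by (auto simp: dual_monoid_def)
  then show "m \<in> {m. \<forall>s\<in>S. 0 \<le> pair_int s m}" by (simp add: lat_inner)
next
  fix m assume "m \<in> {m. \<forall>s\<in>S. 0 \<le> pair_int s m}"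
  then show "m \<in> dual_monoid (cone_gen S)"
    using cone_gen_nonneg[of _ S "lat m"] by (auto simp: dual_monoid_def lat_inner)
qed

text \<open>Strong convexity keeps 0 out of the convex hull of the nonzero generators. A hyperplane
  strictly separating 0 from this compact set gives a real functional, which is then made integral.
  The generator 0 is allowed in \<open>S\<close> and has to be set aside.\<close>

lemma interior_dual_point:
  assumes S: "finite S" and sc: "strongly_convex (cone_gen S)"
  shows "\<exists>m. \<forall>s\<in>S - {0}. 0 < pair_int s m"
proof -
  let ?C = "convex hull (lat ` (S - {0}))"
  have "0 \<notin> ?C"
  proof
    assume "0 \<in> ?C"
    then obtain u where u: "\<And>x. x \<in> lat ` (S - {0}) \<Longrightarrow> 0 \<le> u x" "sum u (lat ` (S - {0})) = 1"
      "(\<Sum>x\<in>lat ` (S - {0}). u x *\<^sub>R x) = 0" using S by (auto simp: convex_hull_finite)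
    define c where "c = (\<lambda>s. if s = 0 then 0 else u (lat s))"
    have inj: "inj_on lat (S - {0})" by (auto simp: inj_on_def lat_inject)
    have c: "\<And>s. s \<in> S \<Longrightarrow> 0 \<le> c s" using u(1) by (auto simp: c_def)
    have "sum c (S - {0}) = 1" using u(2) by (simp add: sum.reindex[OF inj] c_def)
    then obtain s where s: "s \<in> S" "s \<noteq> 0" "c s \<noteq> 0" by (metis DiffE insertI1 sum.neutral zero_neq_one)
    have sum0: "(\<Sum>s\<in>S. c s *\<^sub>R lat s) = 0"
    proof -
      have "(\<Sum>s\<in>S. c s *\<^sub>R lat s) = (\<Sum>s\<in>S - {0}. u (lat s) *\<^sub>R lat s)"
        by (rule sum.mono_neutral_cong_right) (auto simp: S c_def)
      then show ?thesis using u(3) by (simp add: sum.reindex[OF inj])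
    qed
    \<comment> \<open>The relation writes \<open>- ?t\<close> as a nonnegative combination of the
      other generators, so the cone would contain a nonzero vector together with its
      negative.\<close>
    let ?t = "c s *\<^sub>R lat s"
    have "?t \<in> cone_gen S" using cone_gen_scale[OF cone_gen_mem[OF S s(1)]] c[OF s(1)] by simp
    moreover have "- ?t \<in> cone_gen S"
    proof -
      have "- ?t = (\<Sum>x\<in>S. (c(s := 0)) x *\<^sub>R lat x)"
        using sum0 sum.remove[OF S s(1), of "\<lambda>x. c x *\<^sub>R lat x"]
          sum.remove[OF S s(1), of "\<lambda>x. (c(s := 0)) x *\<^sub>R lat x"]
        by (simp add: neg_eq_iff_add_eq_0)
      then show ?thesis using cone_genI[of S "c(s := 0)"] c by simp
    qed
    ultimately have "?t \<in> cone_gen S \<inter> uminus ` cone_gen S" by (auto intro!: image_eqI[of _ _ "- ?t"])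
    then have "?t = 0" using sc unfolding strongly_convex_def by blast
    then show False using s by (simp add: lat_inject[of s 0, simplified])
  qed
  moreover have "compact ?C" using S by (simp add: compact_convex_hull finite_imp_compact)
  ultimately obtain a b where ab: "0 < b" "\<And>x. x \<in> ?C \<Longrightarrow> b < a \<bullet> x"
    using separating_hyperplane_closed_0[of ?C] compact_imp_closed convex_convex_hull by blast
  have "\<exists>m. \<forall>x\<in>lat ` (S - {0}). x \<bullet> lat m > 0"
  proof (rule lattice_point_positive)
    show "a \<bullet> x > 0" if "x \<in> lat ` (S - {0})" for x
      using ab(1) ab(2)[OF hull_inc[OF that]] by linarith
  qed (use S in simp)
  then show ?thesis by (auto simp: lat_inner)
qed

text \<open>A separating functional is nonnegative on the cone and negative at \<open>x\<close>.
  Adding a small multiple of \<open>m0\<close> makes it positive on all nonzero generators without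
  losing negativity at \<open>x\<close>; these are now finitely many strict conditions, so an
  integral functional satisfies them too.\<close>

lemma double_dual:
  assumes S: "finite S" and sc: "strongly_convex (cone_gen S)"
    and x: "\<And>m. m \<in> dual_monoid (cone_gen S) \<Longrightarrow> 0 \<le> x \<bullet> lat m"
  shows "x \<in> cone_gen S"
proof (rule ccontr)
  assume "x \<notin> cone_gen S"
  then obtain a b where ab: "a \<bullet> x < b" "\<And>y. y \<in> cone_gen S \<Longrightarrow> b < a \<bullet> y"
    using separating_hyperplane_closed_point[of "cone_gen S" x] closed_cone_gen[OF S] by blast
  have b: "b < 0" using ab(2)[OF cone_gen_zero] by simp
  have nonneg: "0 \<le> a \<bullet> lat s" if "s \<in> S" for s
  proof (rule ccontr)
    assume neg: "\<not> 0 \<le> a \<bullet> lat s"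
    have "b < a \<bullet> ((b / (a \<bullet> lat s)) *\<^sub>R lat s)"
      using b neg by (intro ab(2) cone_gen_scale[OF cone_gen_mem[OF S that]]) (simp add: divide_nonpos_neg)
    then show False using neg by simp
  qed
  obtain m0 where m0: "\<And>s. s \<in> S \<Longrightarrow> s \<noteq> 0 \<Longrightarrow> 0 < pair_int s m0"
    using interior_dual_point[OF S sc] by blast
  \<comment> \<open>The witness makes the perturbation smaller than the absolute value of
    \<open>a \<bullet> x\<close>; the summand 1 in its denominator covers the case that
    \<open>m0\<close> pairs to 0 with \<open>x\<close>.\<close>
  obtain e :: real where e: "e > 0" "a \<bullet> x + e * (lat m0 \<bullet> x) < 0"
  proof
    let ?e = "- (a \<bullet> x) / (1 + \<bar>lat m0 \<bullet> x\<bar>)"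
    have ax: "a \<bullet> x < 0" using ab(1) b by linarith
    then show "?e > 0" by (simp add: divide_neg_pos)
    have "?e * (lat m0 \<bullet> x) \<le> ?e * \<bar>lat m0 \<bullet> x\<bar>" using \<open>?e > 0\<close> by (intro mult_left_mono) auto
    also have "\<dots> < ?e * (1 + \<bar>lat m0 \<bullet> x\<bar>)" using \<open>?e > 0\<close> by (intro mult_strict_left_mono) auto
    also have "\<dots> = - (a \<bullet> x)"
      by (simp add: add_nonneg_eq_0_iff)
    finally show "a \<bullet> x + ?e * (lat m0 \<bullet> x) < 0" by linarith
  qed
  have "\<exists>m. \<forall>y\<in>insert (- x) (lat ` (S - {0})). y \<bullet> lat m > 0"
  proof (rule lattice_point_positive[where a = "a + e *\<^sub>R lat m0"])
    fix y assume "y \<in> insert (- x) (lat ` (S - {0}))"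
    then show "(a + e *\<^sub>R lat m0) \<bullet> y > 0"
    proof
      assume "y = - x"
      then show ?thesis using e by (simp add: inner_add_left)
    next
      assume "y \<in> lat ` (S - {0})"
      then obtain s where s: "s \<in> S" "s \<noteq> 0" "y = lat s" by blast
      have "lat m0 \<bullet> lat s = of_int (pair_int s m0)" by (subst inner_commute) (rule lat_inner)
      then have "e * (lat m0 \<bullet> lat s) > 0" using e(1) m0 s by simp
      then show ?thesis using nonneg[OF s(1)] s by (simp add: inner_add_left)
    qed
  qed (use S in simp)
  then obtain m where m: "x \<bullet> lat m < 0" "\<And>s. s \<in> S \<Longrightarrow> s \<noteq> 0 \<Longrightarrow> 0 < pair_int s m"
    by (auto simp: lat_inner)
  then have "0 \<le> pair_int s m" if "s \<in> S" for s using that by (cases "s = 0") (auto simp: less_imp_le)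
  then have "m \<in> dual_monoid (cone_gen S)" by (simp add: dual_monoid_cone_gen[OF S])
  then show False using x m(1) by force
qed


section \<open>Smooth cones\<close>

text \<open>One evaluation for two purposes: Laurent polynomials, with \<phi> the identity on
  complex coefficients, and polynomials in derivations, whose coefficients are Laurent polynomials
  evaluated by \<phi>.\<close>

definition pm_eval :: "('b::zero \<Rightarrow> 'c::comm_ring_1) \<Rightarrow> ('a \<Rightarrow> 'c) \<Rightarrow> ('a \<Rightarrow>\<^sub>0 'b) \<Rightarrow> 'c" where
  "pm_eval \<phi> w p = (\<Sum>k\<in>Poly_Mapping.keys p. \<phi> (Poly_Mapping.lookup p k) * w k)"

lemma chart_eval_pm_eval: "chart_eval \<gamma> f = pm_eval (\<lambda>c. c) \<gamma> f"
  by (simp add: chart_eval_def pm_eval_def)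

lemma pm_eval_superset:
  assumes "finite A" "Poly_Mapping.keys p \<subseteq> A" "\<phi> 0 = 0"
  shows "pm_eval \<phi> w p = (\<Sum>k\<in>A. \<phi> (Poly_Mapping.lookup p k) * w k)"
  unfolding pm_eval_def
  by (rule sum.mono_neutral_left) (use assms in \<open>auto simp: in_keys_iff\<close>)

lemma pm_eval_zero [simp]: "pm_eval \<phi> w 0 = 0"
  by (simp add: pm_eval_def)

lemma pm_eval_add:
  assumes "\<phi> 0 = 0" "\<And>x y. \<phi> (x + y) = \<phi> x + \<phi> y"
  shows "pm_eval \<phi> w (p + q) = pm_eval \<phi> w p + pm_eval \<phi> w q"
proof -
  let ?A = "Poly_Mapping.keys p \<union> Poly_Mapping.keys q"
  have *: "pm_eval \<phi> w r = (\<Sum>k\<in>?A. \<phi> (Poly_Mapping.lookup r k) * w k)" if "Poly_Mapping.keys r \<subseteq> ?A" for r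
    by (rule pm_eval_superset) (use that assms in auto)
  show ?thesis
    by (simp add: * Poly_Mapping.keys_add lookup_add assms algebra_simps sum.distrib)
qed

lemma pm_eval_sum:
  assumes "\<phi> 0 = 0" "\<And>x y. \<phi> (x + y) = \<phi> x + \<phi> y"
  shows "pm_eval \<phi> w (sum f A) = (\<Sum>x\<in>A. pm_eval \<phi> w (f x))"
  by (induction A rule: infinite_finite_induct) (simp_all add: pm_eval_add assms)

lemma pm_eval_single:
  assumes "\<phi> 0 = 0"
  shows "pm_eval \<phi> w (Poly_Mapping.single k c) = \<phi> c * w k"
  by (simp add: pm_eval_def assms)

lemma poly_mapping_sum_singles:
  "p = (\<Sum>k\<in>Poly_Mapping.keys p. Poly_Mapping.single k (Poly_Mapping.lookup p k))"
proof (rule poly_mapping_eqI)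
  fix k
  have "(\<Sum>x\<in>Poly_Mapping.keys p. Poly_Mapping.lookup p x when x = k) = Poly_Mapping.lookup p k"
    by (simp add: when_def sum.delta in_keys_iff)
  then show "Poly_Mapping.lookup p k =
      Poly_Mapping.lookup (\<Sum>k\<in>Poly_Mapping.keys p. Poly_Mapping.single k (Poly_Mapping.lookup p k)) k"
    by (simp add: lookup_sum lookup_single)
qed

lemma pm_eval_times:
  fixes \<phi> :: "'b::comm_ring_1 \<Rightarrow> 'c::comm_ring_1"
  assumes "\<phi> 0 = 0" "\<And>x y. \<phi> (x + y) = \<phi> x + \<phi> y"
  shows "pm_eval \<phi> w (p * q) = (\<Sum>k\<in>Poly_Mapping.keys p. \<Sum>l\<in>Poly_Mapping.keys q.
     \<phi> (Poly_Mapping.lookup p k * Poly_Mapping.lookup q l) * w (k + l))"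
proof -
  have "p * q = (\<Sum>k\<in>Poly_Mapping.keys p. \<Sum>l\<in>Poly_Mapping.keys q.
     Poly_Mapping.single (k + l) (Poly_Mapping.lookup p k * Poly_Mapping.lookup q l))"
    by (subst (1) poly_mapping_sum_singles[of p], subst (1) poly_mapping_sum_singles[of q])
       (simp add: sum_product mult_single)
  then show ?thesis by (simp add: pm_eval_sum pm_eval_single assms)
qed

lemma pm_eval_mult:
  fixes \<phi> :: "'b::comm_ring_1 \<Rightarrow> 'c::comm_ring_1"
  assumes "\<phi> 0 = 0" "\<And>x y. \<phi> (x + y) = \<phi> x + \<phi> y" "\<And>x y. \<phi> (x * y) = \<phi> x * \<phi> y"
    and "\<And>k l. k \<in> Poly_Mapping.keys p \<Longrightarrow> l \<in> Poly_Mapping.keys q \<Longrightarrow> w (k + l) = w k * w l"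
  shows "pm_eval \<phi> w (p * q) = pm_eval \<phi> w p * pm_eval \<phi> w q"
proof -
  have "pm_eval \<phi> w (p * q) = (\<Sum>k\<in>Poly_Mapping.keys p. \<Sum>l\<in>Poly_Mapping.keys q.
     (\<phi> (Poly_Mapping.lookup p k) * w k) * (\<phi> (Poly_Mapping.lookup q l) * w l))"
    unfolding pm_eval_times[where \<phi> = \<phi>, OF assms(1,2)]
    by (intro sum.cong refl) (simp add: assms algebra_simps)
  then show ?thesis by (simp add: pm_eval_def sum_product)
qed

section \<open>Point derivations on charts and the count of tangent vectors\<close>

lemma dual_monoid_add: "m \<in> dual_monoid \<sigma> \<Longrightarrow> m' \<in> dual_monoid \<sigma> \<Longrightarrow> m + m' \<in> dual_monoid \<sigma>"
  by (auto simp: dual_monoid_def lat_add inner_add_right)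

lemma dual_monoid_zero: "0 \<in> dual_monoid \<sigma>"
  by (simp add: dual_monoid_def)

lemma chart_eval_lconst: "chart_eval d (lconst c * f) = c * chart_eval d f"
  unfolding chart_eval_pm_eval by (subst pm_eval_times) (auto simp: lconst_def pm_eval_def sum_distrib_left algebra_simps)

lemma chart_eval_leibniz:
  assumes "\<And>k l. k \<in> Poly_Mapping.keys f \<Longrightarrow> l \<in> Poly_Mapping.keys g \<Longrightarrow> d (k + l) = \<gamma> k * d l + \<gamma> l * d k"
  shows "chart_eval d (f * g) = chart_eval \<gamma> f * chart_eval d g + chart_eval \<gamma> g * chart_eval d f"
proof -
  have "chart_eval d (f * g) = (\<Sum>k\<in>Poly_Mapping.keys f. \<Sum>l\<in>Poly_Mapping.keys g.
     Poly_Mapping.lookup f k * \<gamma> k * (Poly_Mapping.lookup g l * d l) +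
     Poly_Mapping.lookup g l * \<gamma> l * (Poly_Mapping.lookup f k * d k))"
    unfolding chart_eval_pm_eval
    by (subst pm_eval_times) (use assms in \<open>auto simp: algebra_simps intro!: sum.cong\<close>)
  also have "\<dots> = chart_eval \<gamma> f * chart_eval d g + chart_eval d f * chart_eval \<gamma> g"
    unfolding sum.distrib chart_eval_def sum_product by (simp add: mult_ac)
  finally show ?thesis by (simp add: mult.commute)
qed

text \<open>A function on the monoid satisfying the Leibniz rule extends linearly to a point
  derivation, so tangent vectors can be written down combinatorially.\<close>

lemma tangent_space_chart_eval:
  assumes "\<And>m m'. m \<in> dual_monoid \<sigma> \<Longrightarrow> m' \<in> dual_monoid \<sigma> \<Longrightarrow> d (m + m') = \<gamma> m * d m' + \<gamma> m' * d m"
  shows "restrict (chart_eval d) (chart_ring \<sigma>) \<in> tangent_space \<sigma> \<gamma>"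
proof -
  have add: "f + g \<in> chart_ring \<sigma>" if "f \<in> chart_ring \<sigma>" "g \<in> chart_ring \<sigma>" for f g
    using that Poly_Mapping.keys_add[of f g] by (auto simp: chart_ring_def)
  have mult: "f * g \<in> chart_ring \<sigma>" if "f \<in> chart_ring \<sigma>" "g \<in> chart_ring \<sigma>" for f g
    using that keys_mult[of f g] by (auto simp: chart_ring_def intro!: dual_monoid_add)
  have const: "lconst c \<in> chart_ring \<sigma>" for c :: complex
    by (auto simp: chart_ring_def lconst_def dual_monoid_zero)
  have "chart_eval d (f * g) = chart_eval \<gamma> f * chart_eval d g + chart_eval \<gamma> g * chart_eval d f"
    if "f \<in> chart_ring \<sigma>" "g \<in> chart_ring \<sigma>" for f g
    by (rule chart_eval_leibniz) (use that assms in \<open>auto simp: chart_ring_def subset_iff\<close>)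
  then show ?thesis
    by (auto simp: tangent_space_def add mult const chart_eval_lconst) (simp_all add: chart_eval_pm_eval pm_eval_add)
qed

lemma toric_pt_self:
  assumes "\<sigma> \<in> \<Sigma>" "\<gamma> \<in> chart_points \<sigma>"
  shows "(\<sigma>, \<gamma>) \<in> toric_pt \<Sigma> \<sigma> \<gamma>" "toric_pt \<Sigma> \<sigma> \<gamma> \<in> topspace (vtop (toric_variety \<Sigma>))"
proof -
  have "restrict \<gamma> (dual_monoid \<sigma>) = \<gamma>"
    using assms by (auto simp: chart_points_def extensional_restrict)
  then show "(\<sigma>, \<gamma>) \<in> toric_pt \<Sigma> \<sigma> \<gamma>"
    using assms by (auto simp: toric_pt_def glue_def intro!: bexI[of _ \<gamma>])
  have "chart_eval \<gamma> 1 \<noteq> 0"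
    using assms by (simp add: chart_eval_def chart_points_def)
  moreover have "1 \<in> chart_ring \<sigma>" by (simp add: chart_ring_def dual_monoid_zero)
  ultimately show "toric_pt \<Sigma> \<sigma> \<gamma> \<in> topspace (vtop (toric_variety \<Sigma>))"
    using assms by (auto simp: toric_variety_def topology_generated_by_topspace)
qed

text \<open>Spanning by \<open>CARD('n)\<close> functionals is the form of smoothness that bounds
  the number of independent tangent vectors.\<close>

lemma smooth_toric_tangent:
  fixes \<Sigma> :: "(real ^ 'n) set set"
  assumes "smooth_toric \<Sigma>" "\<sigma> \<in> \<Sigma>" "\<gamma> \<in> chart_points \<sigma>"
  obtains b :: "'n \<Rightarrow> 'n laurent \<Rightarrow> complex"
  where "\<And>\<delta>. \<delta> \<in> tangent_space \<sigma> \<gamma> \<Longrightarrow> \<exists>c. \<forall>f\<in>chart_ring \<sigma>. \<delta> f = (\<Sum>i\<in>UNIV. c i * b i f)"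
proof -
  have "\<forall>(\<sigma>', \<gamma>')\<in>toric_pt \<Sigma> \<sigma> \<gamma>. \<exists>b::'n \<Rightarrow> 'n laurent \<Rightarrow> complex. range b \<subseteq> tangent_space \<sigma>' \<gamma>' \<and>
       (\<forall>\<delta>\<in>tangent_space \<sigma>' \<gamma>'. \<exists>!c::'n \<Rightarrow> complex. \<delta> = (\<lambda>f\<in>chart_ring \<sigma>'. \<Sum>i\<in>UNIV. c i * b i f))"
    using bspec[OF assms(1)[unfolded smooth_toric_def] toric_pt_self(2)[OF assms(2,3)]] .
  from bspec[OF this toric_pt_self(1)[OF assms(2,3)]]
  have "\<exists>b::'n \<Rightarrow> 'n laurent \<Rightarrow> complex. range b \<subseteq> tangent_space \<sigma> \<gamma> \<and>
       (\<forall>\<delta>\<in>tangent_space \<sigma> \<gamma>. \<exists>!c::'n \<Rightarrow> complex. \<delta> = (\<lambda>f\<in>chart_ring \<sigma>. \<Sum>i\<in>UNIV. c i * b i f))"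
    unfolding prod.case .
  then obtain b :: "'n \<Rightarrow> 'n laurent \<Rightarrow> complex" where "range b \<subseteq> tangent_space \<sigma> \<gamma> \<and>
    (\<forall>\<delta>\<in>tangent_space \<sigma> \<gamma>. \<exists>!c::'n \<Rightarrow> complex. \<delta> = (\<lambda>f\<in>chart_ring \<sigma>. \<Sum>i\<in>UNIV. c i * b i f))" ..
  then have b: "\<forall>\<delta>\<in>tangent_space \<sigma> \<gamma>. \<exists>!c::'n \<Rightarrow> complex. \<delta> = (\<lambda>f\<in>chart_ring \<sigma>. \<Sum>i\<in>UNIV. c i * b i f)" ..
  show ?thesis
  proof (rule that)
    fix \<delta> assume "\<delta> \<in> tangent_space \<sigma> \<gamma>"
    from ex1_implies_ex[OF bspec[OF b this]]
    obtain c where "\<delta> = (\<lambda>f\<in>chart_ring \<sigma>. \<Sum>i\<in>UNIV. c i * b i f)" ..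
    then show "\<exists>c. \<forall>f\<in>chart_ring \<sigma>. \<delta> f = (\<Sum>i\<in>UNIV. c i * b i f)" by auto
  qed
qed

text \<open>The identity matrix with entries \<open>d e e'\<close> factors through complex n-space,
  each \<open>d e\<close> being a combination of the n functionals \<open>b i\<close>. The vectors
  of values of the \<open>b i\<close> at the monomials of \<open>E\<close> are therefore linearly
  independent.\<close>

lemma tangent_card_bound:
  fixes b :: "'n::finite \<Rightarrow> 'n laurent \<Rightarrow> complex" and E :: "(int ^ 'n) set"
  assumes b: "\<And>\<delta>. \<delta> \<in> tangent_space \<sigma> \<gamma> \<Longrightarrow> \<exists>c. \<forall>f\<in>chart_ring \<sigma>. \<delta> f = (\<Sum>i\<in>UNIV. c i * b i f)"
    and E: "finite E" "E \<subseteq> dual_monoid \<sigma>"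
    and tangent: "\<And>e m m'. e \<in> E \<Longrightarrow> m \<in> dual_monoid \<sigma> \<Longrightarrow> m' \<in> dual_monoid \<sigma> \<Longrightarrow>
       d e (m + m') = \<gamma> m * d e m' + \<gamma> m' * d e m"
    and dual: "\<And>e e'. e \<in> E \<Longrightarrow> e' \<in> E \<Longrightarrow> d e e' = (if e = e' then 1 else 0)"
  shows "card E \<le> CARD('n)"
proof -
  have "\<exists>c. \<forall>f\<in>chart_ring \<sigma>. chart_eval (d e) f = (\<Sum>i\<in>UNIV. c i * b i f)" if "e \<in> E" for e
    using b[OF tangent_space_chart_eval[where d = "d e", OF tangent[OF that]]] by auto
  then obtain c where c: "\<And>e f. e \<in> E \<Longrightarrow> f \<in> chart_ring \<sigma> \<Longrightarrow> chart_eval (d e) f = (\<Sum>i\<in>UNIV. c e i * b i f)"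
    by metis
  define x :: "int ^ 'n \<Rightarrow> complex ^ 'n" where "x = (\<lambda>e. \<chi> i. b i (Poly_Mapping.single e 1))"
  have cx: "(\<Sum>i\<in>UNIV. c e i * x e' $ i) = (if e = e' then 1 else 0)" if "e \<in> E" "e' \<in> E" for e e'
  proof -
    have "Poly_Mapping.single e' (1::complex) \<in> chart_ring \<sigma>" using that E by (auto simp: chart_ring_def)
    from c[OF that(1) this] show ?thesis using dual[OF that] by (simp add: x_def chart_eval_def)
  qed
  have inj: "inj_on x E"
  proof (rule inj_onI)
    fix e e' assume "e \<in> E" "e' \<in> E" "x e = x e'"
    then show "e = e'" using cx[of e e'] cx[of e e] by (auto split: if_splits)
  qed
  have "vec.independent (x ` E)"
  proof (rule vec.independent_if_scalars_zero)
    fix f v assume s: "(\<Sum>y\<in>x ` E. f y *s y) = 0" and "v \<in> x ` E"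
    then obtain e where e: "e \<in> E" "v = x e" by blast
    have "(\<Sum>e'\<in>E. f (x e') *s x e') = 0" using s by (simp add: sum.reindex[OF inj])
    then have "0 = (\<Sum>i\<in>UNIV. c e i * (\<Sum>e'\<in>E. f (x e') *s x e') $ i)" by simp
    also have "\<dots> = (\<Sum>i\<in>UNIV. \<Sum>e'\<in>E. f (x e') * (c e i * x e' $ i))"
      by (simp add: sum_distrib_left algebra_simps)
    also have "\<dots> = (\<Sum>e'\<in>E. f (x e') * (\<Sum>i\<in>UNIV. c e i * x e' $ i))"
      by (subst sum.swap) (simp add: sum_distrib_left)
    also have "\<dots> = (\<Sum>e'\<in>E. if e = e' then f (x e') else 0)"
      by (intro sum.cong refl) (simp add: cx e)
    also have "\<dots> = f v" using E e by (simp add: sum.delta')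
    finally show "f v = 0" by simp
  qed (use E in simp)
  then have "card (x ` E) \<le> vec.dim (UNIV :: (complex ^ 'n) set)"
    by (intro vec.independent_card_le_dim) auto
  then show ?thesis by (simp add: card_image[OF inj] vec_dim_card card_cart_basis)
qed

text \<open>Generators of the lattice span the real vector space; this lower bound will meet the
  upper bound from tangent vectors.\<close>

lemma lattice_generators_card:
  fixes E :: "(int ^ 'n) set"
  assumes "finite E" "\<And>m. \<exists>k. m = (\<Sum>e\<in>E. k e *s e)"
  shows "CARD('n) \<le> card E"
proof -
  have "axis i 1 \<in> span (lat ` E)" for i
  proof -
    obtain k where "axis i 1 = (\<Sum>e\<in>E. k e *s e)" using assms(2) by metis
    then have "lat (axis i 1) = (\<Sum>e\<in>E. of_int (k e) *\<^sub>R lat e)" by (simp add: lat_sum lat_scale)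
    moreover have "lat (axis i 1) = axis i 1" by (simp add: lat_def axis_def vec_eq_iff)
    moreover have "(\<Sum>e\<in>E. of_int (k e) *\<^sub>R lat e) \<in> span (lat ` E)"
      by (intro span_sum span_scale span_base) auto
    ultimately show ?thesis by simp
  qed
  then have "Basis \<subseteq> span (lat ` E)" by (auto simp: Basis_vec_def)
  then have "span Basis \<subseteq> span (lat ` E)" by (rule span_minimal) (rule subspace_span)
  then have "(UNIV :: (real ^ 'n) set) \<subseteq> span (lat ` E)" by (simp add: span_Basis)
  then have "dim (UNIV :: (real ^ 'n) set) \<le> card (lat ` E)"
    using assms(1) by (intro dim_le_card) auto
  also have "\<dots> \<le> card E" using assms(1) by (rule card_image_le)
  finally show ?thesis by simp
qed

section \<open>Dual lattice bases and the cones they frame\<close>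

definition unimodular :: "('n \<Rightarrow> int ^ 'n) \<Rightarrow> ('n \<Rightarrow> int ^ 'n) \<Rightarrow> bool" where
  "unimodular v u \<longleftrightarrow> (\<forall>i j. pair_int (v i) (u j) = (if i = j then 1 else 0))"

lemma pair_int_commute: "pair_int v u = pair_int u v"
  by (simp add: pair_int_def mult.commute)

lemma unimodular_sym: "unimodular v u \<Longrightarrow> unimodular u v"
  by (auto simp: unimodular_def pair_int_commute)

text \<open>Over the reals a one-sided inverse of a square matrix is two-sided.\<close>

lemma int_matrix_inverse:
  fixes a b :: "'n::finite \<Rightarrow> 'n \<Rightarrow> int"
  assumes "\<And>i k. (\<Sum>j\<in>UNIV. a i j * b j k) = (if i = k then 1 else 0)"
  shows "(\<Sum>j\<in>UNIV. b i j * a j k) = (if i = k then 1 else 0)"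
proof -
  define A B :: "real ^ 'n ^ 'n" where "A = (\<chi> i j. of_int (a i j))" and "B = (\<chi> i j. of_int (b i j))"
  have "A ** B = mat 1"
  proof -
    have "(\<Sum>j\<in>UNIV. real_of_int (a i j) * real_of_int (b j k)) = (if i = k then 1 else 0)" for i k
      using arg_cong[OF assms[of i k], of real_of_int] by (simp split: if_splits)
    then show ?thesis by (simp add: A_def B_def matrix_matrix_mult_def mat_def vec_eq_iff)
  qed
  then have "B ** A = mat 1" by (simp add: matrix_left_right_inverse)
  then have "(\<Sum>j\<in>UNIV. real_of_int (b i j) * real_of_int (a j k)) = (if i = k then 1 else 0)"
    by (simp add: A_def B_def matrix_matrix_mult_def mat_def vec_eq_iff)
  then have "real_of_int (\<Sum>j\<in>UNIV. b i j * a j k) = of_int (if i = k then 1 else 0)" by simp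
  then show ?thesis by (simp only: of_int_eq_iff)
qed

lemma unimodular_delta:
  assumes "unimodular v u"
  shows "(\<Sum>j\<in>UNIV. u j $ k * v j $ l) = (if k = l then 1 else 0)"
  using int_matrix_inverse[of "\<lambda>i j. v i $ j" "\<lambda>j i. u i $ j"] assms
  by (simp add: unimodular_def pair_int_def)

lemma unimodular_expand:
  assumes "unimodular v u"
  shows "m = (\<Sum>j\<in>UNIV. pair_int (v j) m *s u j)"
proof (subst vec_eq_iff, intro allI)
  fix k
  have "(\<Sum>j\<in>UNIV. pair_int (v j) m *s u j) $ k = (\<Sum>j\<in>UNIV. \<Sum>l\<in>UNIV. u j $ k * v j $ l * m $ l)"
    by (simp add: pair_int_def sum_distrib_left sum_distrib_right mult_ac)
  also have "\<dots> = (\<Sum>l\<in>UNIV. (\<Sum>j\<in>UNIV. u j $ k * v j $ l) * m $ l)"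
    by (subst sum.swap) (simp add: sum_distrib_right)
  also have "\<dots> = m $ k"
    by (simp add: unimodular_delta[OF assms] mult_delta_left)
  finally show "m $ k = (\<Sum>j\<in>UNIV. pair_int (v j) m *s u j) $ k" by simp
qed

lemma unimodular_expand_inner:
  assumes "unimodular v u"
  shows "x \<bullet> lat m = (\<Sum>j\<in>UNIV. of_int (pair_int (v j) m) * (x \<bullet> lat (u j)))"
  by (subst unimodular_expand[OF assms, of m]) (simp add: lat_sum lat_scale inner_sum_right)

lemma unimodular_expand_real:
  assumes "unimodular v u"
  shows "x = (\<Sum>j\<in>UNIV. (x \<bullet> lat (u j)) *\<^sub>R lat (v j))"
proof (subst vec_eq_iff, intro allI)
  fix k
  have "x $ k = x \<bullet> lat (axis k 1)"
    by (simp add: inner_vec_def lat_def axis_def if_distrib cong: if_cong)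
  also have "\<dots> = (\<Sum>j\<in>UNIV. of_int (v j $ k) * (x \<bullet> lat (u j)))"
    by (subst unimodular_expand_inner[OF assms]) (simp add: pair_int_axis)
  also have "\<dots> = (\<Sum>j\<in>UNIV. (x \<bullet> lat (u j)) *\<^sub>R lat (v j)) $ k"
    by (simp add: lat_def mult.commute)
  finally show "x $ k = (\<Sum>j\<in>UNIV. (x \<bullet> lat (u j)) *\<^sub>R lat (v j)) $ k" .
qed

lemma unimodular_inner: "unimodular v u \<Longrightarrow> lat (v i) \<bullet> lat (u j) = (if i = j then 1 else 0)"
  by (simp add: lat_inner unimodular_def)

text \<open>The cone spanned by the part \<open>K\<close> of the lattice basis \<open>v\<close>,
  described in the coordinates given by the dual basis \<open>u\<close>. In these coordinates the
  dual monoid, the faces and the rays can be read off.\<close>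

definition framed :: "(real ^ 'n) set \<Rightarrow> ('n \<Rightarrow> int ^ 'n) \<Rightarrow> ('n \<Rightarrow> int ^ 'n) \<Rightarrow> 'n set \<Rightarrow> bool" where
  "framed \<sigma> v u K \<longleftrightarrow> unimodular v u \<and>
     \<sigma> = {x. (\<forall>i\<in>K. 0 \<le> x \<bullet> lat (u i)) \<and> (\<forall>i. i \<notin> K \<longrightarrow> x \<bullet> lat (u i) = 0)}"

lemma framed_gen: "framed \<sigma> v u K \<Longrightarrow> i \<in> K \<Longrightarrow> 0 \<le> t \<Longrightarrow> t *\<^sub>R lat (v i) \<in> \<sigma>"
  by (auto simp: framed_def unimodular_inner)

lemma framed_gen_iff: "framed \<sigma> v u K \<Longrightarrow> lat (v i) \<in> \<sigma> \<longleftrightarrow> i \<in> K"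
  by (auto simp: framed_def unimodular_inner split: if_splits)

lemma framed_dual_monoid:
  assumes "framed \<sigma> v u K"
  shows "dual_monoid \<sigma> = {m. \<forall>i\<in>K. 0 \<le> pair_int (v i) m}"
proof (intro equalityI subsetI)
  fix m assume "m \<in> dual_monoid \<sigma>"
  then show "m \<in> {m. \<forall>i\<in>K. 0 \<le> pair_int (v i) m}"
    using framed_gen[OF assms, of _ 1] by (force simp: dual_monoid_def lat_inner)
next
  fix m assume m: "m \<in> {m. \<forall>i\<in>K. 0 \<le> pair_int (v i) m}"
  have "0 \<le> x \<bullet> lat m" if "x \<in> \<sigma>" for x
  proof -
    have u: "unimodular v u" using assms by (simp add: framed_def)
    have "0 \<le> of_int (pair_int (v j) m) * (x \<bullet> lat (u j))" for j
      using m that assms by (cases "j \<in> K") (auto simp: framed_def)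
    then show ?thesis unfolding unimodular_expand_inner[OF u, of x m] by (intro sum_nonneg)
  qed
  then show "m \<in> dual_monoid \<sigma>" by (simp add: dual_monoid_def)
qed

text \<open>
  At the distinguished point of the chart, the irreducible elements of the dual monoid modulo units
  and a basis of the group of units yield linearly independent tangent vectors, so by smoothness
  there are at most \<open>n\<close> of them. Since they generate the character lattice, they form a basis of it.
\<close>

lemma smooth_cone_framed:
  fixes S :: "(int ^ 'n) set"
  assumes S: "finite S" and sc: "strongly_convex (cone_gen S)"
    and tangent: "\<And>\<gamma>. \<gamma> \<in> chart_points (cone_gen S) \<Longrightarrow> \<exists>b::'n \<Rightarrow> 'n laurent \<Rightarrow> complex.
       \<forall>\<delta>\<in>tangent_space (cone_gen S) \<gamma>. \<exists>c. \<forall>f\<in>chart_ring (cone_gen S). \<delta> f = (\<Sum>i\<in>UNIV. c i * b i f)"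
  shows "\<exists>v u K. framed (cone_gen S) v u K"
proof -
  define \<sigma> where "\<sigma> = cone_gen S"
  define D where "D = dual_monoid \<sigma>"
  have D: "m \<in> D \<longleftrightarrow> (\<forall>s\<in>S. 0 \<le> pair_int s m)" for m
    by (simp add: D_def \<sigma>_def dual_monoid_cone_gen[OF S])
  define U where "U = {m. \<forall>s\<in>S. pair_int s m = 0}"
  \<comment> \<open>A height on the dual monoid: additive, nonnegative and zero exactly on the units
    \<open>U\<close>. It makes the decomposition into irreducibles terminate.\<close>
  define ht where "ht = (\<lambda>m. \<Sum>s\<in>S. pair_int s m)"
  have ht_add: "ht (m + m') = ht m + ht m'" for m m' by (simp add: ht_def pair_int_add sum.distrib)
  have ht_nonneg: "0 \<le> ht m" if "m \<in> D" for m
    using that by (auto simp: ht_def D intro: sum_nonneg)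
  have ht_U: "ht m = 0 \<longleftrightarrow> m \<in> U" if "m \<in> D" for m
    using that S by (auto simp: ht_def D U_def sum_nonneg_eq_0_iff)
  have UD: "U \<subseteq> D" by (auto simp: U_def D)
  have U_add: "m + m' \<in> U" if "m \<in> U" "m' \<in> U" for m m' using that by (simp add: U_def pair_int_add)
  have U_diff: "m - m' \<in> U" if "m \<in> U" "m' \<in> U" for m m' using that by (simp add: U_def pair_int_diff)
  have U_0: "0 \<in> U" by (simp add: U_def)
  have D_add: "m + m' \<in> D" if "m \<in> D" "m' \<in> D" for m m' using that by (simp add: D pair_int_add)
  have U_iff: "m + m' \<in> U \<longleftrightarrow> m \<in> U \<and> m' \<in> U" if "m \<in> D" "m' \<in> D" for m m'
    using ht_U[OF D_add[OF that]] ht_U that ht_nonneg[OF that(1)] ht_nonneg[OF that(2)] ht_add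
    by (metis add_nonneg_eq_0_iff)
  \<comment> \<open>Multiplicative because a sum of two monoid elements is a unit only if both of
    them are.\<close>
  define \<gamma> where "\<gamma> = (\<lambda>m\<in>D. if m \<in> U then 1 else 0 :: complex)"
  have "\<gamma> \<in> chart_points \<sigma>"
    unfolding chart_points_def D_def[symmetric] using U_iff U_0 UD D_add by (auto simp: \<gamma>_def)
  then obtain b :: "'n \<Rightarrow> 'n laurent \<Rightarrow> complex" where
    b: "\<And>\<delta>. \<delta> \<in> tangent_space \<sigma> \<gamma> \<Longrightarrow> \<exists>c. \<forall>f\<in>chart_ring \<sigma>. \<delta> f = (\<Sum>i\<in>UNIV. c i * b i f)"
    using tangent[of \<gamma>] unfolding \<sigma>_def by metis
  from subgroup_basis[of U, OF U_0 U_diff] obtain G where G: "finite G" "G \<subseteq> U"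
    and G_gen: "\<forall>u\<in>U. \<exists>c. u = (\<Sum>g\<in>G. c g *s g)"
    and G_ind: "\<forall>c. (\<Sum>g\<in>G. c g *s g) = 0 \<longrightarrow> (\<forall>g\<in>G. c g = 0)" by auto
  from bchoice[OF G_gen] obtain coord where coord: "\<forall>u\<in>U. u = (\<Sum>g\<in>G. coord u g *s g)" ..
  have coord_eq: "coord u g = c g" if u: "u \<in> U" "u = (\<Sum>g\<in>G. c g *s g)" and g: "g \<in> G" for u c g
  proof -
    have "(\<Sum>g\<in>G. (coord u g - c g) *s g) = (\<Sum>g\<in>G. coord u g *s g) - (\<Sum>g\<in>G. c g *s g)"
      by (simp add: vec_eq_iff sum_subtractf left_diff_distrib)
    also have "\<dots> = 0" using bspec[OF coord u(1)] u(2) by simp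
    finally show ?thesis using G_ind[rule_format, of "\<lambda>g. coord u g - c g", OF _ g] by simp
  qed
  have coord_add: "coord (m + m') g = coord m g + coord m' g" if "m \<in> U" "m' \<in> U" "g \<in> G" for m m' g
  proof (rule coord_eq[OF U_add[OF that(1,2)] _ that(3)])
    have "(\<Sum>g\<in>G. (coord m g + coord m' g) *s g) = (\<Sum>g\<in>G. coord m g *s g) + (\<Sum>g\<in>G. coord m' g *s g)"
      by (simp add: vec_eq_iff sum.distrib distrib_right)
    then show "m + m' = (\<Sum>g\<in>G. (coord m g + coord m' g) *s g)"
      using bspec[OF coord that(1)] bspec[OF coord that(2)] by simp
  qed
  have coord_basis: "coord g' g = (if g = g' then 1 else 0)" if "g \<in> G" "g' \<in> G" for g g'
  proof (rule coord_eq[of g' "\<lambda>g. if g = g' then 1 else 0"])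
    have "(\<Sum>g\<in>G. (if g = g' then 1 else 0) *s g) = (\<Sum>g\<in>G. if g = g' then g else 0)"
      by (intro sum.cong) (auto simp: vec_eq_iff)
    also have "\<dots> = g'" using that G(1) by simp
    finally show "g' = (\<Sum>g\<in>G. (if g = g' then 1 else 0) *s g)" by simp
  qed (use that G in auto)
  define Irr where "Irr = {h \<in> D. h \<notin> U \<and> (\<forall>a\<in>D - U. \<forall>b\<in>D - U. h \<noteq> a + b)}"
  define indep where "indep = (\<lambda>R. finite R \<and> R \<subseteq> Irr \<and> (\<forall>r\<in>R. \<forall>r'\<in>R. r - r' \<in> U \<longrightarrow> r = r'))"
  have bound: "card (G \<union> R) \<le> CARD('n)" if R: "indep R" for R
  proof -
    \<comment> \<open>For a basis element of the units: the coordinate along it, a logarithmic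
      derivative in the direction of a torus. For an irreducible: the indicator of its class modulo
      units, a derivative in a direction where the monomials vanish at \<gamma>.\<close>
    define d :: "int ^ 'n \<Rightarrow> int ^ 'n \<Rightarrow> complex" where
      "d = (\<lambda>e m. if e \<in> G then (if m \<in> U then of_int (coord m e) else 0) else (if m - e \<in> U then 1 else 0))"
    have RU: "r \<notin> U" if "r \<in> R" for r using that R by (auto simp: indep_def Irr_def)
    show ?thesis
    proof (rule tangent_card_bound[where \<sigma> = \<sigma> and d = d, OF b])
      show "finite (G \<union> R)" using G R by (simp add: indep_def)
      show "G \<union> R \<subseteq> dual_monoid \<sigma>" using G UD R by (auto simp: indep_def Irr_def D_def)
      show "d e e' = (if e = e' then 1 else 0)" if ee: "e \<in> G \<union> R" "e' \<in> G \<union> R" for e e'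
      proof -
        consider "e \<in> G" "e' \<in> G" | "e \<in> G" "e' \<in> R" | "e \<in> R" "e' \<in> G" | "e \<in> R" "e' \<in> R"
          using ee by blast
        then show ?thesis
        proof cases
          case 1 then show ?thesis using G(2) by (auto simp: d_def coord_basis)
        next
          case 2 then show ?thesis using RU G(2) by (auto simp: d_def)
        next
          case 3
          have "e' - e \<notin> U"
          proof
            assume "e' - e \<in> U"
            from U_diff[OF _ this, of e'] 3 G(2) RU show False by auto
          qed
          then show ?thesis using 3 RU G(2) by (auto simp: d_def)
        next
          case 4 then show ?thesis using RU G(2) R U_0 by (auto simp: d_def indep_def)
        qed
      qed
      show "d e (m + m') = \<gamma> m * d e m' + \<gamma> m' * d e m"
        if e: "e \<in> G \<union> R" and m: "m \<in> dual_monoid \<sigma>" "m' \<in> dual_monoid \<sigma>" for e m m'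
      proof (cases "e \<in> G")
        case True
        then show ?thesis using m U_iff[of m m'] coord_add[of m m' e]
          by (auto simp: d_def \<gamma>_def D_def)
      next
        case False
        then have e: "e \<in> R" "e \<in> D" "e \<notin> U" using e R by (auto simp: indep_def Irr_def)
        have notU: "w - e \<notin> U" if "w \<in> U" for w using U_diff[OF that, of "w - e"] e(3) by auto
        consider "m \<in> U" "m' \<in> U" | "m \<in> U" "m' \<notin> U" | "m \<notin> U" "m' \<in> U" | "m \<notin> U" "m' \<notin> U" by blast
        then show ?thesis
        proof cases
          case 1
          then show ?thesis using notU U_add by (simp add: d_def False)
        next
          case 2
          have "m + m' - e \<in> U \<longleftrightarrow> m' - e \<in> U"
            using U_add[OF 2(1), of "m' - e"] U_diff[OF _ 2(1), of "m + m' - e"] by (auto simp: algebra_simps)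
          then show ?thesis using 2 m by (simp add: d_def False \<gamma>_def D_def)
        next
          case 3
          have "m + m' - e \<in> U \<longleftrightarrow> m - e \<in> U"
            using U_add[OF 3(2), of "m - e"] U_diff[OF _ 3(2), of "m + m' - e"] by (auto simp: algebra_simps)
          then show ?thesis using 3 m by (simp add: d_def False \<gamma>_def D_def)
        next
          case 4
          \<comment> \<open>Here \<gamma> vanishes at both elements, so the Leibniz rule demands
            that the indicator vanish at their sum. Otherwise the unit \<open>m + m' - e\<close>,
            moved over to \<open>m'\<close>, would decompose the irreducible \<open>e\<close> into
            two nonunits.\<close>
          have "m + m' - e \<notin> U"
          proof
            assume w: "m + m' - e \<in> U"
            have w': "- (m + m' - e) \<in> U" using U_diff[OF U_0 w] by simp
            have "m' + - (m + m' - e) \<in> D" using D_add[of m' "- (m + m' - e)"] m w' UD by (auto simp: D_def)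
            moreover have "m' + - (m + m' - e) \<notin> U"
              using U_add[OF _ w, of "m' + - (m + m' - e)"] 4 by auto
            moreover have "e = m + (m' + - (m + m' - e))" by simp
            ultimately show False using e(1) R m(1) 4(1) unfolding indep_def Irr_def D_def by blast
          qed
          then show ?thesis using 4 m by (simp add: d_def False \<gamma>_def D_def)
        qed
      qed
    qed
  qed
  \<comment> \<open>The tangent bound guarantees a system of largest size, and by maximality it
    meets the class of every irreducible.\<close>
  have "\<exists>R. indep R \<and> (\<forall>R'. indep R' \<longrightarrow> card R' \<le> card R)"
  proof (rule ex_has_greatest_nat)
    show "indep {}" by (simp add: indep_def)
    show "\<forall>R. indep R \<longrightarrow> card R < Suc CARD('n)"
    proof (intro allI impI)
      fix R assume R: "indep R"
      have "card R \<le> card (G \<union> R)" using R G by (intro card_mono) (auto simp: indep_def)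
      then show "card R < Suc CARD('n)" using bound[OF R] by simp
    qed
  qed
  then obtain R where R: "indep R" and R_max: "\<And>R'. indep R' \<Longrightarrow> card R' \<le> card R" by blast
  have RD: "R \<subseteq> D" and RU: "R \<inter> U = {}" and Rfin: "finite R" using R by (auto simp: indep_def Irr_def)
  have rep: "\<exists>r\<in>R. h - r \<in> U" if h: "h \<in> Irr" for h
  proof (rule ccontr)
    assume no: "\<not> (\<exists>r\<in>R. h - r \<in> U)"
    have "r - h \<notin> U" if "r \<in> R" for r using no that U_diff[OF U_0, of "r - h"] by auto
    then have "indep (insert h R)" using R h no by (auto simp: indep_def)
    moreover have "h \<notin> R" using no U_0 by force
    ultimately show False using R_max[of "insert h R"] Rfin by simp
  qed
  define E where "E = G \<union> R"
  have Efin: "finite E" and ED: "E \<subseteq> D" using G UD RD Rfin by (auto simp: E_def)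
  \<comment> \<open>Coefficients are nonnegative on irreducibles only; on the basis of the units any
    sign is allowed.\<close>
  define gen where "gen = (\<lambda>m. \<exists>k. m = (\<Sum>e\<in>E. k e *s e) \<and> (\<forall>r\<in>R. (0::int) \<le> k r))"
  have gen_add: "gen (m + m')" if "gen m" "gen m'" for m m'
  proof -
    obtain k k' where k: "m = (\<Sum>e\<in>E. k e *s e)" "m' = (\<Sum>e\<in>E. k' e *s e)" "\<forall>r\<in>R. 0 \<le> k r" "\<forall>r\<in>R. 0 \<le> k' r"
      using \<open>gen m\<close> \<open>gen m'\<close> unfolding gen_def by blast
    have "m + m' = (\<Sum>e\<in>E. (k e + k' e) *s e)"
      unfolding k(1,2) by (simp add: vec_eq_iff sum.distrib distrib_right)
    then show ?thesis using k unfolding gen_def by (intro exI[of _ "\<lambda>e. k e + k' e"]) auto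
  qed
  have gen_U: "gen m" if "m \<in> U" for m
  proof -
    have "(\<Sum>e\<in>E. (if e \<in> G then coord m e else 0) *s e) = (\<Sum>e\<in>G. coord m e *s e)"
      by (rule sum.mono_neutral_cong_right) (use Efin in \<open>auto simp: E_def\<close>)
    then show ?thesis using bspec[OF coord that] RU G(2) unfolding gen_def
      by (intro exI[of _ "\<lambda>e. if e \<in> G then coord m e else 0"]) auto
  qed
  have gen_R: "gen r" if "r \<in> R" for r
  proof -
    have "(\<Sum>e\<in>E. (if e = r then 1 else 0) *s e) = (\<Sum>e\<in>E. if e = r then e else 0)"
      by (intro sum.cong) (auto simp: vec_eq_iff)
    then show ?thesis using that Efin unfolding gen_def
      by (intro exI[of _ "\<lambda>e. if e = r then 1 else 0"]) (auto simp: E_def)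
  qed
  have gen_D: "m \<in> D \<Longrightarrow> gen m" for m
  proof (induction "nat (ht m)" arbitrary: m rule: less_induct)
    case less
    consider "m \<in> U" | "m \<in> Irr" | a b where "a \<in> D - U" "b \<in> D - U" "m = a + b"
      using less.prems by (auto simp: Irr_def)
    then show ?case
    proof cases
      case 1 then show ?thesis by (rule gen_U)
    next
      case 2
      then obtain r where r: "r \<in> R" "m - r \<in> U" using rep by blast
      from gen_add[OF gen_R[OF r(1)] gen_U[OF r(2)]] show ?thesis by simp
    next
      case 3
      then have "0 < ht a" "0 < ht b" using ht_nonneg ht_U by (auto simp: order_less_le)
      then have "gen a" "gen b" using less.hyps[of a] less.hyps[of b] 3 by (auto simp: ht_add)
      then show ?thesis unfolding 3 by (rule gen_add)
    qed
  qed
  obtain m0 where m0: "\<And>s. s \<in> S \<Longrightarrow> s \<noteq> 0 \<Longrightarrow> 0 < pair_int s m0"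
    using interior_dual_point[OF S sc] by blast
  have m0D: "m0 \<in> D"
    unfolding D by (metis m0 less_imp_le order_refl pair_int_zero(1))
  have E_gen: "\<exists>k. m = (\<Sum>e\<in>E. k e *s e)" for m
  proof -
    \<comment> \<open>Large enough that adding \<open>N *s m0\<close> moves \<open>m\<close> into
      the dual monoid; every character is thus a difference of two generated elements.\<close>
    define N where "N = (\<Sum>s\<in>S. \<bar>pair_int s m\<bar>)"
    have N: "\<bar>pair_int s m\<bar> \<le> N" if "s \<in> S" for s
      unfolding N_def using S that by (intro member_le_sum) auto
    have N0: "0 \<le> N" by (auto simp: N_def intro: sum_nonneg)
    have "m + N *s m0 \<in> D" unfolding D
    proof
      fix s assume s: "s \<in> S"
      show "0 \<le> pair_int s (m + N *s m0)"
      proof (cases "s = 0")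
        case False
        then have "N * 1 \<le> N * pair_int s m0" using m0[OF s] N0 by (intro mult_left_mono) auto
        then show ?thesis using N[OF s] by (simp add: pair_int_add pair_int_scale)
      qed simp
    qed
    moreover have "N *s m0 \<in> D" using m0D N0 by (simp add: D pair_int_scale)
    ultimately have "gen (m + N *s m0)" "gen (N *s m0)" using gen_D by auto
    then obtain k k' where k: "m + N *s m0 = (\<Sum>e\<in>E. k e *s e)" "N *s m0 = (\<Sum>e\<in>E. k' e *s e)"
      unfolding gen_def by (elim exE conjE)
    have "m = (\<Sum>e\<in>E. k e *s e) - (\<Sum>e\<in>E. k' e *s e)"
      using arg_cong2[of _ _ _ _ "(-)", OF k] by simp
    also have "\<dots> = (\<Sum>e\<in>E. (k e - k' e) *s e)" by (simp add: vec_eq_iff sum_subtractf left_diff_distrib)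
    finally show ?thesis by (intro exI[of _ "\<lambda>e. k e - k' e"])
  qed
  \<comment> \<open>Tangent vectors bound the number of generators from above, generation of the
    lattice bounds it from below.\<close>
  have "card E = CARD('n)"
    using bound[OF R] lattice_generators_card[OF Efin E_gen] by (simp add: E_def)
  then obtain u :: "'n \<Rightarrow> int ^ 'n" where u: "bij_betw u UNIV E"
    using finite_same_card_bij[of "UNIV :: 'n set" E] Efin by auto
  have reindex: "(\<Sum>e\<in>E. k e *s e) = (\<Sum>i\<in>UNIV. k (u i) *s u i)" for k :: "int ^ 'n \<Rightarrow> int"
    using sum.reindex_bij_betw[OF u, of "\<lambda>e. k e *s e"] by simp
  have "\<forall>j. \<exists>k. axis j 1 = (\<Sum>i\<in>UNIV. k (u i) *s u i)" using E_gen unfolding reindex by blast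
  from choice[OF this] obtain k where k: "\<And>j. axis j 1 = (\<Sum>i\<in>UNIV. k j (u i) *s u i)" by auto
  \<comment> \<open>The coefficients of the standard basis with respect to \<open>u\<close>, read
    off coordinatewise, are the entries of the inverse matrix and hence give the dual basis.\<close>
  define v :: "'n \<Rightarrow> int ^ 'n" where "v = (\<lambda>i. \<chi> j. k j (u i))"
  have "(\<Sum>i\<in>UNIV. v i $ j * u i $ l) = (if j = l then 1 else 0)" for j l
  proof -
    have "(\<Sum>i\<in>UNIV. v i $ j * u i $ l) = (\<Sum>i\<in>UNIV. k j (u i) *s u i) $ l" by (simp add: v_def)
    also have "\<dots> = (if j = l then 1 else 0)" unfolding k[symmetric] by (simp add: axis_def)
    finally show ?thesis .
  qed
  from int_matrix_inverse[of "\<lambda>j i. v i $ j" "\<lambda>i l. u i $ l", OF this]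
  have "unimodular u v" by (simp add: unimodular_def pair_int_def)
  then have uni: "unimodular v u" by (rule unimodular_sym)
  define K where "K = {i. u i \<in> R}"
  have uG: "u i \<in> U" if "i \<notin> K" for i
    using that u G(2) by (auto simp: K_def E_def bij_betw_def)
  have coords: "0 \<le> pair_int (v i) m" if mi: "m \<in> D" "i \<in> K" for i m
  proof -
    obtain k where k: "m = (\<Sum>i\<in>UNIV. k (u i) *s u i)" "\<forall>r\<in>R. 0 \<le> k r"
      using gen_D[OF mi(1)] unfolding gen_def reindex by (elim exE conjE)
    have "pair_int (v i) m = (\<Sum>j\<in>UNIV. k (u j) * (if i = j then 1 else 0))"
      using uni by (subst k(1)) (simp add: pair_int_sum pair_int_scale unimodular_def)
    also have "\<dots> = k (u i)" by (simp add: mult_delta_right)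
    finally show ?thesis using k(2) mi(2) by (simp add: K_def)
  qed
  have "x \<in> \<sigma> \<longleftrightarrow> (\<forall>i\<in>K. 0 \<le> x \<bullet> lat (u i)) \<and> (\<forall>i. i \<notin> K \<longrightarrow> x \<bullet> lat (u i) = 0)" for x
  proof (intro iffI conjI ballI allI impI)
    fix i assume x: "x \<in> \<sigma>"
    show "0 \<le> x \<bullet> lat (u i)" if "i \<in> K" using that x RD by (auto simp: K_def D_def dual_monoid_def)
    show "x \<bullet> lat (u i) = 0" if "i \<notin> K"
    proof -
      have "u i \<in> D" "- u i \<in> D" using uG[OF that] UD U_diff[OF U_0 uG[OF that]] by auto
      then have "0 \<le> x \<bullet> lat (u i)" "0 \<le> x \<bullet> lat (- u i)" using x unfolding D_def dual_monoid_def by blast+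
      then show ?thesis by (simp add: lat_uminus)
    qed
  next
    assume x: "(\<forall>i\<in>K. 0 \<le> x \<bullet> lat (u i)) \<and> (\<forall>i. i \<notin> K \<longrightarrow> x \<bullet> lat (u i) = 0)"
    \<comment> \<open>By biduality it is enough to pair \<open>x\<close> with elements of the dual
      monoid, whose coordinates on \<open>K\<close> are nonnegative while those of \<open>x\<close>
      outside \<open>K\<close> vanish.\<close>
    show "x \<in> \<sigma>" unfolding \<sigma>_def
    proof (rule double_dual[OF S sc])
      fix m assume m: "m \<in> dual_monoid (cone_gen S)"
      have "0 \<le> of_int (pair_int (v j) m) * (x \<bullet> lat (u j))" for j
        using m x coords[of m j] by (cases "j \<in> K") (auto simp: D_def \<sigma>_def)
      then show "0 \<le> x \<bullet> lat m"
        unfolding unimodular_expand_inner[OF uni, of x m] by (intro sum_nonneg)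
    qed
  qed
  then have "framed \<sigma> v u K" using uni by (auto simp: framed_def)
  then show ?thesis unfolding \<sigma>_def by blast
qed


section \<open>Frames of the cones of a smooth fan, their faces and rays\<close>

lemma rational_cone_gen: "rational_cone \<sigma> \<longleftrightarrow> (\<exists>S. finite S \<and> \<sigma> = cone_gen S)"
  by (simp add: rational_cone_def cone_gen_def)

lemma fan_framed:
  fixes \<Sigma> :: "(real ^ 'n) set set"
  assumes "fan \<Sigma>" "smooth_toric \<Sigma>" "\<sigma> \<in> \<Sigma>"
  shows "\<exists>v u K. framed \<sigma> v u K"
proof -
  have "rational_cone \<sigma>" and sc: "strongly_convex \<sigma>" using assms(1,3) by (auto simp: fan_def)
  then obtain S where S: "finite S" "\<sigma> = cone_gen S" by (auto simp: rational_cone_gen)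
  have "\<exists>b::'n \<Rightarrow> 'n laurent \<Rightarrow> complex.
       \<forall>\<delta>\<in>tangent_space \<sigma> \<gamma>. \<exists>c. \<forall>f\<in>chart_ring \<sigma>. \<delta> f = (\<Sum>i\<in>UNIV. c i * b i f)"
    if "\<gamma> \<in> chart_points \<sigma>" for \<gamma>
    by (rule smooth_toric_tangent[OF assms(2,3) that]) (rule exI, rule ballI)
  then show ?thesis unfolding S(2) by (intro smooth_cone_framed S(1) sc[unfolded S(2)])
qed

text \<open>The face inherits the frame: it is spanned by the basis vectors it contains, because a
  basis vector with positive coefficient in a point of a face belongs to the face.\<close>

lemma framed_face:
  assumes f: "framed \<sigma> v u K" and face: "\<tau> face_of \<sigma>" and cone: "rational_cone \<tau>"
  shows "framed \<tau> v u {i \<in> K. lat (v i) \<in> \<tau>}"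
proof -
  obtain S where \<tau>: "\<tau> = cone_gen S" using cone by (auto simp: rational_cone_gen)
  have uni: "unimodular v u" using f by (simp add: framed_def)
  have \<sigma>: "x \<in> \<sigma> \<longleftrightarrow> (\<forall>i\<in>K. 0 \<le> x \<bullet> lat (u i)) \<and> (\<forall>i. i \<notin> K \<longrightarrow> x \<bullet> lat (u i) = 0)" for x
    using f by (auto simp: framed_def)
  have sub: "\<tau> \<subseteq> \<sigma>" using face by (simp add: face_of_def)
  have zero: "x \<bullet> lat (u i) = 0" if x: "x \<in> \<tau>" and i: "i \<in> K" "lat (v i) \<notin> \<tau>" for x i
  proof (rule ccontr)
    define c where "c = x \<bullet> lat (u i)"
    assume "x \<bullet> lat (u i) \<noteq> 0"
    then have c: "c > 0" using sub x i(1) \<sigma>[of x] by (auto simp: c_def less_le)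
    \<comment> \<open>The point \<open>x\<close> is the midpoint of \<open>y\<close>, twice its part
      along \<open>v i\<close>, and \<open>z\<close>, twice the rest. Both lie in the cone, so the
      face contains \<open>y\<close>.\<close>
    define y where "y = (2 * c) *\<^sub>R lat (v i)"
    define z where "z = 2 *\<^sub>R (x - c *\<^sub>R lat (v i))"
    have y: "y \<in> \<sigma>" unfolding y_def using framed_gen[OF f i(1)] c by simp
    have zu: "z \<bullet> lat (u j) = (if i = j then 0 else 2 * (x \<bullet> lat (u j)))" for j
      by (auto simp: z_def inner_diff_left unimodular_inner[OF uni] c_def)
    have "z \<in> \<sigma>" using sub x unfolding \<sigma> zu by (auto simp: \<sigma>)
    moreover have "y \<noteq> z"
      using zu[of i] c by (auto simp: y_def unimodular_inner[OF uni])
    moreover have "x = (1 - 1/2) *\<^sub>R y + (1/2) *\<^sub>R z" by (simp add: y_def z_def scaleR_diff_right)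
    ultimately have "x \<in> open_segment y z"
      unfolding in_segment by (intro conjI exI[of _ "1/2"]) auto
    then have "y \<in> \<tau>" using face x y \<open>z \<in> \<sigma>\<close> unfolding face_of_def by blast
    then have "(1 / (2 * c)) *\<^sub>R y \<in> \<tau>" unfolding \<tau> using c by (intro cone_gen_scale) auto
    then show False using i c by (simp add: y_def)
  qed
  have mem: "x \<in> \<tau>" if x: "\<forall>i\<in>{i \<in> K. lat (v i) \<in> \<tau>}. 0 \<le> x \<bullet> lat (u i)"
    "\<forall>i. i \<notin> {i \<in> K. lat (v i) \<in> \<tau>} \<longrightarrow> x \<bullet> lat (u i) = 0" for x
  proof -
    have "(x \<bullet> lat (u j)) *\<^sub>R lat (v j) \<in> \<tau>" for j
    proof (cases "j \<in> {i \<in> K. lat (v i) \<in> \<tau>}")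
      case True
      then show ?thesis using x(1) unfolding \<tau> by (intro cone_gen_scale) auto
    next
      case False
      then have "x \<bullet> lat (u j) = 0" using x(2) by blast
      then show ?thesis by (simp add: \<tau> cone_gen_zero)
    qed
    then have "(\<Sum>j\<in>A. (x \<bullet> lat (u j)) *\<^sub>R lat (v j)) \<in> \<tau>" for A
      unfolding \<tau> by (induction A rule: infinite_finite_induct) (auto intro: cone_gen_zero cone_gen_add)
    then show ?thesis by (subst unimodular_expand_real[OF uni])
  qed
  have "\<tau> = {x. (\<forall>i\<in>{i \<in> K. lat (v i) \<in> \<tau>}. 0 \<le> x \<bullet> lat (u i)) \<and>
     (\<forall>i. i \<notin> {i \<in> K. lat (v i) \<in> \<tau>} \<longrightarrow> x \<bullet> lat (u i) = 0)}" (is "\<tau> = ?R")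
  proof
    show "?R \<subseteq> \<tau>" using mem by blast
    show "\<tau> \<subseteq> ?R" using zero sub \<sigma> by blast
  qed
  then show ?thesis using uni by (simp add: framed_def)
qed

text \<open>Off \<open>i\<close> the endpoints of a segment through \<rho> have nonnegative
  coordinates with a convex combination equal to 0, so these vanish. Hence every basis vector with
  index in \<open>K\<close> spans a face.\<close>

lemma framed_ray:
  assumes f: "framed \<sigma> v u K" and i: "i \<in> K"
  defines "\<rho> \<equiv> {x. 0 \<le> x \<bullet> lat (u i) \<and> (\<forall>j. j \<noteq> i \<longrightarrow> x \<bullet> lat (u j) = 0)}"
  shows "framed \<rho> v u {i}" "\<rho> face_of \<sigma>"
proof -
  have uni: "unimodular v u" using f by (simp add: framed_def)
  have \<sigma>: "x \<in> \<sigma> \<longleftrightarrow> (\<forall>i\<in>K. 0 \<le> x \<bullet> lat (u i)) \<and> (\<forall>i. i \<notin> K \<longrightarrow> x \<bullet> lat (u i) = 0)" for x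
    using f by (auto simp: framed_def)
  show "framed \<rho> v u {i}" using uni by (auto simp: framed_def \<rho>_def)
  show "\<rho> face_of \<sigma>"
    unfolding face_of_def
  proof (intro conjI ballI impI)
    show "\<rho> \<subseteq> \<sigma>"
    proof
      fix x assume "x \<in> \<rho>"
      then show "x \<in> \<sigma>" unfolding \<sigma> \<rho>_def using i by (metis (mono_tags, lifting) mem_Collect_eq order_refl)
    qed
    show "convex \<rho>"
      by (auto simp: convex_def \<rho>_def inner_add_left)
    fix a b x assume ab: "a \<in> \<sigma>" "b \<in> \<sigma>" and x: "x \<in> \<rho>" "x \<in> open_segment a b"
    obtain t where t: "0 < t" "t < 1" "x = (1 - t) *\<^sub>R a + t *\<^sub>R b" using x(2) by (auto simp: in_segment)
    have nonneg: "0 \<le> a \<bullet> lat (u j)" "0 \<le> b \<bullet> lat (u j)" for j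
      using ab unfolding \<sigma> by (cases "j \<in> K"; auto)+
    have "a \<bullet> lat (u j) = 0 \<and> b \<bullet> lat (u j) = 0" if "j \<noteq> i" for j
    proof -
      have "(1 - t) * (a \<bullet> lat (u j)) + t * (b \<bullet> lat (u j)) = 0"
        using x(1) that t(3) by (simp add: \<rho>_def inner_add_left)
      moreover have "0 \<le> (1 - t) * (a \<bullet> lat (u j))" "0 \<le> t * (b \<bullet> lat (u j))" using t nonneg by auto
      ultimately have "(1 - t) * (a \<bullet> lat (u j)) = 0" "t * (b \<bullet> lat (u j)) = 0" by linarith+
      then show ?thesis using t by auto
    qed
    then show "a \<in> \<rho>" "b \<in> \<rho>" using nonneg by (auto simp: \<rho>_def)
  qed
qed

lemma framed_prim_gen:
  assumes "framed \<rho> v u {i}"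
  shows "prim_gen \<rho> = v i"
  unfolding prim_gen_def
proof (rule the_equality)
  have uni: "unimodular v u" using assms by (simp add: framed_def)
  have v0: "v i \<noteq> 0" using uni[unfolded unimodular_def, rule_format, of i i] by auto
  have vi: "lat (v i) \<in> \<rho>" using framed_gen_iff[OF assms] by simp
  have mult: "\<exists>k::nat. w = (\<chi> j. int k * v i $ j)" if "lat w \<in> \<rho>" for w
  proof -
    have "0 \<le> pair_int w (u i)" and z: "\<And>j. j \<noteq> i \<Longrightarrow> pair_int w (u j) = 0"
      using that assms by (auto simp: framed_def lat_inner)
    have "w = (\<Sum>j\<in>UNIV. pair_int (u j) w *s v j)"
      by (rule unimodular_expand[OF unimodular_sym[OF uni]])
    also have "\<dots> = (\<Sum>j\<in>UNIV. if j = i then pair_int w (u i) *s v i else 0)"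
      by (intro sum.cong refl) (simp add: pair_int_commute[of _ w] z)
    also have "\<dots> = pair_int w (u i) *s v i" by simp
    finally show ?thesis using \<open>0 \<le> pair_int w (u i)\<close>
      by (intro exI[of _ "nat (pair_int w (u i))"]) (simp add: vec_eq_iff)
  qed
  show "v i \<noteq> 0 \<and> lat (v i) \<in> \<rho> \<and> (\<forall>w. lat w \<in> \<rho> \<longrightarrow> (\<exists>k::nat. w = (\<chi> j. int k * v i $ j)))"
    using v0 vi mult by blast
  fix v' assume v': "v' \<noteq> 0 \<and> lat v' \<in> \<rho> \<and> (\<forall>w. lat w \<in> \<rho> \<longrightarrow> (\<exists>k::nat. w = (\<chi> j. int k * v' $ j)))"
  \<comment> \<open>Two candidates are natural multiples of each other, so both factors are
    1.\<close>
  then obtain k l :: nat where k: "v' = (\<chi> j. int k * v i $ j)" and l: "v i = (\<chi> j. int l * v' $ j)"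
    using mult vi by blast
  obtain j where j: "v i $ j \<noteq> 0" using v0 by (auto simp: vec_eq_iff)
  have "v i $ j = int l * v' $ j" by (subst l) simp
  moreover have "v' $ j = int k * v i $ j" by (subst k) simp
  ultimately have "v i $ j = int l * int k * v i $ j" by simp
  then have "int (l * k) = 1" using j by simp
  then have "l * k = 1" by (simp only: of_nat_eq_1_iff)
  then have "k = 1" by simp
  then show "v' = v i" using k by (simp add: vec_eq_iff)
qed

lemma framed_independent:
  assumes f: "framed \<sigma> v u K"
  shows "independent (lat ` v ` K)" "card (lat ` v ` K) = card K"
proof -
  have uni: "unimodular v u" using f by (simp add: framed_def)
  have inj: "inj_on (\<lambda>i. lat (v i)) K"
  proof (rule inj_onI)
    fix i j assume "lat (v i) = lat (v j)"
    then have "lat (v i) \<bullet> lat (u i) = lat (v j) \<bullet> lat (u i)" by (rule arg_cong)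
    then show "i = j" unfolding unimodular_inner[OF uni] by (simp split: if_splits)
  qed
  show "card (lat ` v ` K) = card K" unfolding image_image by (rule card_image[OF inj])
  show "independent (lat ` v ` K)"
    unfolding image_image
  proof (rule independent_if_scalars_zero)
    fix c x assume s: "(\<Sum>x\<in>(\<lambda>i. lat (v i)) ` K. c x *\<^sub>R x) = 0" and "x \<in> (\<lambda>i. lat (v i)) ` K"
    then obtain i where i: "i \<in> K" "x = lat (v i)" by blast
    have "0 = (\<Sum>j\<in>K. c (lat (v j)) *\<^sub>R lat (v j)) \<bullet> lat (u i)" using s by (simp add: sum.reindex[OF inj])
    also have "\<dots> = c x" using i by (simp add: inner_sum_left unimodular_inner[OF uni] if_distrib cong: if_cong)
    finally show "c x = 0" by simp
  qed simp
qed

lemma framed_dim: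
  fixes v :: "'n \<Rightarrow> int ^ 'n"
  assumes f: "framed \<sigma> v u K"
  shows "dim \<sigma> = card K"
proof (rule antisym)
  have uni: "unimodular v u" using f by (simp add: framed_def)
  have "\<sigma> \<subseteq> span (lat ` v ` K)"
  proof
    fix x assume x: "x \<in> \<sigma>"
    have "(x \<bullet> lat (u j)) *\<^sub>R lat (v j) \<in> span (lat ` v ` K)" for j
      using x f by (cases "j \<in> K") (auto simp: framed_def span_base span_scale span_zero)
    then show "x \<in> span (lat ` v ` K)"
      by (subst unimodular_expand_real[OF uni]) (intro span_sum)
  qed
  then show "dim \<sigma> \<le> card K" using dim_le_card[of \<sigma> "lat ` v ` K"] framed_independent(2)[OF f] by simp
  have "lat ` v ` K \<subseteq> \<sigma>" using framed_gen_iff[OF f] by auto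
  then show "card K \<le> dim \<sigma>" using independent_card_le_dim[OF _ framed_independent(1)[OF f]] framed_independent(2)[OF f] by simp
qed

section \<open>Derivations and their symbols\<close>

abbreviation lmonom :: "int ^ 'n \<Rightarrow> 'n::finite laurent" where
  "lmonom m \<equiv> Poly_Mapping.single m 1"

definition torus_eval :: "complex ^ 'n \<Rightarrow> 'n::finite laurent \<Rightarrow> complex" where
  "torus_eval a f = chart_eval (\<lambda>m. chi m a) f"

lemma torus_eval_add: "torus_eval a (f + g) = torus_eval a f + torus_eval a g"
  by (simp add: torus_eval_def chart_eval_pm_eval pm_eval_add)

lemma torus_eval_zero [simp]: "torus_eval a 0 = 0"
  by (simp add: torus_eval_def chart_eval_pm_eval)

lemma torus_eval_mult: "torus_eval a (f * g) = torus_eval a f * torus_eval a g"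
  by (simp add: torus_eval_def chart_eval_pm_eval pm_eval_mult chi_add)

lemma torus_eval_single: "torus_eval a (Poly_Mapping.single m c) = c * chi m a"
  by (simp add: torus_eval_def chart_eval_pm_eval pm_eval_single)

lemma torus_eval_one [simp]: "torus_eval a 1 = 1"
  using torus_eval_single[of a 0 1] by simp

lemma torus_eval_lconst: "torus_eval a (lconst c) = c"
  by (simp add: lconst_def torus_eval_single)

lemma torus_eval_sum: "torus_eval a (sum f A) = (\<Sum>x\<in>A. torus_eval a (f x))"
  by (induction A rule: infinite_finite_induct) (simp_all add: torus_eval_add)

lemma torus_eval_uminus: "torus_eval a (- f) = - torus_eval a f"
  using torus_eval_add[of a "- f" f] by (simp add: eq_neg_iff_add_eq_0)

text \<open>Identities in chart rings and between derivations can thus be checked at the points of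
  the torus.\<close>

lemma torus_eval_eqI:
  assumes "\<And>a. torus_eval a f = torus_eval a g"
  shows "f = g"
proof -
  have "Poly_Mapping.lookup (f - g) m = 0" if "m \<in> Poly_Mapping.keys (f - g)" for m
  proof (rule chi_independent[OF _ _ that])
    fix a
    have "torus_eval a (f + - g) = 0" unfolding torus_eval_add torus_eval_uminus using assms by simp
    then show "(\<Sum>m\<in>Poly_Mapping.keys (f - g). Poly_Mapping.lookup (f - g) m * chi m a) = 0"
      by (simp add: torus_eval_def chart_eval_def)
  qed simp
  then have "Poly_Mapping.lookup (f - g) m = 0" for m by (cases "m \<in> Poly_Mapping.keys (f - g)") (auto simp: in_keys_iff)
  then show ?thesis by (intro poly_mapping_eqI) (simp add: lookup_minus)
qed

section \<open>Derivations of chart rings in a frame\<close>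

lemma chart_ring_add: "f \<in> chart_ring \<sigma> \<Longrightarrow> g \<in> chart_ring \<sigma> \<Longrightarrow> f + g \<in> chart_ring \<sigma>"
  using Poly_Mapping.keys_add[of f g] by (auto simp: chart_ring_def)

lemma chart_ring_mult: "f \<in> chart_ring \<sigma> \<Longrightarrow> g \<in> chart_ring \<sigma> \<Longrightarrow> f * g \<in> chart_ring \<sigma>"
  using keys_mult[of f g] by (auto simp: chart_ring_def intro!: dual_monoid_add)

lemma chart_ring_zero: "0 \<in> chart_ring \<sigma>"
  by (simp add: chart_ring_def)

lemma chart_ring_one: "1 \<in> chart_ring \<sigma>"
  by (simp add: chart_ring_def dual_monoid_zero)

lemma chart_ring_uminus: "f \<in> chart_ring \<sigma> \<Longrightarrow> - f \<in> chart_ring \<sigma>"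
  by (simp add: chart_ring_def)

lemma chart_ring_single: "m \<in> dual_monoid \<sigma> \<Longrightarrow> Poly_Mapping.single m c \<in> chart_ring \<sigma>"
  by (auto simp: chart_ring_def)

lemma chart_ring_lconst: "lconst c \<in> chart_ring \<sigma>"
  by (simp add: lconst_def chart_ring_single dual_monoid_zero)

lemma chart_ring_sum: "(\<And>x. x \<in> A \<Longrightarrow> f x \<in> chart_ring \<sigma>) \<Longrightarrow> sum f A \<in> chart_ring \<sigma>"
  by (induction A rule: infinite_finite_induct) (auto intro: chart_ring_zero chart_ring_add)

lemma derivation_closed: "D \<in> carrier (derivations R) \<Longrightarrow> f \<in> R \<Longrightarrow> D f \<in> R"
  by (auto simp: derivations_def)

lemma derivation_add: "D \<in> carrier (derivations R) \<Longrightarrow> f \<in> R \<Longrightarrow> g \<in> R \<Longrightarrow> D (f + g) = D f + D g"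
  by (auto simp: derivations_def)

lemma derivation_lconst: "D \<in> carrier (derivations R) \<Longrightarrow> f \<in> R \<Longrightarrow> D (lconst c * f) = lconst c * D f"
  by (auto simp: derivations_def)

lemma derivation_mult: "D \<in> carrier (derivations R) \<Longrightarrow> f \<in> R \<Longrightarrow> g \<in> R \<Longrightarrow> D (f * g) = f * D g + g * D f"
  by (auto simp: derivations_def)

lemma derivation_extensional: "D \<in> carrier (derivations R) \<Longrightarrow> f \<notin> R \<Longrightarrow> D f = undefined"
  by (auto simp: derivations_def)

lemma derivation_eqI:
  "D \<in> carrier (derivations R) \<Longrightarrow> E \<in> carrier (derivations R) \<Longrightarrow> (\<And>f. f \<in> R \<Longrightarrow> D f = E f) \<Longrightarrow> D = E"
  using derivation_extensional by (metis ext)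

lemma derivations_add_closed:
  assumes "D \<in> carrier (derivations (chart_ring \<sigma>))" "E \<in> carrier (derivations (chart_ring \<sigma>))"
  shows "D \<oplus>\<^bsub>derivations (chart_ring \<sigma>)\<^esub> E \<in> carrier (derivations (chart_ring \<sigma>))"
  using assms
  by (auto simp: derivations_def PiE_iff chart_ring_add chart_ring_mult chart_ring_lconst algebra_simps)

lemma derivations_smult_closed:
  assumes "D \<in> carrier (derivations (chart_ring \<sigma>))" "r \<in> chart_ring \<sigma>"
  shows "r \<odot>\<^bsub>derivations (chart_ring \<sigma>)\<^esub> D \<in> carrier (derivations (chart_ring \<sigma>))"
  using assms
  by (auto simp: derivations_def PiE_iff chart_ring_add chart_ring_mult chart_ring_lconst algebra_simps)

lemma derivations_zero_closed: "\<zero>\<^bsub>derivations (chart_ring \<sigma>)\<^esub> \<in> carrier (derivations (chart_ring \<sigma>))"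
  by (auto simp: derivations_def chart_ring_add chart_ring_mult chart_ring_lconst chart_ring_zero)

lemma derivation_sum:
  assumes D: "D \<in> carrier (derivations (chart_ring \<sigma>))" and "\<And>x. x \<in> A \<Longrightarrow> f x \<in> chart_ring \<sigma>"
  shows "D (sum f A) = (\<Sum>x\<in>A. D (f x))"
proof -
  have "D (lconst 0 * 0) = lconst 0 * D 0" using derivation_lconst[OF D chart_ring_zero] .
  then have D0: "D 0 = 0" by (simp add: lconst_def)
  show ?thesis using assms(2)
    by (induction A rule: infinite_finite_induct) (simp_all add: D0 derivation_add[OF D] chart_ring_sum)
qed

lemma torus_eval_derivation:
  assumes D: "D \<in> carrier (derivations (chart_ring \<sigma>))" and f: "f \<in> chart_ring \<sigma>"
  shows "torus_eval a (D f) = (\<Sum>m\<in>Poly_Mapping.keys f. Poly_Mapping.lookup f m * torus_eval a (D (lmonom m)))"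
proof -
  have keys: "m \<in> dual_monoid \<sigma>" if "m \<in> Poly_Mapping.keys f" for m using f that by (auto simp: chart_ring_def)
  have "D f = D (\<Sum>m\<in>Poly_Mapping.keys f. lconst (Poly_Mapping.lookup f m) * lmonom m)"
    by (subst poly_mapping_sum_singles[of f]) (simp add: lconst_def mult_single)
  also have "\<dots> = (\<Sum>m\<in>Poly_Mapping.keys f. lconst (Poly_Mapping.lookup f m) * D (lmonom m))"
    using keys by (subst derivation_sum[OF D]) (auto intro!: sum.cong chart_ring_mult chart_ring_lconst chart_ring_single
        simp: derivation_lconst[OF D] chart_ring_single)
  finally show ?thesis by (simp add: torus_eval_sum torus_eval_mult torus_eval_lconst)
qed

text \<open>With \<open>\<partial>\<^sub>v\<close> multiplying the character m by the pairing of v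
  and m, a derivation is the sum of
  \<open>D(\<chi>\<^sup>u) \<chi>\<^sup>-\<^sup>u \<partial>\<^sub>v\<close> over the dual pairs of
  the frame. The symbol replaces each \<open>\<partial>\<^sub>v\<close> by the linear form of
  v.\<close>

definition der_symbol ::
    "('n \<Rightarrow> int ^ 'n) \<Rightarrow> ('n \<Rightarrow> int ^ 'n) \<Rightarrow> ('n::finite laurent \<Rightarrow> 'n laurent) \<Rightarrow> 'n symbol" where
  "der_symbol v u D a y = (\<Sum>j\<in>UNIV. torus_eval a (D (lmonom (u j))) * chi (- u j) a * cpair (v j) y)"

text \<open>This is \<open>\<chi>\<^sup>-\<^sup>u \<partial>\<^sub>v\<close>, the partial derivative
  with respect to the coordinate \<open>lmonom (u j)\<close>.\<close>

definition basis_derivation ::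
    "(real ^ 'n) set \<Rightarrow> ('n \<Rightarrow> int ^ 'n) \<Rightarrow> ('n \<Rightarrow> int ^ 'n) \<Rightarrow> 'n \<Rightarrow> 'n::finite laurent \<Rightarrow> 'n laurent" where
  "basis_derivation \<sigma> v u j = (\<lambda>f\<in>chart_ring \<sigma>. \<Sum>m\<in>Poly_Mapping.keys f.
     Poly_Mapping.single (m - u j) (of_int (pair_int (v j) m) * Poly_Mapping.lookup f m))"

lemma unimodular_expand_complex:
  assumes "unimodular v u"
  shows "y = (\<Sum>j\<in>UNIV. cpair (v j) y *s cvec (u j))"
proof (subst vec_eq_iff, intro allI)
  fix k
  have "(\<Sum>j\<in>UNIV. cpair (v j) y *s cvec (u j)) $ k = (\<Sum>j\<in>UNIV. \<Sum>l\<in>UNIV. of_int (u j $ k * v j $ l) * y $ l)"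
    by (simp add: cpair_def cvec_def sum_distrib_left sum_distrib_right mult_ac)
  also have "\<dots> = (\<Sum>l\<in>UNIV. of_int (\<Sum>j\<in>UNIV. u j $ k * v j $ l) * y $ l)"
    by (subst sum.swap) (simp add: sum_distrib_right)
  also have "\<dots> = (\<Sum>l\<in>UNIV. if k = l then y $ l else 0)"
    unfolding unimodular_delta[OF assms] by (intro sum.cong) auto
  also have "\<dots> = y $ k" by simp
  finally show "y $ k = (\<Sum>j\<in>UNIV. cpair (v j) y *s cvec (u j)) $ k" by simp
qed

locale framed_cone =
  fixes \<sigma> :: "(real ^ 'n::finite) set" and v u :: "'n \<Rightarrow> int ^ 'n" and K :: "'n set"
  assumes framed: "framed \<sigma> v u K"
begin

abbreviation "R \<equiv> chart_ring \<sigma>"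
abbreviation "M \<equiv> derivations R"

lemma unimodular: "unimodular v u"
  using framed by (simp add: framed_def)

lemma pair_vu: "pair_int (v i) (u j) = (if i = j then 1 else 0)"
  using unimodular by (simp add: unimodular_def)

lemma dual: "m \<in> dual_monoid \<sigma> \<longleftrightarrow> (\<forall>i\<in>K. 0 \<le> pair_int (v i) m)"
  by (simp add: framed_dual_monoid[OF framed])

lemma u_dual: "u j \<in> dual_monoid \<sigma>"
  by (simp add: dual pair_vu)

lemma lmonom_u [simp]: "lmonom (u j) \<in> R"
  by (intro chart_ring_single u_dual)

text \<open>Additivity is available on the dual monoid only, so the partial sums of the expansion
  have to stay inside it.\<close>

lemma additive_expand:
  fixes F :: "int ^ 'n \<Rightarrow> complex"
  assumes add: "\<And>m m'. m \<in> dual_monoid \<sigma> \<Longrightarrow> m' \<in> dual_monoid \<sigma> \<Longrightarrow> F (m + m') = F m + F m'"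
    and m: "m \<in> dual_monoid \<sigma>"
  shows "F m = (\<Sum>j\<in>UNIV. of_int (pair_int (v j) m) * F (u j))"
proof -
  have F0: "F 0 = 0" using add[OF dual_monoid_zero dual_monoid_zero] by simp
  have nat: "F (int k *s w) = of_nat k * F w \<and> int k *s w \<in> dual_monoid \<sigma>" if w: "w \<in> dual_monoid \<sigma>" for k w
  proof (induction k)
    case (Suc k)
    have "int (Suc k) *s w = w + int k *s w" by (simp add: vec_eq_iff algebra_simps)
    then show ?case using Suc add[OF w, of "int k *s w"] dual_monoid_add[OF w, of "int k *s w"] by (simp add: distrib_right)
  qed (simp add: F0 dual_monoid_zero)
  \<comment> \<open>A negative multiple occurs only for \<open>j\<close> outside \<open>K\<close>,
    and there \<open>- u j\<close> belongs to the monoid as well.\<close>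
  have int: "F (k *s u j) = of_int k * F (u j) \<and> k *s u j \<in> dual_monoid \<sigma>" if k: "0 \<le> k \<or> j \<notin> K" for k j
  proof (cases "0 \<le> k")
    case True
    then show ?thesis using nat[OF u_dual, of "nat k" j] by simp
  next
    case False
    then have "j \<notin> K" using k by simp
    then have mu: "- u j \<in> dual_monoid \<sigma>" by (auto simp: dual pair_vu pair_int_uminus)
    have "F (- u j) = - F (u j)" using add[OF u_dual[of j] mu] F0 by (simp add: eq_neg_iff_add_eq_0 add.commute)
    moreover have "int (nat (- k)) *s (- u j) = k *s u j" using False by (simp add: vec_eq_iff)
    ultimately show ?thesis using nat[OF mu, of "nat (- k)"] False by simp
  qed
  have "F (\<Sum>j\<in>A. pair_int (v j) m *s u j) = (\<Sum>j\<in>A. of_int (pair_int (v j) m) * F (u j)) \<and>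
    (\<Sum>j\<in>A. pair_int (v j) m *s u j) \<in> dual_monoid \<sigma>" if "finite A" for A
    using that
  proof (induction A rule: finite_induct)
    case (insert j A)
    have "0 \<le> pair_int (v j) m \<or> j \<notin> K" using m by (auto simp: dual)
    from int[OF this] insert show ?case by (simp add: add dual_monoid_add)
  qed (simp add: F0 dual_monoid_zero)
  from this[of UNIV] show ?thesis unfolding unimodular_expand[OF unimodular, of m, symmetric] by simp
qed

text \<open>The logarithmic derivative of characters is additive in \<open>m\<close>, hence
  determined by its values at the \<open>u j\<close>. Its value at m is the symbol at the covector
  \<open>cvec m\<close>.\<close>

lemma derivation_lmonom:
  assumes D: "D \<in> carrier M" and m: "m \<in> dual_monoid \<sigma>"
  shows "torus_eval a (D (lmonom m)) = chi m a * der_symbol v u D a (cvec m)"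
proof -
  define F where "F = (\<lambda>m. torus_eval a (D (lmonom m)) * chi (- m) a)"
  have "F (m + m') = F m + F m'" if "m \<in> dual_monoid \<sigma>" "m' \<in> dual_monoid \<sigma>" for m m'
  proof -
    have "D (lmonom m * lmonom m') = lmonom m * D (lmonom m') + lmonom m' * D (lmonom m)"
      using that by (intro derivation_mult[OF D] chart_ring_single)
    then have "torus_eval a (D (lmonom (m + m'))) = chi m a * torus_eval a (D (lmonom m')) + chi m' a * torus_eval a (D (lmonom m))"
      by (simp add: mult_single torus_eval_add torus_eval_mult torus_eval_single)
    then show ?thesis by (simp add: F_def chi_uminus chi_add field_simps)
  qed
  from additive_expand[of F, OF this m]
  have "F m = der_symbol v u D a (cvec m)"
    by (simp add: F_def der_symbol_def cpair_cvec mult.commute)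
  then show ?thesis by (simp add: F_def chi_uminus field_simps)
qed

lemma torus_eval_basis_derivation:
  assumes "f \<in> R"
  shows "torus_eval a (basis_derivation \<sigma> v u j f) =
    chi (- u j) a * chart_eval (\<lambda>m. of_int (pair_int (v j) m) * chi m a) f"
  using assms by (simp add: basis_derivation_def torus_eval_sum torus_eval_single chart_eval_def
      sum_distrib_left chi_diff chi_uminus field_simps)

text \<open>Division by the character of \<open>u j\<close> lowers only the \<open>j\<close>-th
  coordinate of a monomial. If that coordinate is constrained, it is positive or the coefficient
  \<open>pair_int (v j) m\<close> kills the monomial.\<close>

lemma basis_derivation_closed: "basis_derivation \<sigma> v u j \<in> carrier M"
proof -
  have "basis_derivation \<sigma> v u j f \<in> R" if f: "f \<in> R" for f
  proof -
    have "Poly_Mapping.single (m - u j) (of_int (pair_int (v j) m) * Poly_Mapping.lookup f m) \<in> R"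
      if "m \<in> Poly_Mapping.keys f" for m
    proof (cases "pair_int (v j) m = 0")
      case True
      then show ?thesis by (simp add: chart_ring_zero)
    next
      case False
      have m: "m \<in> dual_monoid \<sigma>" using f that by (auto simp: chart_ring_def)
      have "m - u j \<in> dual_monoid \<sigma>" unfolding dual
      proof
        fix i assume "i \<in> K"
        then have "0 \<le> pair_int (v i) m" using m by (simp add: dual)
        then show "0 \<le> pair_int (v i) (m - u j)" using False by (auto simp: pair_int_diff pair_vu)
      qed
      then show ?thesis by (rule chart_ring_single)
    qed
    then show ?thesis using f by (simp add: basis_derivation_def chart_ring_sum)
  qed
  moreover have "basis_derivation \<sigma> v u j (f + g) = basis_derivation \<sigma> v u j f + basis_derivation \<sigma> v u j g"
    if "f \<in> R" "g \<in> R" for f g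
    by (rule torus_eval_eqI) (simp add: that chart_ring_add torus_eval_basis_derivation torus_eval_add
        chart_eval_pm_eval pm_eval_add distrib_left)
  moreover have "basis_derivation \<sigma> v u j (lconst c * f) = lconst c * basis_derivation \<sigma> v u j f"
    if "f \<in> R" for f c
    by (rule torus_eval_eqI) (simp add: that chart_ring_mult chart_ring_lconst torus_eval_basis_derivation
        torus_eval_mult torus_eval_lconst chart_eval_lconst)
  moreover have "basis_derivation \<sigma> v u j (f * g) = f * basis_derivation \<sigma> v u j g + g * basis_derivation \<sigma> v u j f"
    if "f \<in> R" "g \<in> R" for f g
  proof (rule torus_eval_eqI)
    fix a
    have "chart_eval (\<lambda>m. of_int (pair_int (v j) m) * chi m a) (f * g) =
      chart_eval (\<lambda>m. chi m a) f * chart_eval (\<lambda>m. of_int (pair_int (v j) m) * chi m a) g +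
      chart_eval (\<lambda>m. chi m a) g * chart_eval (\<lambda>m. of_int (pair_int (v j) m) * chi m a) f"
      by (rule chart_eval_leibniz) (simp add: pair_int_add chi_add algebra_simps)
    then show "torus_eval a (basis_derivation \<sigma> v u j (f * g)) =
      torus_eval a (f * basis_derivation \<sigma> v u j g + g * basis_derivation \<sigma> v u j f)"
      using that by (simp add: chart_ring_mult torus_eval_basis_derivation torus_eval_add torus_eval_mult
          algebra_simps flip: torus_eval_def)
  qed
  moreover have "basis_derivation \<sigma> v u j f = undefined" if "f \<notin> R" for f
    using that by (simp add: basis_derivation_def)
  ultimately show ?thesis by (auto simp: derivations_def)
qed

lemma der_symbol_basis: "der_symbol v u (basis_derivation \<sigma> v u j) a y = chi (- u j) a * cpair (v j) y"
proof -
  have "torus_eval a (basis_derivation \<sigma> v u j (lmonom (u i))) * chi (- u i) a * cpair (v i) y =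
    (if i = j then chi (- u j) a * cpair (v j) y else 0)" for i
    by (auto simp: torus_eval_basis_derivation chart_eval_pm_eval pm_eval_single pair_vu chi_uminus)
  then show ?thesis by (simp add: der_symbol_def)
qed

lemma der_symbol_add:
  "D \<in> carrier M \<Longrightarrow> E \<in> carrier M \<Longrightarrow>
   der_symbol v u (D \<oplus>\<^bsub>M\<^esub> E) a y = der_symbol v u D a y + der_symbol v u E a y"
  unfolding der_symbol_def sum.distrib[symmetric]
  by (intro sum.cong refl) (simp add: derivations_def torus_eval_add algebra_simps)

lemma der_symbol_smult:
  "D \<in> carrier M \<Longrightarrow> der_symbol v u (r \<odot>\<^bsub>M\<^esub> D) a y = torus_eval a r * der_symbol v u D a y"
  unfolding der_symbol_def sum_distrib_left
  by (intro sum.cong refl) (simp add: derivations_def torus_eval_mult algebra_simps)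

lemma der_symbol_scale: "der_symbol v u D a (t *s y) = t * der_symbol v u D a y"
  by (simp add: der_symbol_def cpair_scale sum_distrib_left algebra_simps)

lemma der_symbol_vsum: "der_symbol v u D a (\<Sum>x\<in>A. f x) = (\<Sum>x\<in>A. der_symbol v u D a (f x))"
  unfolding der_symbol_def cpair_sum sum_distrib_left by (rule sum.swap)

text \<open>Over an arbitrary index set, so that the sum can be rebuilt from the module operations
  by induction.\<close>

definition lincomb :: "'n set \<Rightarrow> ('n \<Rightarrow> 'n laurent) \<Rightarrow> 'n laurent \<Rightarrow> 'n laurent" where
  "lincomb A r = (\<lambda>f\<in>R. \<Sum>j\<in>A. r j * basis_derivation \<sigma> v u j f)"

lemma lincomb_empty: "lincomb {} r = \<zero>\<^bsub>M\<^esub>"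
  by (simp add: lincomb_def derivations_def)

lemma lincomb_insert:
  "finite A \<Longrightarrow> j \<notin> A \<Longrightarrow> lincomb (insert j A) r = (r j \<odot>\<^bsub>M\<^esub> basis_derivation \<sigma> v u j) \<oplus>\<^bsub>M\<^esub> lincomb A r"
  by (auto simp: lincomb_def derivations_def)

lemma lincomb_closed:
  assumes "finite A" "\<And>j. j \<in> A \<Longrightarrow> r j \<in> R"
  shows "lincomb A r \<in> carrier M"
  using assms
  by (induction A rule: finite_induct)
     (auto simp: lincomb_empty lincomb_insert derivations_zero_closed
       intro!: derivations_add_closed derivations_smult_closed basis_derivation_closed)

lemma derivation_lincomb:
  assumes D: "D \<in> carrier M"
  shows "D = lincomb UNIV (\<lambda>j. D (lmonom (u j)))"
proof (rule derivation_eqI[OF D lincomb_closed])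
  fix f assume f: "f \<in> R"
  show "D f = lincomb UNIV (\<lambda>j. D (lmonom (u j))) f"
  proof (rule torus_eval_eqI)
    fix a
    have "torus_eval a (D f) = (\<Sum>m\<in>Poly_Mapping.keys f. Poly_Mapping.lookup f m * (chi m a * der_symbol v u D a (cvec m)))"
      unfolding torus_eval_derivation[OF D f]
      using f by (intro sum.cong refl) (auto simp: derivation_lmonom[OF D] chart_ring_def)
    also have "\<dots> = (\<Sum>m\<in>Poly_Mapping.keys f. \<Sum>j\<in>UNIV. torus_eval a (D (lmonom (u j))) *
       (chi (- u j) a * (Poly_Mapping.lookup f m * (of_int (pair_int (v j) m) * chi m a))))"
      by (simp add: der_symbol_def cpair_cvec sum_distrib_left algebra_simps)
    also have "\<dots> = torus_eval a (lincomb UNIV (\<lambda>j. D (lmonom (u j))) f)"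
      using f by (subst sum.swap) (simp add: lincomb_def torus_eval_sum torus_eval_mult torus_eval_basis_derivation
          chart_eval_def sum_distrib_left)
    finally show "torus_eval a (D f) = torus_eval a (lincomb UNIV (\<lambda>j. D (lmonom (u j))) f)" .
  qed
qed (auto intro: derivation_closed[OF D])

lemma derivation_determined:
  assumes "D \<in> carrier M" "E \<in> carrier M" "\<And>j. D (lmonom (u j)) = E (lmonom (u j))"
  shows "D = E"
  using derivation_lincomb[OF assms(1)] derivation_lincomb[OF assms(2)] assms(3) by simp

lemma basis_derivation_lmonom:
  "basis_derivation \<sigma> v u j (lmonom (u i)) = (if i = j then 1 else 0)"
  by (rule torus_eval_eqI) (auto simp: torus_eval_basis_derivation chart_eval_pm_eval pm_eval_single pair_vu chi_uminus)

lemma basis_derivation_inj: "inj (basis_derivation \<sigma> v u)"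
proof (rule injI)
  fix i j assume "basis_derivation \<sigma> v u i = basis_derivation \<sigma> v u j"
  then show "i = j" using basis_derivation_lmonom[of i i] basis_derivation_lmonom[of j i] by (auto split: if_splits)
qed

end

text \<open>The symbol is linear in \<open>y\<close>, and its value at \<open>cvec m\<close> is the
  logarithmic derivative of the character m, which does not mention the frame.\<close>

lemma der_symbol_frame_independent:
  assumes "framed_cone \<tau> v u K" "framed_cone \<tau> v' u' K'" "D \<in> carrier (derivations (chart_ring \<tau>))"
  shows "der_symbol v' u' D a y = der_symbol v u D a y"
proof -
  interpret A: framed_cone \<tau> v u K by fact
  interpret B: framed_cone \<tau> v' u' K' by fact
  have "der_symbol v' u' D a y = (\<Sum>j\<in>UNIV. cpair (v' j) y * der_symbol v u D a (cvec (u' j)))"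
    unfolding der_symbol_def[of v']
    by (intro sum.cong refl) (simp add: A.derivation_lmonom[OF assms(3) B.u_dual] chi_uminus)
  also have "\<dots> = der_symbol v u D a (\<Sum>j\<in>UNIV. cpair (v' j) y *s cvec (u' j))"
    by (simp add: A.der_symbol_vsum A.der_symbol_scale)
  finally show ?thesis by (simp flip: unimodular_expand_complex[OF B.unimodular])
qed

text \<open>The extension has the same coefficients \<open>D (lmonom (u j))\<close> in the common
  frame. It is unique because those monomials already lie in the smaller ring and determine a
  derivation.\<close>

lemma der_ext_symbol:
  assumes "framed_cone \<sigma> v u K" "framed_cone \<tau> v u K'" "\<tau> \<subseteq> \<sigma>"
    and D: "D \<in> carrier (derivations (chart_ring \<sigma>))"
  shows "der_ext \<sigma> \<tau> D \<in> carrier (derivations (chart_ring \<tau>))"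
    and "der_symbol v u (der_ext \<sigma> \<tau> D) = der_symbol v u D"
proof -
  interpret S: framed_cone \<sigma> v u K by fact
  interpret T: framed_cone \<tau> v u K' by fact
  have sub: "chart_ring \<sigma> \<subseteq> chart_ring \<tau>" using assms(3) by (auto simp: chart_ring_def dual_monoid_def)
  define E where "E = T.lincomb UNIV (\<lambda>j. D (lmonom (u j)))"
  have E: "E \<in> carrier (derivations (chart_ring \<tau>))"
    unfolding E_def using derivation_closed[OF D S.lmonom_u] sub by (intro T.lincomb_closed) auto
  have ED: "E f = D f" if f: "f \<in> chart_ring \<sigma>" for f
  proof -
    have "E f = S.lincomb UNIV (\<lambda>j. D (lmonom (u j))) f"
      using f sub by (auto simp: E_def T.lincomb_def S.lincomb_def basis_derivation_def)
    then show ?thesis using S.derivation_lincomb[OF D] by simp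
  qed
  have "der_ext \<sigma> \<tau> D = E"
    unfolding der_ext_def
  proof (rule the_equality)
    show "E \<in> carrier (derivations (chart_ring \<tau>)) \<and> (\<forall>f\<in>chart_ring \<sigma>. E f = D f)" using E ED by blast
    fix E' assume "E' \<in> carrier (derivations (chart_ring \<tau>)) \<and> (\<forall>f\<in>chart_ring \<sigma>. E' f = D f)"
    then show "E' = E" using ED by (intro T.derivation_determined E) auto
  qed
  moreover have "der_symbol v u E = der_symbol v u D"
    by (intro ext) (simp add: der_symbol_def ED)
  ultimately show "der_ext \<sigma> \<tau> D \<in> carrier (derivations (chart_ring \<tau>))"
    and "der_symbol v u (der_ext \<sigma> \<tau> D) = der_symbol v u D"
    using E by simp_all
qed

section \<open>Symmetric algebras of modules of derivations\<close>

lemma class_ring_simps [simp]: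
  "carrier (class_ring S) = S" "x \<otimes>\<^bsub>class_ring S\<^esub> y = x * y" "x \<oplus>\<^bsub>class_ring S\<^esub> y = x + y"
  "\<one>\<^bsub>class_ring S\<^esub> = 1" "\<zero>\<^bsub>class_ring S\<^esub> = 0"
  by (simp_all add: class_ring_def)

lemma cring_class_ring:
  assumes "0 \<in> S" "1 \<in> S" "\<And>x y. x \<in> S \<Longrightarrow> y \<in> S \<Longrightarrow> x + y \<in> S"
    "\<And>x y. x \<in> S \<Longrightarrow> y \<in> S \<Longrightarrow> x * y \<in> S" "\<And>x. x \<in> S \<Longrightarrow> - x \<in> S"
  shows "cring (class_ring S)"
proof (rule cringI)
  show "abelian_group (class_ring S)"
  proof (rule abelian_groupI)
    show "\<exists>y\<in>carrier (class_ring S). y \<oplus>\<^bsub>class_ring S\<^esub> x = \<zero>\<^bsub>class_ring S\<^esub>"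
      if "x \<in> carrier (class_ring S)" for x
      using that assms(5) by (intro bexI[of _ "- x"]) auto
  qed (use assms in \<open>auto simp: algebra_simps\<close>)
  show "comm_monoid (class_ring S)"
    by (rule comm_monoidI) (use assms in \<open>auto simp: algebra_simps\<close>)
qed (auto simp: algebra_simps)

definition sym_symbol :: "('n \<Rightarrow> int ^ 'n) \<Rightarrow> ('n \<Rightarrow> int ^ 'n) \<Rightarrow>
    ('n laurent, 'n laurent \<Rightarrow> 'n laurent) mpoly \<Rightarrow> 'n::finite symbol" where
  "sym_symbol v u p a y = pm_eval (torus_eval a) (\<lambda>\<mu>. \<Prod>D\<in>#\<mu>. der_symbol v u D a y) p"

lemma sym_symbol_zero [simp]: "sym_symbol v u 0 a y = 0"
  by (simp add: sym_symbol_def)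

lemma sym_symbol_add: "sym_symbol v u (p + q) a y = sym_symbol v u p a y + sym_symbol v u q a y"
  by (simp add: sym_symbol_def pm_eval_add torus_eval_add)

lemma sym_symbol_uminus: "sym_symbol v u (- p) a y = - sym_symbol v u p a y"
  using sym_symbol_add[of v u "- p" p a y] by (simp add: eq_neg_iff_add_eq_0)

lemma sym_symbol_diff: "sym_symbol v u (p - q) a y = sym_symbol v u p a y - sym_symbol v u q a y"
  using sym_symbol_add[of v u p "- q" a y] by (simp add: sym_symbol_uminus)

lemma sym_symbol_mult: "sym_symbol v u (p * q) a y = sym_symbol v u p a y * sym_symbol v u q a y"
  by (simp add: sym_symbol_def pm_eval_mult torus_eval_add torus_eval_mult)

lemma sym_symbol_single:
  "sym_symbol v u (Poly_Mapping.single \<mu> c) a y = torus_eval a c * (\<Prod>D\<in>#\<mu>. der_symbol v u D a y)"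
  by (simp add: sym_symbol_def pm_eval_single)

lemma sym_symbol_var: "sym_symbol v u (sym_var D) a y = der_symbol v u D a y"
  by (simp add: sym_var_def sym_symbol_single)

lemma sym_symbol_sum: "sym_symbol v u (sum f A) a y = (\<Sum>x\<in>A. sym_symbol v u (f x) a y)"
  by (induction A rule: infinite_finite_induct) (simp_all add: sym_symbol_add)

lemma sym_symbol_one: "sym_symbol v u 1 a y = 1"
  using sym_symbol_single[of v u 0 1 a y] by simp

text \<open>The choice of representative is harmless: the symbol vanishes on the ideal of
  relations.\<close>

definition class_symbol :: "('n \<Rightarrow> int ^ 'n) \<Rightarrow> ('n \<Rightarrow> int ^ 'n) \<Rightarrow> 'n::finite sym_elt \<Rightarrow> 'n symbol" where
  "class_symbol v u C = sym_symbol v u (SOME p. p \<in> C)"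

definition homogeneous :: "nat \<Rightarrow> 'n::finite symbol \<Rightarrow> bool" where
  "homogeneous k h \<longleftrightarrow> (\<forall>a y t. h a (t *s y) = t ^ k * h a y)"

context framed_cone
begin

abbreviation "SP \<equiv> sym_poly R M"
abbreviation "I \<equiv> sym_ideal R M"
abbreviation "psym \<equiv> sym_symbol v u"

lemma sym_poly_single: "c \<in> R \<Longrightarrow> set_mset \<mu> \<subseteq> carrier M \<Longrightarrow> Poly_Mapping.single \<mu> c \<in> SP"
  by (auto simp: sym_poly_def lookup_single when_def chart_ring_zero)

lemma sym_poly_zero: "0 \<in> SP"
  by (auto simp: sym_poly_def chart_ring_zero)

lemma sym_poly_one: "1 \<in> SP"
  using sym_poly_single[OF chart_ring_one, of "{#}"] by simp

lemma sym_poly_add: "p \<in> SP \<Longrightarrow> q \<in> SP \<Longrightarrow> p + q \<in> SP"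
  using Poly_Mapping.keys_add[of p q] unfolding sym_poly_def image_subset_iff
  by (simp add: lookup_add chart_ring_add) blast

lemma sym_poly_uminus: "p \<in> SP \<Longrightarrow> - p \<in> SP"
  by (auto simp: sym_poly_def intro!: chart_ring_uminus)

lemma sym_poly_diff: "p \<in> SP \<Longrightarrow> q \<in> SP \<Longrightarrow> p - q \<in> SP"
  using sym_poly_add[OF _ sym_poly_uminus, of p q] by simp

lemma sym_poly_sum: "(\<And>x. x \<in> A \<Longrightarrow> f x \<in> SP) \<Longrightarrow> sum f A \<in> SP"
  by (induction A rule: infinite_finite_induct) (auto intro: sym_poly_zero sym_poly_add)

lemma sym_poly_lookup: "p \<in> SP \<Longrightarrow> Poly_Mapping.lookup p \<mu> \<in> R"
  by (auto simp: sym_poly_def)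

lemma sym_poly_keys: "p \<in> SP \<Longrightarrow> \<mu> \<in> Poly_Mapping.keys p \<Longrightarrow> set_mset \<mu> \<subseteq> carrier M"
  by (auto simp: sym_poly_def)

lemma sym_poly_mult:
  assumes "p \<in> SP" "q \<in> SP"
  shows "p * q \<in> SP"
proof -
  have "p * q = (\<Sum>k\<in>Poly_Mapping.keys p. \<Sum>l\<in>Poly_Mapping.keys q.
     Poly_Mapping.single (k + l) (Poly_Mapping.lookup p k * Poly_Mapping.lookup q l))"
    by (subst (1) poly_mapping_sum_singles[of p], subst (1) poly_mapping_sum_singles[of q])
       (simp add: sum_product mult_single)
  also have "\<dots> \<in> SP"
    using assms sym_poly_keys by (intro sym_poly_sum sym_poly_single chart_ring_mult sym_poly_lookup) auto
  finally show ?thesis .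
qed

lemma sym_var_closed: "D \<in> carrier M \<Longrightarrow> sym_var D \<in> SP"
  by (simp add: sym_var_def sym_poly_single chart_ring_one)

lemma const_closed: "c \<in> R \<Longrightarrow> Poly_Mapping.single {#} c \<in> SP"
  by (simp add: sym_poly_single)

sublocale P: cring "class_ring SP"
  by (intro cring_class_ring sym_poly_zero sym_poly_one sym_poly_add sym_poly_mult sym_poly_uminus)

definition relations :: "('n laurent, 'n laurent \<Rightarrow> 'n laurent) mpoly set" where
  "relations = {sym_var (D \<oplus>\<^bsub>M\<^esub> E) - (sym_var D + sym_var E) | D E. D \<in> carrier M \<and> E \<in> carrier M} \<union>
      {sym_var (r \<odot>\<^bsub>M\<^esub> D) - Poly_Mapping.single {#} r * sym_var D | r D. r \<in> R \<and> D \<in> carrier M}"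

lemma sym_ideal_relations: "I = genideal (class_ring SP) relations"
  by (simp add: sym_ideal_def relations_def)

lemma relations_closed: "relations \<subseteq> carrier (class_ring SP)"
  unfolding relations_def class_ring_simps
  by (auto intro!: sym_poly_diff sym_poly_add sym_poly_mult sym_var_closed const_closed
      derivations_add_closed derivations_smult_closed)

sublocale I: ideal I "class_ring SP"
  unfolding sym_ideal_relations by (rule P.genideal_ideal[OF relations_closed])

lemma relations_I: "relations \<subseteq> I"
  unfolding sym_ideal_relations by (rule P.genideal_self[OF relations_closed])

lemma I_closed: "p \<in> I \<Longrightarrow> p \<in> SP"
  using I.a_subset by auto

lemma I_add: "p \<in> I \<Longrightarrow> q \<in> I \<Longrightarrow> p + q \<in> I"
  using I.a_closed by simp

lemma I_zero: "0 \<in> I"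
  using I.zero_closed by simp

lemma I_mult: "p \<in> SP \<Longrightarrow> q \<in> I \<Longrightarrow> p * q \<in> I"
  using I.I_l_closed by simp

lemma I_uminus: "p \<in> I \<Longrightarrow> - p \<in> I"
  using I_mult[of "- 1" p] sym_poly_uminus[OF sym_poly_one] by simp

lemma I_diff: "p \<in> I \<Longrightarrow> q \<in> I \<Longrightarrow> p - q \<in> I"
  using I_add[OF _ I_uminus, of p q] by simp

text \<open>The polynomials with vanishing symbol form an ideal, and it contains the defining
  relations because symbols are additive and linear over the chart ring.\<close>

lemma sym_I:
  assumes "p \<in> I" shows "psym p a y = 0"
proof -
  define J where "J = {p \<in> SP. psym p a y = 0}"
  have "ideal J (class_ring SP)"
  proof (rule idealI)
    show "subgroup J (add_monoid (class_ring SP))"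
    proof (rule P.add.subgroupI)
      fix p assume p: "p \<in> J"
      have e: "\<ominus>\<^bsub>class_ring SP\<^esub> p = - p"
        using p by (intro P.minus_equality) (auto simp: J_def sym_poly_uminus)
      show "\<ominus>\<^bsub>class_ring SP\<^esub> p \<in> J"
        unfolding e using p by (simp add: J_def sym_poly_uminus sym_symbol_uminus)
    qed (auto simp: J_def sym_poly_zero sym_poly_add sym_symbol_add intro!: exI[of _ 0])
  qed (auto simp: J_def sym_poly_mult sym_symbol_mult P.ring_axioms)
  moreover have "relations \<subseteq> J"
  proof
    fix p assume "p \<in> relations"
    moreover from this have "p \<in> SP" using relations_closed by auto
    ultimately show "p \<in> J"
      unfolding J_def relations_def
      by (auto simp: sym_symbol_diff sym_symbol_add sym_symbol_mult sym_symbol_var sym_symbol_single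
          der_symbol_add der_symbol_smult)
  qed
  ultimately have "I \<subseteq> J" unfolding sym_ideal_relations by (rule P.genideal_minimal)
  then show ?thesis using assms by (auto simp: J_def)
qed

section \<open>Normal forms and faithfulness of symbols\<close>

definition normal_forms :: "('n laurent, 'n laurent \<Rightarrow> 'n laurent) mpoly set" where
  "normal_forms = {q \<in> SP. \<forall>\<mu>\<in>Poly_Mapping.keys q. set_mset \<mu> \<subseteq> range (basis_derivation \<sigma> v u)}"

text \<open>Algebraic independence of the symbols of the basis derivations. At a fixed torus point
  they can be given arbitrary values \<open>exp (b $ j)\<close>; monomials in them then become
  distinct characters of \<open>b\<close>, which are independent.\<close>

lemma normal_form_zero:
  assumes q: "q \<in> normal_forms" and zero: "\<And>a y. psym q a y = 0"
  shows "q = 0"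
proof -
  let ?b = "basis_derivation \<sigma> v u"
  \<comment> \<open>The exponent vector of a monomial, taken as a lattice point so that the monomial
    evaluates to \<open>chi (e \<mu>)\<close>.\<close>
  define e :: "('n laurent \<Rightarrow> 'n laurent) multiset \<Rightarrow> int ^ 'n" where "e = (\<lambda>\<mu>. \<chi> j. int (count \<mu> (?b j)))"
  have e_inj: "\<mu> = \<nu>" if "set_mset \<mu> \<subseteq> range ?b" "set_mset \<nu> \<subseteq> range ?b" "e \<mu> = e \<nu>" for \<mu> \<nu>
  proof (rule multiset_eqI)
    fix D
    show "count \<mu> D = count \<nu> D"
    proof (cases "D \<in> range ?b")
      case True
      then show ?thesis using that(3) by (auto simp: e_def vec_eq_iff)
    next
      case False
      then have "D \<notin># \<mu>" "D \<notin># \<nu>" using that by auto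
      then show ?thesis by (simp add: not_in_iff)
    qed
  qed
  have e_add: "e (add_mset (?b j) \<mu>) = axis j 1 + e \<mu>" for j \<mu>
    using basis_derivation_inj by (auto simp: e_def vec_eq_iff axis_def inj_eq)
  have prod: "(\<Prod>D\<in>#\<mu>. der_symbol v u D a y) = chi (e \<mu>) b"
    if "\<And>j. chi (- u j) a * cpair (v j) y = exp (b $ j)" "set_mset \<mu> \<subseteq> range ?b" for \<mu> a y b
    using that(2)
  proof (induction \<mu>)
    case empty
    have "e {#} = 0" by (simp add: e_def vec_eq_iff)
    then show ?case by simp
  next
    case (add D \<mu>)
    then obtain j where "D = ?b j" by auto
    with add show ?case by (simp add: e_add chi_add der_symbol_basis that(1)) (simp add: chi_def cpair_axis)
  qed
  have "torus_eval a (Poly_Mapping.lookup q \<mu>) = 0" if \<mu>: "\<mu> \<in> Poly_Mapping.keys q" for a \<mu>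
  proof -
    have keys: "set_mset \<mu> \<subseteq> range ?b" if "\<mu> \<in> Poly_Mapping.keys q" for \<mu>
      using q that by (auto simp: normal_forms_def)
    have "\<forall>\<mu>\<in>Poly_Mapping.keys q. torus_eval a (Poly_Mapping.lookup q \<mu>) = 0"
    proof (rule characters_independent[where e = "\<lambda>\<mu>. chi (e \<mu>)" and f = "(+)"])
      fix \<mu> \<nu> assume "\<mu> \<in> Poly_Mapping.keys q" "\<nu> \<in> Poly_Mapping.keys q" "\<mu> \<noteq> \<nu>"
      then have "e \<mu> \<noteq> e \<nu>" using e_inj keys by blast
      then show "\<exists>b. chi (e \<mu>) b \<noteq> chi (e \<nu>) b" by (rule chi_distinct)
    next
      fix b :: "complex ^ 'n"
      \<comment> \<open>Solves \<open>chi (- u j) a * cpair (v j) y = exp (b $ j)\<close> for all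
        \<open>j\<close>, by expanding in the basis dual to \<open>v\<close>.\<close>
      define y where "y = (\<Sum>i\<in>UNIV. (exp (b $ i) * chi (u i) a) *s cvec (u i))"
      have cp: "cpair (v j) y = exp (b $ j) * chi (u j) a" for j
      proof -
        have "cpair (v j) y = (\<Sum>i\<in>UNIV. if j = i then exp (b $ i) * chi (u i) a else 0)"
          unfolding y_def cpair_sum by (intro sum.cong refl) (simp add: cpair_scale cpair_cvec pair_vu)
        then show ?thesis by simp
      qed
      have "psym q a y = (\<Sum>\<mu>\<in>Poly_Mapping.keys q. torus_eval a (Poly_Mapping.lookup q \<mu>) * chi (e \<mu>) b)"
        unfolding sym_symbol_def pm_eval_def
        by (intro sum.cong refl arg_cong2[of _ _ _ _ "(*)"] prod keys) (simp_all add: cp chi_uminus)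
      then show "(\<Sum>\<mu>\<in>Poly_Mapping.keys q. torus_eval a (Poly_Mapping.lookup q \<mu>) * chi (e \<mu>) b) = 0"
        using zero by simp
    qed (simp_all add: chi_add_right)
    then show ?thesis using \<mu> by blast
  qed
  then have "Poly_Mapping.lookup q \<mu> = 0" for \<mu>
    using torus_eval_eqI[of "Poly_Mapping.lookup q \<mu>" 0]
    by (cases "\<mu> \<in> Poly_Mapping.keys q") (auto simp: in_keys_iff)
  then show ?thesis by (intro poly_mapping_eqI) simp
qed

lemma normal_forms_add: "p \<in> normal_forms \<Longrightarrow> q \<in> normal_forms \<Longrightarrow> p + q \<in> normal_forms"
  using Poly_Mapping.keys_add[of p q] sym_poly_add[of p q] unfolding normal_forms_def by blast

lemma normal_forms_mult:
  assumes "p \<in> normal_forms" "q \<in> normal_forms" shows "p * q \<in> normal_forms"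
proof -
  have "set_mset \<mu> \<subseteq> range (basis_derivation \<sigma> v u)" if \<mu>: "\<mu> \<in> Poly_Mapping.keys (p * q)" for \<mu>
  proof -
    obtain k l where "\<mu> = k + l" "k \<in> Poly_Mapping.keys p" "l \<in> Poly_Mapping.keys q"
      using \<mu> keys_mult[of p q] by blast
    then show ?thesis using assms unfolding normal_forms_def by simp
  qed
  then show ?thesis using sym_poly_mult assms unfolding normal_forms_def by blast
qed

definition reducible :: "('n laurent, 'n laurent \<Rightarrow> 'n laurent) mpoly \<Rightarrow> bool" where
  "reducible p \<longleftrightarrow> p \<in> SP \<and> (\<exists>q\<in>normal_forms. p - q \<in> I)"

lemma reducible_normal: "p \<in> normal_forms \<Longrightarrow> reducible p"
  using I_zero by (auto simp: reducible_def normal_forms_def intro!: bexI[of _ p])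

lemma reducible_add:
  assumes "reducible p" "reducible p'" shows "reducible (p + p')"
proof -
  obtain q q' where q: "q \<in> normal_forms" "p - q \<in> I" "q' \<in> normal_forms" "p' - q' \<in> I" "p \<in> SP" "p' \<in> SP"
    using assms by (auto simp: reducible_def)
  have "(p + p') - (q + q') = (p - q) + (p' - q')" by simp
  then show ?thesis using q I_add normal_forms_add sym_poly_add unfolding reducible_def by metis
qed

lemma reducible_mult:
  assumes "reducible p" "reducible p'" shows "reducible (p * p')"
proof -
  obtain q q' where q: "q \<in> normal_forms" "p - q \<in> I" "q' \<in> normal_forms" "p' - q' \<in> I" "p \<in> SP" "p' \<in> SP"
    using assms by (auto simp: reducible_def)
  have "p * p' - q * q' = p * (p' - q') + q' * (p - q)" by (simp add: algebra_simps)
  moreover have "\<dots> \<in> I" using q by (intro I_add I_mult) (auto simp: normal_forms_def)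
  ultimately show ?thesis using q normal_forms_mult sym_poly_mult unfolding reducible_def by metis
qed

lemma reducible_cong:
  assumes "reducible p" "p' - p \<in> I" "p' \<in> SP" shows "reducible p'"
proof -
  obtain q where q: "q \<in> normal_forms" "p - q \<in> I" using assms(1) by (auto simp: reducible_def)
  have "p' - q = (p' - p) + (p - q)" by simp
  then show ?thesis using q assms I_add unfolding reducible_def by metis
qed

lemma reducible_const: "c \<in> R \<Longrightarrow> reducible (Poly_Mapping.single {#} c)"
  by (intro reducible_normal) (auto simp: normal_forms_def const_closed)

lemma reducible_var_basis: "reducible (sym_var (basis_derivation \<sigma> v u j))"
  by (intro reducible_normal)
    (use sym_var_closed[OF basis_derivation_closed] in \<open>auto simp: normal_forms_def sym_var_def\<close>)

lemma reducible_lincomb: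
  assumes "finite A" "\<And>j. j \<in> A \<Longrightarrow> r j \<in> R"
  shows "reducible (sym_var (lincomb A r))"
  using assms
proof (induction A rule: finite_induct)
  case empty
  let ?z = "\<zero>\<^bsub>M\<^esub>"
  \<comment> \<open>The additivity relation for 0 + 0 says that the variable of the zero derivation
    lies in the ideal.\<close>
  have "?z \<oplus>\<^bsub>M\<^esub> ?z = ?z" by (auto simp: derivations_def)
  moreover have "sym_var (?z \<oplus>\<^bsub>M\<^esub> ?z) - (sym_var ?z + sym_var ?z) \<in> relations"
    using derivations_zero_closed unfolding relations_def by blast
  ultimately have "- sym_var ?z \<in> I" using relations_I by auto
  then have "sym_var ?z - 0 \<in> I" using I_uminus[of "- sym_var ?z"] by simp
  moreover have "(0 :: ('n laurent, 'n laurent \<Rightarrow> 'n laurent) mpoly) \<in> normal_forms"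
    by (simp add: normal_forms_def sym_poly_zero)
  ultimately show ?case
    unfolding lincomb_empty reducible_def using sym_var_closed[OF derivations_zero_closed] by blast
next
  case (insert j A)
  let ?b = "basis_derivation \<sigma> v u j"
  let ?D = "r j \<odot>\<^bsub>M\<^esub> ?b"
  have b: "?b \<in> carrier M" by (rule basis_derivation_closed)
  have r: "r j \<in> R" using insert.prems by simp
  have D: "?D \<in> carrier M" by (rule derivations_smult_closed[OF b r])
  have L: "lincomb A r \<in> carrier M" using insert by (intro lincomb_closed) auto
  have "sym_var ?D - Poly_Mapping.single {#} (r j) * sym_var ?b \<in> relations"
    using b r unfolding relations_def by blast
  then have "reducible (sym_var ?D)"
    using relations_I
    by (intro reducible_cong[OF reducible_mult[OF reducible_const[OF r] reducible_var_basis]] sym_var_closed D) auto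
  moreover have "reducible (sym_var (lincomb A r))" using insert by simp
  ultimately have "reducible (sym_var ?D + sym_var (lincomb A r))" by (rule reducible_add)
  moreover have "sym_var (?D \<oplus>\<^bsub>M\<^esub> lincomb A r) - (sym_var ?D + sym_var (lincomb A r)) \<in> I"
    using D L relations_I unfolding relations_def by blast
  ultimately show ?case
    unfolding lincomb_insert[OF insert.hyps]
    by (rule reducible_cong) (intro sym_var_closed derivations_add_closed D L)
qed

lemma reducible_all:
  assumes "p \<in> SP" shows "reducible p"
proof -
  have var: "reducible (sym_var D)" if "D \<in> carrier M" for D
    by (subst derivation_lincomb[OF that]) (intro reducible_lincomb derivation_closed[OF that]; simp)
  have single: "reducible (Poly_Mapping.single \<mu> c)" if "set_mset \<mu> \<subseteq> carrier M" "c \<in> R" for \<mu> c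
    using that(1)
  proof (induction \<mu>)
    case empty
    then show ?case using reducible_const that(2) by simp
  next
    case (add D \<mu>)
    have "Poly_Mapping.single (add_mset D \<mu>) c = sym_var D * Poly_Mapping.single \<mu> c"
      by (simp add: sym_var_def mult_single)
    with add show ?case by (auto intro!: reducible_mult var)
  qed
  have "reducible (\<Sum>\<mu>\<in>A. Poly_Mapping.single \<mu> (Poly_Mapping.lookup p \<mu>))" if "A \<subseteq> Poly_Mapping.keys p" for A
    using finite_subset[OF that finite_keys] that
  proof (induction A rule: finite_induct)
    case empty
    then show ?case using reducible_const[OF chart_ring_zero] by simp
  next
    case (insert \<mu> A)
    then show ?case using sym_poly_keys[OF assms] sym_poly_lookup[OF assms]
      by (auto intro!: reducible_add single)
  qed
  from this[OF subset_refl] show ?thesis by (subst poly_mapping_sum_singles[of p])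
qed

text \<open>Faithfulness, which allows residue classes to be compared by their symbols: modulo the
  ideal everything is a polynomial in basis derivations, and such a polynomial with vanishing symbol
  is zero.\<close>

lemma sym_zero_iff:
  assumes "p \<in> SP" shows "(\<forall>a y. psym p a y = 0) \<longleftrightarrow> p \<in> I"
proof
  assume zero: "\<forall>a y. psym p a y = 0"
  obtain q where q: "q \<in> normal_forms" "p - q \<in> I" using reducible_all[OF assms] by (auto simp: reducible_def)
  have "psym q a y = 0" for a y
    using sym_I[OF q(2), of a y] zero by (simp add: sym_symbol_diff)
  then have "q = 0" by (rule normal_form_zero[OF q(1)])
  then show "p \<in> I" using q(2) by simp
qed (auto simp: sym_I)

section \<open>The symmetric algebra as a ring of functions\<close>

lemma sym_class_eq_image: "sym_class R M p = (\<lambda>h. h + p) ` I"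
  by (auto simp: sym_class_def a_r_coset_def')

lemma sym_class_mem: "p \<in> sym_class R M p"
  unfolding sym_class_eq_image using I_zero by (intro image_eqI[of _ _ 0]) auto

lemma sym_class_rep: "q \<in> sym_class R M p \<Longrightarrow> p \<in> SP \<Longrightarrow> q \<in> SP \<and> q - p \<in> I"
  by (auto simp: sym_class_eq_image I_closed sym_poly_add)

lemma sym_class_eq:
  assumes "p - q \<in> I" shows "sym_class R M p = sym_class R M q"
proof (intro equalityI subsetI)
  fix x assume "x \<in> sym_class R M p"
  then obtain h where "h \<in> I" "x = h + p" by (auto simp: sym_class_eq_image)
  then show "x \<in> sym_class R M q"
    using I_add[OF _ assms, of h] unfolding sym_class_eq_image by (intro image_eqI[of _ _ "h + (p - q)"]) auto
next
  fix x assume "x \<in> sym_class R M q"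
  then obtain h where "h \<in> I" "x = h + q" by (auto simp: sym_class_eq_image)
  then show "x \<in> sym_class R M p"
    using I_diff[OF _ assms, of h] unfolding sym_class_eq_image by (intro image_eqI[of _ _ "h - (p - q)"]) auto
qed

lemma sym_alg_carrier: "carrier (tan_sym \<sigma>) = sym_class R M ` SP"
  by (auto simp: sym_alg_def FactRing_def A_RCOSETS_def' sym_class_def)

lemma sym_class_symbol:
  assumes "p \<in> SP" "q \<in> sym_class R M p" shows "psym q = psym p"
proof (intro ext)
  fix a y
  show "psym q a y = psym p a y"
    using sym_I[of "q - p" a y] sym_class_rep[OF assms(2,1)] by (simp add: sym_symbol_diff)
qed

lemma class_symbol_class: "p \<in> SP \<Longrightarrow> class_symbol v u (sym_class R M p) = psym p"
  unfolding class_symbol_def using sym_class_mem sym_class_symbol by (metis someI_ex)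

lemma class_symbol_inj:
  assumes "X \<in> carrier (tan_sym \<sigma>)" "Y \<in> carrier (tan_sym \<sigma>)" "class_symbol v u X = class_symbol v u Y"
  shows "X = Y"
proof -
  obtain p q where pq: "p \<in> SP" "q \<in> SP" "X = sym_class R M p" "Y = sym_class R M q"
    using assms(1,2) by (auto simp: sym_alg_carrier)
  then have "psym p = psym q" using assms(3) by (simp add: class_symbol_class)
  then have "p - q \<in> I"
    using pq by (intro sym_zero_iff[THEN iffD1] sym_poly_diff) (auto simp: sym_symbol_diff)
  then show ?thesis using sym_class_eq pq by simp
qed

lemma class_hom: "sym_class R M \<in> ring_hom (class_ring SP) (tan_sym \<sigma>)"
  unfolding sym_alg_def sym_class_def using I.rcos_ring_hom .

lemma class_mult: "p \<in> SP \<Longrightarrow> q \<in> SP \<Longrightarrow>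
    sym_class R M p \<otimes>\<^bsub>tan_sym \<sigma>\<^esub> sym_class R M q = sym_class R M (p * q)"
  using ring_hom_mult[OF class_hom, of p q] by simp

lemma class_add: "p \<in> SP \<Longrightarrow> q \<in> SP \<Longrightarrow>
    sym_class R M p \<oplus>\<^bsub>tan_sym \<sigma>\<^esub> sym_class R M q = sym_class R M (p + q)"
  using ring_hom_add[OF class_hom, of p q] by simp

lemma class_one: "\<one>\<^bsub>tan_sym \<sigma>\<^esub> = sym_class R M 1"
  using ring_hom_one[OF class_hom] by simp

sublocale SA: cring "tan_sym \<sigma>"
  unfolding sym_alg_def by (rule I.quotient_is_cring[OF P.is_cring])

lemma class_zero: "\<zero>\<^bsub>tan_sym \<sigma>\<^esub> = sym_class R M 0"
  using ring_hom_zero[OF class_hom P.ring_axioms SA.ring_axioms] by simp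

lemma class_symbol_mult:
  assumes "X \<in> carrier (tan_sym \<sigma>)" "Y \<in> carrier (tan_sym \<sigma>)"
  shows "class_symbol v u (X \<otimes>\<^bsub>tan_sym \<sigma>\<^esub> Y) a y = class_symbol v u X a y * class_symbol v u Y a y"
  using assms by (auto simp: sym_alg_carrier class_mult class_symbol_class sym_poly_mult sym_symbol_mult)

lemma class_symbol_add:
  assumes "X \<in> carrier (tan_sym \<sigma>)" "Y \<in> carrier (tan_sym \<sigma>)"
  shows "class_symbol v u (X \<oplus>\<^bsub>tan_sym \<sigma>\<^esub> Y) a y = class_symbol v u X a y + class_symbol v u Y a y"
  using assms by (auto simp: sym_alg_carrier class_add class_symbol_class sym_poly_add sym_symbol_add)

lemma class_symbol_zero: "class_symbol v u \<zero>\<^bsub>tan_sym \<sigma>\<^esub> a y = 0"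
  by (simp add: class_zero class_symbol_class sym_poly_zero)

lemma class_symbol_one: "class_symbol v u \<one>\<^bsub>tan_sym \<sigma>\<^esub> a y = 1"
  by (simp add: class_one class_symbol_class sym_poly_one sym_symbol_one)

lemma class_symbol_const:
  "class_symbol v u (sym_class R M (Poly_Mapping.single {#} (lconst c))) a y = c"
  by (simp add: class_symbol_class const_closed chart_ring_lconst sym_symbol_single torus_eval_lconst)

lemma class_symbol_finsum:
  assumes "finite A" "\<And>i. i \<in> A \<Longrightarrow> f i \<in> carrier (tan_sym \<sigma>)"
  shows "class_symbol v u (\<Oplus>\<^bsub>tan_sym \<sigma>\<^esub>i\<in>A. f i) a y = (\<Sum>i\<in>A. class_symbol v u (f i) a y)"
  using assms
proof (induction A rule: finite_induct)
  case empty
  then show ?case by (simp add: class_symbol_zero)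
next
  case (insert i A)
  then show ?case by (subst SA.finsum_insert) (auto simp: class_symbol_add intro!: SA.finsum_closed)
qed

text \<open>It is enough to check generators: characters in the dual monoid have no poles on the
  chart, and the symbol of a basis derivation carries exactly the linear form that its pole
  demands.\<close>

lemma psym_in_symbol_algebra:
  assumes "p \<in> SP" shows "psym p \<in> symbol_algebra K v"
proof -
  have chi_in: "(\<lambda>a y. chi m a) \<in> symbol_algebra K v" if "m \<in> dual_monoid \<sigma>" for m
  proof -
    have "pole_factor K v m y = 1" for y
      using that by (simp add: pole_factor_def dual)
    then show ?thesis using symbol_algebra_gen[OF ypoly.const[of 1], of m K v] by simp
  qed
  have eval_in: "(\<lambda>a y. torus_eval a f) \<in> symbol_algebra K v" if "f \<in> R" for f
    unfolding torus_eval_def chart_eval_def using that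
    by (intro symbol_algebra_sum symbol_algebra_mult symbol_algebra_const chi_in) (auto simp: chart_ring_def)
  have basis_in: "(\<lambda>a y. chi (- u j) a * cpair (v j) y) \<in> symbol_algebra K v" for j
  proof -
    \<comment> \<open>Among the coordinates of \<open>- u j\<close> only the \<open>j\<close>-th is
      negative, namely -1. The pole factor is therefore the linear form itself for \<open>j\<close>
      in \<open>K\<close>, and 1 otherwise.\<close>
    have "\<exists>q\<in>ypoly. \<forall>y. cpair (v j) y = pole_factor K v (- u j) y * q y"
    proof (cases "j \<in> K")
      case True
      have "pole_factor K v (- u j) y = (\<Prod>i\<in>K. if i = j then cpair (v j) y else 1)" for y
        unfolding pole_factor_def by (intro prod.cong refl) (auto simp: pair_int_uminus pair_vu)
      then have "pole_factor K v (- u j) y = cpair (v j) y" for y using True by simp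
      then show ?thesis by (intro bexI[of _ "\<lambda>_. 1"]) (auto intro: ypoly.const)
    next
      case False
      have "pole_factor K v (- u j) y = 1" for y
        unfolding pole_factor_def using False by (intro prod.neutral) (auto simp: pair_int_uminus pair_vu)
      then show ?thesis by (intro bexI[of _ "cpair (v j)"]) (auto intro: ypoly_cpair)
    qed
    then obtain q where "q \<in> ypoly" "\<And>y. cpair (v j) y = pole_factor K v (- u j) y * q y" by blast
    then show ?thesis using symbol_algebra_gen[of q "- u j" K v] by (simp add: mult.assoc)
  qed
  have der_in: "der_symbol v u D \<in> symbol_algebra K v" if D: "D \<in> carrier M" for D
  proof -
    have "(\<lambda>a y. \<Sum>j\<in>UNIV. torus_eval a (D (lmonom (u j))) * (chi (- u j) a * cpair (v j) y)) \<in> symbol_algebra K v"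
      by (intro symbol_algebra_sum symbol_algebra_mult eval_in basis_in derivation_closed[OF D] lmonom_u)
    then show ?thesis by (simp add: der_symbol_def[abs_def] mult.assoc)
  qed
  have prod_in: "(\<lambda>a y. \<Prod>D\<in>#\<mu>. der_symbol v u D a y) \<in> symbol_algebra K v" if "set_mset \<mu> \<subseteq> carrier M" for \<mu>
    using that by (induction \<mu>) (auto intro: symbol_algebra_const symbol_algebra_mult der_in)
  have "(\<lambda>a y. \<Sum>\<mu>\<in>Poly_Mapping.keys p. torus_eval a (Poly_Mapping.lookup p \<mu>) * (\<Prod>D\<in>#\<mu>. der_symbol v u D a y))
    \<in> symbol_algebra K v"
    using sym_poly_keys[OF assms]
    by (intro symbol_algebra_sum symbol_algebra_mult eval_in prod_in sym_poly_lookup[OF assms])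
  then show ?thesis by (simp add: sym_symbol_def[abs_def] pm_eval_def)
qed

section \<open>Realizing functions as symbols\<close>

definition realized :: "'n symbol \<Rightarrow> bool" where
  "realized h \<longleftrightarrow> (\<exists>p\<in>SP. h = psym p)"

lemma realized_add: "realized g \<Longrightarrow> realized h \<Longrightarrow> realized (\<lambda>a y. g a y + h a y)"
  unfolding realized_def
proof (elim bexE)
  fix p q assume "p \<in> SP" "q \<in> SP" "g = psym p" "h = psym q"
  then show "\<exists>r\<in>SP. (\<lambda>a y. g a y + h a y) = psym r"
    by (intro bexI[of _ "p + q"]) (auto simp: fun_eq_iff sym_symbol_add sym_poly_add)
qed

lemma realized_mult: "realized g \<Longrightarrow> realized h \<Longrightarrow> realized (\<lambda>a y. g a y * h a y)"
  unfolding realized_def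
proof (elim bexE)
  fix p q assume "p \<in> SP" "q \<in> SP" "g = psym p" "h = psym q"
  then show "\<exists>r\<in>SP. (\<lambda>a y. g a y * h a y) = psym r"
    by (intro bexI[of _ "p * q"]) (auto simp: fun_eq_iff sym_symbol_mult sym_poly_mult)
qed

lemma realized_const: "realized (\<lambda>a y. c)"
  unfolding realized_def
  by (intro bexI[of _ "Poly_Mapping.single {#} (lconst c)"])
     (auto simp: fun_eq_iff sym_symbol_single torus_eval_lconst const_closed chart_ring_lconst)

lemma realized_sum: "(\<And>x. x \<in> A \<Longrightarrow> realized (f x)) \<Longrightarrow> realized (\<lambda>a y. \<Sum>x\<in>A. f x a y)"
  by (induction A rule: infinite_finite_induct) (simp_all add: realized_const realized_add)

lemma realized_prod: "(\<And>x. x \<in> A \<Longrightarrow> realized (f x)) \<Longrightarrow> realized (\<lambda>a y. \<Prod>x\<in>A. f x a y)"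
  by (induction A rule: infinite_finite_induct) (simp_all add: realized_const realized_mult)

lemma realized_power: "realized f \<Longrightarrow> realized (\<lambda>a y. f a y ^ k)"
  by (induction k) (simp_all add: realized_const realized_mult)

lemma realized_chi:
  assumes "m \<in> dual_monoid \<sigma>" shows "realized (\<lambda>a y. chi m a)"
  unfolding realized_def
  by (intro bexI[of _ "Poly_Mapping.single {#} (lmonom m)"])
     (use assms in \<open>auto simp: fun_eq_iff sym_symbol_single torus_eval_single const_closed chart_ring_single\<close>)

lemma realized_basis: "realized (\<lambda>a y. chi (- u j) a * cpair (v j) y)"
  unfolding realized_def
  by (intro bexI[of _ "sym_var (basis_derivation \<sigma> v u j)"])
     (auto simp: fun_eq_iff sym_symbol_var der_symbol_basis sym_var_closed basis_derivation_closed)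

lemma realized_ypoly:
  assumes "q \<in> ypoly" shows "realized (\<lambda>a y. q y)"
  using assms
proof induction
  case (coord i)
  have cp: "realized (\<lambda>a y. cpair (v j) y)" for j
  proof -
    have "realized (\<lambda>a y. chi (u j) a * (chi (- u j) a * cpair (v j) y))"
      by (intro realized_mult[OF realized_chi[OF u_dual] realized_basis])
    moreover have "chi (u j) a * (chi (- u j) a * cpair (v j) y) = cpair (v j) y" for a y
      by (simp add: chi_uminus)
    ultimately show ?thesis by simp
  qed
  have "y $ i = (\<Sum>j\<in>UNIV. of_int (u j $ i) * cpair (v j) y)" for y
    by (subst (1) unimodular_expand_complex[OF unimodular, of y]) (simp add: cvec_def mult.commute)
  then have "(\<lambda>(a :: complex ^ 'n) y. y $ i) = (\<lambda>a y. \<Sum>j\<in>UNIV. of_int (u j $ i) * cpair (v j) y)" by (intro ext)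
  moreover have "realized (\<lambda>a y. \<Sum>j\<in>UNIV. of_int (u j $ i) * cpair (v j) y)"
    by (intro realized_sum realized_mult realized_const cp)
  ultimately show ?case by simp
qed (auto intro: realized_const realized_add realized_mult)

lemma symbol_algebra_realized:
  assumes "h \<in> symbol_algebra K v" shows "realized h"
  using assms
proof induction
  case zero
  then show ?case by (rule realized_const)
next
  case (step h q m)
  define k where "k = (\<lambda>i. nat (- pair_int (v i) m))"
  \<comment> \<open>Raises the negative coordinates of \<open>m\<close> on \<open>K\<close> to 0, so
    that its character is regular on the chart. The correction is undone by the
    \<open>k i\<close>-th powers of the basis symbols, which bring in precisely the pole
    factor.\<close>
  define m' where "m' = m + (\<Sum>i\<in>K. int (k i) *s u i)"
  have "0 \<le> pair_int (v j) m'" if "j \<in> K" for j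
  proof -
    have "pair_int (v j) (\<Sum>i\<in>K. int (k i) *s u i) = (\<Sum>i\<in>K. if j = i then int (k i) else 0)"
      unfolding pair_int_sum by (intro sum.cong refl) (simp add: pair_int_scale pair_vu)
    then show ?thesis using that by (simp add: m'_def pair_int_add k_def)
  qed
  then have m': "m' \<in> dual_monoid \<sigma>" by (simp add: dual)
  have "realized (\<lambda>a y. chi m' a * (\<Prod>i\<in>K. (chi (- u i) a * cpair (v i) y) ^ k i) * q y)"
    by (intro realized_mult realized_chi m' realized_prod realized_power realized_basis realized_ypoly step)
  moreover have "chi m' a * (\<Prod>i\<in>K. (chi (- u i) a * cpair (v i) y) ^ k i) * q y =
      chi m a * pole_factor K v m y * q y" for a y
  proof -
    have "chi m' a = chi m a * (\<Prod>i\<in>K. chi (u i) a ^ k i)"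
      by (simp add: m'_def chi_add chi_sum chi_scale_nat)
    moreover have c: "chi (- u i) a * cpair (v i) y * chi (u i) a = cpair (v i) y" for i
      by (simp add: chi_uminus)
    have "(\<Prod>i\<in>K. (chi (- u i) a * cpair (v i) y) ^ k i) * (\<Prod>i\<in>K. chi (u i) a ^ k i) = pole_factor K v m y"
      unfolding pole_factor_def prod.distrib[symmetric] k_def power_mult_distrib[symmetric] c ..
    ultimately show ?thesis by (simp add: mult_ac)
  qed
  ultimately show ?case using realized_add[OF step.IH, of "\<lambda>a y. chi m a * pole_factor K v m y * q y"] by simp
qed

lemma class_symbol_image: "class_symbol v u ` carrier (tan_sym \<sigma>) = symbol_algebra K v"
proof (intro equalityI subsetI)
  fix h assume "h \<in> class_symbol v u ` carrier (tan_sym \<sigma>)"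
  then show "h \<in> symbol_algebra K v"
    by (auto simp: sym_alg_carrier class_symbol_class psym_in_symbol_algebra)
next
  fix h assume "h \<in> symbol_algebra K v"
  then obtain p where "p \<in> SP" "h = psym p" using symbol_algebra_realized by (auto simp: realized_def)
  then show "h \<in> class_symbol v u ` carrier (tan_sym \<sigma>)"
    by (auto simp: sym_alg_carrier class_symbol_class intro!: image_eqI[of _ _ "sym_class R M p"])
qed

lemma psym_homogeneous:
  assumes "\<forall>\<mu>\<in>Poly_Mapping.keys q. size \<mu> = k"
  shows "homogeneous k (psym q)"
proof -
  have "(\<Prod>D\<in>#\<mu>. der_symbol v u D a (t *s y)) = t ^ size \<mu> * (\<Prod>D\<in>#\<mu>. der_symbol v u D a y)" for \<mu> a t y
    by (induction \<mu>) (auto simp: der_symbol_scale)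
  then show ?thesis using assms
    by (auto simp: homogeneous_def sym_symbol_def pm_eval_def sum_distrib_left mult_ac intro!: sum.cong)
qed

text \<open>The degree of a class can be seen on its symbol. Conversely, split a representative by
  the size of monomials: if the symbol is homogeneous of degree \<open>k\<close>, comparing
  coefficients in \<open>t\<close> shows that the part of size \<open>k\<close> has the same symbol,
  and faithfulness does the rest.\<close>

lemma sym_power_iff:
  "X \<in> sym_power R M k \<longleftrightarrow> X \<in> carrier (tan_sym \<sigma>) \<and> homogeneous k (class_symbol v u X)"
proof (intro iffI conjI)
  assume "X \<in> sym_power R M k"
  then obtain q where q: "q \<in> SP" "\<forall>\<mu>\<in>Poly_Mapping.keys q. size \<mu> = k" "X = sym_class R M q"
    by (auto simp: sym_power_def)
  show "X \<in> carrier (tan_sym \<sigma>)" using q by (auto simp: sym_alg_carrier)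
  show "homogeneous k (class_symbol v u X)" using q psym_homogeneous by (simp add: class_symbol_class)
next
  assume X: "X \<in> carrier (tan_sym \<sigma>) \<and> homogeneous k (class_symbol v u X)"
  then obtain q where q: "q \<in> SP" "X = sym_class R M q" by (auto simp: sym_alg_carrier)
  then have hom: "homogeneous k (psym q)" using X by (simp add: class_symbol_class)
  define part where "part = (\<lambda>i. \<Sum>\<mu>\<in>{\<mu> \<in> Poly_Mapping.keys q. size \<mu> = i}. Poly_Mapping.single \<mu> (Poly_Mapping.lookup q \<mu>))"
  \<comment> \<open>The summand \<open>k\<close> ensures that the part of size \<open>k\<close> is
    among the parts up to \<open>N\<close>, even if it is zero.\<close>
  define N where "N = k + (\<Sum>\<mu>\<in>Poly_Mapping.keys q. size \<mu>)"
  have part_SP: "part i \<in> SP" for i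
    unfolding part_def using sym_poly_keys[OF q(1)]
    by (intro sym_poly_sum sym_poly_single sym_poly_lookup q(1)) auto
  have part_keys: "\<forall>\<mu>\<in>Poly_Mapping.keys (part i). size \<mu> = i" for i
  proof
    fix \<mu> assume "\<mu> \<in> Poly_Mapping.keys (part i)"
    then have "Poly_Mapping.lookup (part i) \<mu> \<noteq> 0" by (simp add: in_keys_iff)
    moreover have "Poly_Mapping.lookup (part i) \<mu> = 0" if "size \<mu> \<noteq> i"
      unfolding part_def lookup_sum lookup_single when_def using that by (intro sum.neutral) auto
    ultimately show "size \<mu> = i" by blast
  qed
  have size_N: "size \<mu> \<le> N" if "\<mu> \<in> Poly_Mapping.keys q" for \<mu>
    using member_le_sum[OF that, of size] by (simp add: N_def)
  have "q = (\<Sum>i\<le>N. part i)"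
  proof -
    have "(\<Sum>i\<le>N. part i) = (\<Sum>\<mu>\<in>Poly_Mapping.keys q. Poly_Mapping.single \<mu> (Poly_Mapping.lookup q \<mu>))"
      unfolding part_def by (rule sum.group) (use size_N in auto)
    then show ?thesis by (simp flip: poly_mapping_sum_singles)
  qed
  then have total: "psym q a y = (\<Sum>i\<le>N. psym (part i) a y)" for a y
    by (subst (1) \<open>q = _\<close>) (simp add: sym_symbol_sum)
  have "psym (part k) a y = psym q a y" for a y
  proof -
    \<comment> \<open>The symbol along \<open>t *s y\<close> as a polynomial in
      \<open>t\<close>.\<close>
    define P where "P = (\<Sum>i\<le>N. Polynomial.monom (psym (part i) a y) i)"
    have "P = Polynomial.monom (psym q a y) k"
    proof (rule poly_eq_from_values)
      fix t
      have "poly P t = (\<Sum>i\<le>N. psym (part i) a (t *s y))"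
        using psym_homogeneous[OF part_keys]
        by (auto simp: P_def poly_sum poly_monom homogeneous_def mult.commute intro!: sum.cong)
      also have "\<dots> = poly (Polynomial.monom (psym q a y) k) t"
        using hom by (simp add: homogeneous_def poly_monom mult.commute flip: total)
      finally show "poly P t = poly (Polynomial.monom (psym q a y) k) t" .
    qed
    then have "Polynomial.coeff P k = psym q a y" by simp
    moreover have "Polynomial.coeff P k = psym (part k) a y"
      by (simp add: P_def coeff_sum N_def)
    ultimately show ?thesis by simp
  qed
  then have "psym (part k) = psym q" by blast
  then have "X = sym_class R M (part k)"
    unfolding q(2) using q(1) part_SP
    by (intro class_symbol_inj) (auto simp: sym_alg_carrier class_symbol_class)
  then show "X \<in> sym_power R M k" using part_SP part_keys by (auto simp: sym_power_def)
qed

end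

text \<open>The union over representatives in \<open>sym_res\<close> is a single class, since
  extending any representative of \<open>X\<close> gives the same symbol and symbols are faithful on
  the smaller chart.\<close>

lemma sym_res_symbol:
  fixes \<sigma> \<tau> :: "(real ^ 'n::finite) set"
  assumes S: "framed_cone \<sigma> v u K" and T: "framed_cone \<tau> v u K'" and sub: "\<tau> \<subseteq> \<sigma>"
    and X: "X \<in> carrier (tan_sym \<sigma>)"
  shows "sym_res \<sigma> \<tau> X \<in> carrier (tan_sym \<tau>)"
    and "class_symbol v u (sym_res \<sigma> \<tau> X) = class_symbol v u X"
proof -
  interpret S: framed_cone \<sigma> v u K by fact
  interpret T: framed_cone \<tau> v u K' by fact
  have R: "chart_ring \<sigma> \<subseteq> chart_ring \<tau>" using sub by (auto simp: chart_ring_def dual_monoid_def)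
  define extend where "extend = (\<lambda>p :: ('n laurent, 'n laurent \<Rightarrow> 'n laurent) mpoly. \<Sum>\<mu>\<in>Poly_Mapping.keys p.
        Poly_Mapping.single (image_mset (der_ext \<sigma> \<tau>) \<mu>) (Poly_Mapping.lookup p \<mu>))"
  have extend_SP: "extend p \<in> T.SP" if p: "p \<in> S.SP" for p
    unfolding extend_def using S.sym_poly_keys[OF p] S.sym_poly_lookup[OF p] R der_ext_symbol(1)[OF S T sub]
    by (intro T.sym_poly_sum T.sym_poly_single) (auto, blast)
  have extend_sym: "T.psym (extend p) = S.psym p" if p: "p \<in> S.SP" for p
  proof (intro ext)
    fix a y
    have "(\<Prod>D\<in>#image_mset (der_ext \<sigma> \<tau>) \<mu>. der_symbol v u D a y) = (\<Prod>D\<in>#\<mu>. der_symbol v u D a y)"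
      if "\<mu> \<in> Poly_Mapping.keys p" for \<mu>
      using S.sym_poly_keys[OF p that] der_ext_symbol(2)[OF S T sub]
      by (auto simp: image_mset.compositionality comp_def intro!: arg_cong[of _ _ prod_mset] image_mset_cong)
    then show "T.psym (extend p) a y = S.psym p a y"
      by (simp add: extend_def sym_symbol_sum sym_symbol_single) (simp add: sym_symbol_def pm_eval_def)
  qed
  obtain p where p: "p \<in> S.SP" "X = sym_class S.R S.M p" using X by (auto simp: S.sym_alg_carrier)
  have "sym_class T.R T.M (extend q) = sym_class T.R T.M (extend p)" if "q \<in> X" for q
  proof -
    have q: "q \<in> S.SP" "S.psym q = S.psym p"
      using that p S.sym_class_rep S.sym_class_symbol by auto
    show ?thesis
      using q p(1) extend_SP extend_sym
      by (intro T.class_symbol_inj) (auto simp: T.sym_alg_carrier T.class_symbol_class)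
  qed
  moreover have "p \<in> X" using p S.sym_class_mem by simp
  ultimately have "sym_res \<sigma> \<tau> X = sym_class T.R T.M (extend p)"
    unfolding sym_res_def extend_def by blast
  then show "sym_res \<sigma> \<tau> X \<in> carrier (tan_sym \<tau>)"
    and "class_symbol v u (sym_res \<sigma> \<tau> X) = class_symbol v u X"
    using p extend_SP extend_sym by (auto simp: T.sym_alg_carrier T.class_symbol_class S.class_symbol_class)
qed

lemma class_symbol_frame_independent:
  assumes A: "framed_cone \<tau> v u K" and B: "framed_cone \<tau> v' u' K'" and X: "X \<in> carrier (tan_sym \<tau>)"
  shows "class_symbol v' u' X = class_symbol v u X"
proof -
  interpret A: framed_cone \<tau> v u K by fact
  interpret B: framed_cone \<tau> v' u' K' by fact
  obtain p where p: "p \<in> A.SP" "X = sym_class A.R A.M p" using X by (auto simp: A.sym_alg_carrier)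
  have "sym_symbol v' u' p a y = sym_symbol v u p a y" for a y
    unfolding sym_symbol_def pm_eval_def
    using A.sym_poly_keys[OF p(1)] der_symbol_frame_independent[OF A B]
    by (intro sum.cong refl arg_cong2[of _ _ _ _ "(*)"] arg_cong[of _ _ prod_mset] image_mset_cong) blast
  then show ?thesis using p by (simp add: A.class_symbol_class B.class_symbol_class fun_eq_iff)
qed

section \<open>The ring of sections\<close>

definition symbol_ring :: "'n::finite symbol set \<Rightarrow> 'n symbol calgebra" where
  "symbol_ring J = \<lparr>carrier = J, monoid.mult = (\<lambda>g h a y. g a y * h a y), one = (\<lambda>a y. 1),
     zero = (\<lambda>a y. 0), add = (\<lambda>g h a y. g a y + h a y), cconst = (\<lambda>c a y. c)\<rparr>"

lemma symbol_ring_simps [simp]: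
  "carrier (symbol_ring J) = J" "g \<otimes>\<^bsub>symbol_ring J\<^esub> h = (\<lambda>a y. g a y * h a y)"
  "\<one>\<^bsub>symbol_ring J\<^esub> = (\<lambda>a y. 1)" "\<zero>\<^bsub>symbol_ring J\<^esub> = (\<lambda>a y. 0)"
  "g \<oplus>\<^bsub>symbol_ring J\<^esub> h = (\<lambda>a y. g a y + h a y)" "cconst (symbol_ring J) c = (\<lambda>a y. c)"
  by (simp_all add: symbol_ring_def)

lemma cring_symbol_ring:
  assumes "\<And>c. (\<lambda>a y. c) \<in> J" "\<And>g h. g \<in> J \<Longrightarrow> h \<in> J \<Longrightarrow> (\<lambda>a y. g a y + h a y) \<in> J"
    "\<And>g h. g \<in> J \<Longrightarrow> h \<in> J \<Longrightarrow> (\<lambda>a y. g a y * h a y) \<in> J"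
  shows "cring (symbol_ring J)"
proof (rule cringI)
  show "abelian_group (symbol_ring J)"
  proof (rule abelian_groupI)
    show "\<exists>h\<in>carrier (symbol_ring J). h \<oplus>\<^bsub>symbol_ring J\<^esub> g = \<zero>\<^bsub>symbol_ring J\<^esub>"
      if "g \<in> carrier (symbol_ring J)" for g
      using that assms(3)[OF assms(1)[of "-1"], of g] by (intro bexI[of _ "\<lambda>a y. - 1 * g a y"]) auto
  qed (use assms in \<open>auto simp: algebra_simps\<close>)
  show "comm_monoid (symbol_ring J)"
    by (rule comm_monoidI) (use assms in \<open>auto simp: algebra_simps\<close>)
qed (auto simp: algebra_simps)

text \<open>Here \<open>R\<close> is not yet known to be a ring, which rules out the library's version.\<close>

lemma inverse_ring_iso:
  assumes bij: "bij_betw f (carrier R) (carrier S)"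
    and mult: "\<And>x y. x \<in> carrier R \<Longrightarrow> y \<in> carrier R \<Longrightarrow> x \<otimes>\<^bsub>R\<^esub> y \<in> carrier R \<and> f (x \<otimes>\<^bsub>R\<^esub> y) = f x \<otimes>\<^bsub>S\<^esub> f y"
    and add: "\<And>x y. x \<in> carrier R \<Longrightarrow> y \<in> carrier R \<Longrightarrow> x \<oplus>\<^bsub>R\<^esub> y \<in> carrier R \<and> f (x \<oplus>\<^bsub>R\<^esub> y) = f x \<oplus>\<^bsub>S\<^esub> f y"
    and one: "\<one>\<^bsub>R\<^esub> \<in> carrier R" "f \<one>\<^bsub>R\<^esub> = \<one>\<^bsub>S\<^esub>"
    and zero: "\<zero>\<^bsub>R\<^esub> \<in> carrier R" "f \<zero>\<^bsub>R\<^esub> = \<zero>\<^bsub>S\<^esub>" and S: "cring S"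
  shows "inv_into (carrier R) f \<in> ring_iso S R" "cring R"
proof -
  let ?g = "inv_into (carrier R) f"
  have inj: "inj_on f (carrier R)" and im: "f ` carrier R = carrier S" using bij by (auto simp: bij_betw_def)
  have g: "?g z \<in> carrier R" "f (?g z) = z" if "z \<in> carrier S" for z
    using that im by (auto intro: inv_into_into f_inv_into_f)
  have gf: "?g (f x) = x" if "x \<in> carrier R" for x using inj that by simp
  show iso: "?g \<in> ring_iso S R"
  proof (rule ring_iso_memI)
    show "?g (x \<otimes>\<^bsub>S\<^esub> y) = ?g x \<otimes>\<^bsub>R\<^esub> ?g y" if "x \<in> carrier S" "y \<in> carrier S" for x y
      using mult[OF g(1)[OF that(1)] g(1)[OF that(2)]] g(2) that gf by metis
    show "?g (x \<oplus>\<^bsub>S\<^esub> y) = ?g x \<oplus>\<^bsub>R\<^esub> ?g y" if "x \<in> carrier S" "y \<in> carrier S" for x y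
      using add[OF g(1)[OF that(1)] g(1)[OF that(2)]] g(2) that gf by metis
    show "?g \<one>\<^bsub>S\<^esub> = \<one>\<^bsub>R\<^esub>" using gf[OF one(1)] one(2) by simp
    show "bij_betw ?g (carrier S) (carrier R)" using bij by (rule bij_betw_inv_into)
  qed (use g in simp)
  have "?g \<zero>\<^bsub>S\<^esub> = \<zero>\<^bsub>R\<^esub>" using gf[OF zero(1)] zero(2) by simp
  then show "cring R" using cring.ring_iso_imp_img_cring[OF S iso] by simp
qed

text \<open>By \<open>meet\<close> the frame of \<sigma> also frames its intersections with other
  cones, so restriction to an overlap does not alter symbols. The frame of \<tau> is obtained on the
  same overlap by exchanging the two cones.\<close>

locale framed_fan =
  fixes \<Sigma> :: "(real ^ 'n::finite) set set"
    and V U :: "(real ^ 'n) set \<Rightarrow> 'n \<Rightarrow> int ^ 'n" and K :: "(real ^ 'n) set \<Rightarrow> 'n set"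
  assumes nonempty: "\<Sigma> \<noteq> {}"
    and frame: "\<sigma> \<in> \<Sigma> \<Longrightarrow> framed_cone \<sigma> (V \<sigma>) (U \<sigma>) (K \<sigma>)"
    and meet: "\<sigma> \<in> \<Sigma> \<Longrightarrow> \<tau> \<in> \<Sigma> \<Longrightarrow> \<exists>K'. framed_cone (\<sigma> \<inter> \<tau>) (V \<sigma>) (U \<sigma>) K'"
begin

definition J :: "'n symbol set" where
  "J = (\<Inter>\<sigma>\<in>\<Sigma>. symbol_algebra (K \<sigma>) (V \<sigma>))"

abbreviation Ssym :: "(real ^ 'n) set \<Rightarrow> 'n sym_elt \<Rightarrow> 'n symbol" where
  "Ssym \<sigma> \<equiv> class_symbol (V \<sigma>) (U \<sigma>)"

lemma J_const: "(\<lambda>a y. c) \<in> J"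
  by (auto simp: J_def symbol_algebra_const)

lemma J_add: "g \<in> J \<Longrightarrow> h \<in> J \<Longrightarrow> (\<lambda>a y. g a y + h a y) \<in> J"
  by (auto simp: J_def symbol_algebra_add)

lemma J_mult: "g \<in> J \<Longrightarrow> h \<in> J \<Longrightarrow> (\<lambda>a y. g a y * h a y) \<in> J"
  by (auto simp: J_def symbol_algebra_mult)

lemma J_sum: "(\<And>x. x \<in> A \<Longrightarrow> f x \<in> J) \<Longrightarrow> (\<lambda>a y. \<Sum>x\<in>A. f x a y) \<in> J"
  by (auto simp: J_def intro!: symbol_algebra_sum)

lemma cring_J: "cring (symbol_ring J)"
  by (intro cring_symbol_ring J_const J_add J_mult)

text \<open>Restriction preserves symbols, the two frames on the overlap give the same symbol, and
  symbols are faithful there. Gluing local sections thus means having one and the same function in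
  all charts.\<close>

lemma sym_res_eq_iff:
  assumes \<sigma>: "\<sigma> \<in> \<Sigma>" and \<tau>: "\<tau> \<in> \<Sigma>" and X: "X \<in> carrier (tan_sym \<sigma>)" and Y: "Y \<in> carrier (tan_sym \<tau>)"
  shows "sym_res \<sigma> (\<sigma> \<inter> \<tau>) X = sym_res \<tau> (\<sigma> \<inter> \<tau>) Y \<longleftrightarrow> Ssym \<sigma> X = Ssym \<tau> Y"
proof -
  obtain K1 K2 where A: "framed_cone (\<sigma> \<inter> \<tau>) (V \<sigma>) (U \<sigma>) K1" and B: "framed_cone (\<sigma> \<inter> \<tau>) (V \<tau>) (U \<tau>) K2"
    using meet[OF \<sigma> \<tau>] meet[OF \<tau> \<sigma>] by (auto simp: Int_commute)
  note X' = sym_res_symbol[OF frame[OF \<sigma>] A _ X, OF Int_lower1]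
  note Y' = sym_res_symbol[OF frame[OF \<tau>] B _ Y, OF Int_lower2]
  have "sym_res \<sigma> (\<sigma> \<inter> \<tau>) X = sym_res \<tau> (\<sigma> \<inter> \<tau>) Y \<longleftrightarrow>
     Ssym \<sigma> (sym_res \<sigma> (\<sigma> \<inter> \<tau>) X) = Ssym \<sigma> (sym_res \<tau> (\<sigma> \<inter> \<tau>) Y)"
    using framed_cone.class_symbol_inj[OF A X'(1) Y'(1)] by auto
  also have "Ssym \<sigma> (sym_res \<tau> (\<sigma> \<inter> \<tau>) Y) = Ssym \<tau> (sym_res \<tau> (\<sigma> \<inter> \<tau>) Y)"
    by (rule class_symbol_frame_independent[OF B A Y'(1)])
  finally show ?thesis by (simp add: X'(2) Y'(2))
qed

definition sec :: "'n symbol \<Rightarrow> (real ^ 'n) set \<Rightarrow> 'n sym_elt" where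
  "sec h = (\<lambda>\<sigma>\<in>\<Sigma>. inv_into (carrier (tan_sym \<sigma>)) (Ssym \<sigma>) h)"

lemma sec:
  assumes "h \<in> J" "\<sigma> \<in> \<Sigma>"
  shows "sec h \<sigma> \<in> carrier (tan_sym \<sigma>)" "Ssym \<sigma> (sec h \<sigma>) = h"
proof -
  have "h \<in> Ssym \<sigma> ` carrier (tan_sym \<sigma>)"
    using assms framed_cone.class_symbol_image[OF frame[OF assms(2)]] by (auto simp: J_def)
  then show "sec h \<sigma> \<in> carrier (tan_sym \<sigma>)" "Ssym \<sigma> (sec h \<sigma>) = h"
    using assms(2) by (simp_all add: sec_def inv_into_into f_inv_into_f)
qed

lemma sec_eqI:
  assumes "h \<in> J" "s \<in> extensional \<Sigma>" "\<And>\<sigma>. \<sigma> \<in> \<Sigma> \<Longrightarrow> s \<sigma> \<in> carrier (tan_sym \<sigma>) \<and> Ssym \<sigma> (s \<sigma>) = h"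
  shows "s = sec h"
proof
  fix \<sigma>
  show "s \<sigma> = sec h \<sigma>"
  proof (cases "\<sigma> \<in> \<Sigma>")
    case True
    then show ?thesis
      using assms(3)[OF True] sec[OF assms(1) True] framed_cone.class_symbol_inj[OF frame[OF True]] by metis
  next
    case False
    then show ?thesis using assms(2) by (simp add: sec_def extensional_def)
  qed
qed

lemma sec_zero: "sec (\<lambda>a y. 0) = (\<lambda>\<sigma>\<in>\<Sigma>. \<zero>\<^bsub>tan_sym \<sigma>\<^esub>)"
proof (rule sec_eqI[symmetric, OF J_const])
  fix \<sigma> assume \<sigma>: "\<sigma> \<in> \<Sigma>"
  interpret framed_cone \<sigma> "V \<sigma>" "U \<sigma>" "K \<sigma>" by (rule frame[OF \<sigma>])
  show "(\<lambda>\<sigma>\<in>\<Sigma>. \<zero>\<^bsub>tan_sym \<sigma>\<^esub>) \<sigma> \<in> carrier (tan_sym \<sigma>) \<and> Ssym \<sigma> ((\<lambda>\<sigma>\<in>\<Sigma>. \<zero>\<^bsub>tan_sym \<sigma>\<^esub>) \<sigma>) = (\<lambda>a y. 0)"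
    using \<sigma> class_symbol_zero by (auto simp: fun_eq_iff)
qed simp

definition symb :: "((real ^ 'n) set \<Rightarrow> 'n sym_elt) \<Rightarrow> 'n symbol" where
  "symb s = (let \<sigma> = SOME \<sigma>. \<sigma> \<in> \<Sigma> in Ssym \<sigma> (s \<sigma>))"

lemma symb_sec: "h \<in> J \<Longrightarrow> symb (sec h) = h"
  using sec(2) some_in_eq[of \<Sigma>] nonempty by (simp add: symb_def Let_def)

lemma H0_sec:
  assumes "h \<in> J" "homogeneous p h" shows "sec h \<in> H0_Sym \<Sigma> p"
proof -
  have "sec h \<in> extensional \<Sigma>" by (simp add: sec_def)
  then show ?thesis
    using assms sec sym_res_eq_iff framed_cone.sym_power_iff[OF frame]
    by (auto simp: H0_Sym_def PiE_iff)
qed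

lemma H0_symb:
  assumes "s \<in> H0_Sym \<Sigma> p"
  shows "symb s \<in> J" "homogeneous p (symb s)" "s = sec (symb s)"
proof -
  define \<sigma>0 where "\<sigma>0 = (SOME \<sigma>. \<sigma> \<in> \<Sigma>)"
  have \<sigma>0: "\<sigma>0 \<in> \<Sigma>" unfolding \<sigma>0_def using some_in_eq[of \<Sigma>] nonempty by simp
  have power: "s \<sigma> \<in> sym_power (chart_ring \<sigma>) (derivations (chart_ring \<sigma>)) p" if "\<sigma> \<in> \<Sigma>" for \<sigma>
    using assms that by (auto simp: H0_Sym_def)
  have s: "s \<sigma> \<in> carrier (tan_sym \<sigma>)" "homogeneous p (Ssym \<sigma> (s \<sigma>))" if "\<sigma> \<in> \<Sigma>" for \<sigma>
    using power[OF that] framed_cone.sym_power_iff[OF frame[OF that]] by auto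
  have eq: "Ssym \<sigma> (s \<sigma>) = symb s" if "\<sigma> \<in> \<Sigma>" for \<sigma>
    using assms that \<sigma>0 s sym_res_eq_iff[OF that \<sigma>0 s(1)[OF that] s(1)[OF \<sigma>0]]
    by (auto simp: H0_Sym_def symb_def \<sigma>0_def[symmetric] Let_def)
  show J: "symb s \<in> J"
    using s(1) eq framed_cone.class_symbol_image[OF frame] by (force simp: J_def)
  show "homogeneous p (symb s)" using s(2)[OF \<sigma>0] eq[OF \<sigma>0] by simp
  show "s = sec (symb s)"
    using assms s(1) eq by (intro sec_eqI J) (auto simp: H0_Sym_def PiE_iff)
qed

section \<open>Graded families of symbols and their sums\<close>

definition graded :: "(nat \<Rightarrow> 'n symbol) \<Rightarrow> bool" where
  "graded H \<longleftrightarrow> (\<forall>p. H p \<in> J \<and> homogeneous p (H p)) \<and> finite {p. H p \<noteq> (\<lambda>a y. 0)}"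

text \<open>Its value at \<open>t\<close> is the sum of the components at \<open>t *s y\<close>;
  this is how the components are recovered from their sum.\<close>

definition gen_poly :: "(nat \<Rightarrow> 'n symbol) \<Rightarrow> complex ^ 'n \<Rightarrow> complex ^ 'n \<Rightarrow> complex poly" where
  "gen_poly H a y = (\<Sum>p\<in>{p. H p \<noteq> (\<lambda>a y. 0)}. Polynomial.monom (H p a y) p)"

lemma coeff_gen_poly: "graded H \<Longrightarrow> Polynomial.coeff (gen_poly H a y) p = H p a y"
  by (auto simp: gen_poly_def graded_def coeff_sum)

definition total :: "(nat \<Rightarrow> 'n symbol) \<Rightarrow> 'n symbol" where
  "total H a y = poly (gen_poly H a y) 1"

lemma total_scale:
  assumes "graded H" shows "total H a (t *s y) = poly (gen_poly H a y) t"
  using assms by (simp add: total_def gen_poly_def poly_sum poly_monom graded_def homogeneous_def mult.commute)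

lemma total_J: "graded H \<Longrightarrow> total H \<in> J"
  unfolding total_def[abs_def] gen_poly_def poly_sum poly_monom by (auto simp: graded_def intro!: J_sum)

lemma total_inj:
  assumes "graded H" "graded H'" "total H = total H'" shows "H = H'"
proof (intro ext)
  fix p a y
  have "gen_poly H a y = gen_poly H' a y"
    by (rule poly_eq_from_values) (simp add: assms flip: total_scale)
  then show "H p a y = H' p a y" using coeff_gen_poly assms by metis
qed

lemma total_surj:
  assumes h: "h \<in> J" shows "\<exists>H. graded H \<and> total H = h"
proof -
  have ex: "\<exists>P N. (\<forall>a y t. h a (t *s y) = poly (P a y) t) \<and>
    (\<forall>i. (\<lambda>a y. Polynomial.coeff (P a y) i) \<in> symbol_algebra (K \<sigma>) (V \<sigma>)) \<and> (\<forall>a y. Polynomial.degree (P a y) \<le> N)"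
    if "\<sigma> \<in> \<Sigma>" for \<sigma>
    using h that by (intro symbol_algebra_homogeneous) (simp add: J_def)
  obtain \<sigma>0 where "\<sigma>0 \<in> \<Sigma>" using nonempty by blast
  then obtain P N where P: "\<And>a y t. h a (t *s y) = poly (P a y) t" and deg: "\<And>a y. Polynomial.degree (P a y) \<le> N"
    using ex by blast
  define H where "H = (\<lambda>p a y. Polynomial.coeff (P a y) p)"
  \<comment> \<open>\<open>P\<close> comes from the chart of one cone; every other chart yields the
    same polynomial because both have the values of \<open>h\<close> along \<open>t *s y\<close>.
    Hence its coefficients lie in all chart algebras.\<close>
  have HJ: "H p \<in> J" for p
    unfolding J_def
  proof
    fix \<sigma> assume "\<sigma> \<in> \<Sigma>"
    then obtain Q where Q: "\<And>a y t. h a (t *s y) = poly (Q a y) t"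
      "\<And>i. (\<lambda>a y. Polynomial.coeff (Q a y) i) \<in> symbol_algebra (K \<sigma>) (V \<sigma>)" using ex by blast
    have "P a y = Q a y" for a y by (rule poly_eq_from_values) (simp add: P[symmetric] Q(1)[symmetric])
    then show "H p \<in> symbol_algebra (K \<sigma>) (V \<sigma>)" using Q(2)[of p] by (simp add: H_def)
  qed
  have hom: "homogeneous p (H p)" for p
    unfolding homogeneous_def H_def using homogeneous_coeff[OF P] by blast
  have "{p. H p \<noteq> (\<lambda>a y. 0)} \<subseteq> {..N}"
  proof
    fix p assume "p \<in> {p. H p \<noteq> (\<lambda>a y. 0)}"
    then obtain a y where "Polynomial.coeff (P a y) p \<noteq> 0" by (auto simp: H_def fun_eq_iff)
    then show "p \<in> {..N}" using le_degree[of "P a y" p] deg[of a y] by simp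
  qed
  then have "finite {p. H p \<noteq> (\<lambda>a y. 0)}" by (rule finite_subset) simp
  then have H: "graded H" using HJ hom by (simp add: graded_def)
  have "gen_poly H a y = P a y" for a y
    by (rule poly_eqI) (simp add: coeff_gen_poly[OF H], simp add: H_def)
  then have "total H a y = h a y" for a y using P[of a 1 y] by (simp add: total_def)
  then show ?thesis using H by blast
qed

definition conv :: "(nat \<Rightarrow> 'n symbol) \<Rightarrow> (nat \<Rightarrow> 'n symbol) \<Rightarrow> nat \<Rightarrow> 'n symbol" where
  "conv H H' p a y = (\<Sum>i\<le>p. H i a y * H' (p - i) a y)"

lemma graded_conv:
  assumes "graded H" "graded H'"
  shows "graded (conv H H')"
proof -
  have "conv H H' p \<in> J" for p
    using assms by (auto simp: conv_def[abs_def] graded_def intro!: J_sum J_mult)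
  moreover have "homogeneous p (conv H H' p)" for p
  proof -
    have "H i a (t *s y) * H' (p - i) a (t *s y) = t ^ p * (H i a y * H' (p - i) a y)" if "i \<le> p" for i a t y
    proof -
      have "H i a (t *s y) * H' (p - i) a (t *s y) = (t ^ i * t ^ (p - i)) * (H i a y * H' (p - i) a y)"
        using assms by (simp add: graded_def homogeneous_def mult_ac)
      then show ?thesis using that by (simp flip: power_add)
    qed
    then show ?thesis by (auto simp: homogeneous_def conv_def sum_distrib_left intro!: sum.cong)
  qed
  moreover have "{p. conv H H' p \<noteq> (\<lambda>a y. 0)} \<subseteq>
     (\<lambda>(i, j). i + j) ` ({p. H p \<noteq> (\<lambda>a y. 0)} \<times> {p. H' p \<noteq> (\<lambda>a y. 0)})"
  proof
    fix p assume "p \<in> {p. conv H H' p \<noteq> (\<lambda>a y. 0)}"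
    then obtain a y where "(\<Sum>i\<le>p. H i a y * H' (p - i) a y) \<noteq> 0" by (auto simp: conv_def fun_eq_iff)
    then obtain i where "i \<le> p" "H i a y * H' (p - i) a y \<noteq> 0" by (meson atMost_iff sum.neutral)
    then show "p \<in> (\<lambda>(i, j). i + j) ` ({p. H p \<noteq> (\<lambda>a y. 0)} \<times> {p. H' p \<noteq> (\<lambda>a y. 0)})"
      by (intro image_eqI[of _ _ "(i, p - i)"]) (auto simp: fun_eq_iff)
  qed
  then have "finite {p. conv H H' p \<noteq> (\<lambda>a y. 0)}"
    by (rule finite_subset) (use assms in \<open>auto simp: graded_def\<close>)
  ultimately show ?thesis by (simp add: graded_def)
qed

lemma total_conv:
  assumes "graded H" "graded H'" shows "total (conv H H') a y = total H a y * total H' a y"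
proof -
  have "gen_poly (conv H H') a y = gen_poly H a y * gen_poly H' a y"
    by (rule poly_eqI) (simp add: coeff_gen_poly assms graded_conv coeff_mult conv_def)
  then show ?thesis by (simp add: total_def)
qed

lemma graded_add:
  assumes "graded H" "graded H'" shows "graded (\<lambda>p a y. H p a y + H' p a y)"
proof -
  have "{p. (\<lambda>a y. H p a y + H' p a y) \<noteq> (\<lambda>a y. 0)} \<subseteq> {p. H p \<noteq> (\<lambda>a y. 0)} \<union> {p. H' p \<noteq> (\<lambda>a y. 0)}"
    by auto
  then have "finite {p. (\<lambda>a y. H p a y + H' p a y) \<noteq> (\<lambda>a y. 0)}"
    by (rule finite_subset) (use assms in \<open>auto simp: graded_def\<close>)
  then show ?thesis using assms by (auto simp: graded_def homogeneous_def distrib_left intro!: J_add)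
qed

lemma total_add:
  assumes "graded H" "graded H'"
  shows "total (\<lambda>p a y. H p a y + H' p a y) a y = total H a y + total H' a y"
proof -
  have "gen_poly (\<lambda>p a y. H p a y + H' p a y) a y = gen_poly H a y + gen_poly H' a y"
    by (rule poly_eqI) (simp add: coeff_gen_poly assms graded_add)
  then show ?thesis by (simp add: total_def)
qed

lemma graded_const: "graded (\<lambda>p a y. if p = 0 then c else 0)"
proof -
  have "{p. (\<lambda>(a :: complex ^ 'n) (y :: complex ^ 'n). if p = (0::nat) then c else 0) \<noteq> (\<lambda>a y. 0)} \<subseteq> {0}" by auto
  then have "finite {p. (\<lambda>(a :: complex ^ 'n) (y :: complex ^ 'n). if p = (0::nat) then c else 0) \<noteq> (\<lambda>a y. 0)}"
    by (rule finite_subset) simp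
  moreover have "(\<lambda>a y. if p = 0 then c else 0) \<in> J" for p :: nat
    using J_const[of c] J_const[of 0] by (cases "p = 0") auto
  ultimately show ?thesis by (auto simp: graded_def homogeneous_def)
qed

lemma total_const: "total (\<lambda>p a y. if p = 0 then c else 0) a y = c"
proof -
  have "gen_poly (\<lambda>p a y. if p = 0 then c else 0) a y = [:c:]"
    by (rule poly_eqI) (simp add: coeff_gen_poly[OF graded_const] coeff_pCons split: nat.splits)
  then show ?thesis by (simp add: total_def)
qed

section \<open>The graded ring of global sections\<close>

abbreviation "A \<equiv> sym_section_ring \<Sigma>"

definition build :: "(nat \<Rightarrow> 'n symbol) \<Rightarrow> nat \<Rightarrow> (real ^ 'n) set \<Rightarrow> 'n sym_elt" where
  "build H p = sec (H p)"

lemma build_carrier: assumes "graded H" shows "build H \<in> carrier A"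
proof -
  have "{p. build H p \<noteq> (\<lambda>\<sigma>\<in>\<Sigma>. \<zero>\<^bsub>tan_sym \<sigma>\<^esub>)} \<subseteq> {p. H p \<noteq> (\<lambda>a y. 0)}"
    by (auto simp: build_def sec_zero)
  then have "finite {p. build H p \<noteq> (\<lambda>\<sigma>\<in>\<Sigma>. \<zero>\<^bsub>tan_sym \<sigma>\<^esub>)}"
    by (rule finite_subset) (use assms in \<open>simp add: graded_def\<close>)
  then show ?thesis using assms by (auto simp: sym_section_ring_def build_def graded_def intro!: H0_sec)
qed

lemma carrier_build:
  assumes "s \<in> carrier A"
  shows "graded (\<lambda>p. symb (s p))" "s = build (\<lambda>p. symb (s p))"
proof -
  have H0: "s p \<in> H0_Sym \<Sigma> p" for p
    using assms by (auto simp: sym_section_ring_def)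
  have fin: "finite {p. s p \<noteq> (\<lambda>\<sigma>\<in>\<Sigma>. \<zero>\<^bsub>tan_sym \<sigma>\<^esub>)}"
    using assms by (auto simp: sym_section_ring_def)
  show "s = build (\<lambda>p. symb (s p))" using H0_symb(3)[OF H0] by (auto simp: build_def fun_eq_iff)
  have "{p. symb (s p) \<noteq> (\<lambda>a y. 0)} \<subseteq> {p. s p \<noteq> (\<lambda>\<sigma>\<in>\<Sigma>. \<zero>\<^bsub>tan_sym \<sigma>\<^esub>)}"
    using symb_sec[OF J_const[of 0]] by (auto simp: sec_zero)
  then show "graded (\<lambda>p. symb (s p))" using H0_symb[OF H0] fin by (auto simp: graded_def intro: finite_subset)
qed

lemma symb_build: "graded H \<Longrightarrow> (\<lambda>p. symb (build H p)) = H"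
  by (auto simp: build_def graded_def symb_sec)

lemma build_mult:
  assumes "graded H" "graded H'" shows "build H \<otimes>\<^bsub>A\<^esub> build H' = build (conv H H')"
proof
  fix p
  have J: "H i \<in> J" "H' i \<in> J" "conv H H' i \<in> J" for i using assms graded_conv[OF assms] by (auto simp: graded_def)
  show "(build H \<otimes>\<^bsub>A\<^esub> build H') p = build (conv H H') p"
    unfolding build_def[of "conv H H'"]
  proof (rule sec_eqI[OF J(3)])
    fix \<sigma> assume \<sigma>: "\<sigma> \<in> \<Sigma>"
    interpret framed_cone \<sigma> "V \<sigma>" "U \<sigma>" "K \<sigma>" by (rule frame[OF \<sigma>])
    have e: "(build H \<otimes>\<^bsub>A\<^esub> build H') p \<sigma> = (\<Oplus>\<^bsub>tan_sym \<sigma>\<^esub>i\<in>{..p}. sec (H i) \<sigma> \<otimes>\<^bsub>tan_sym \<sigma>\<^esub> sec (H' (p - i)) \<sigma>)"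
      using \<sigma> by (simp add: sym_section_ring_def build_def)
    have "Ssym \<sigma> ((build H \<otimes>\<^bsub>A\<^esub> build H') p \<sigma>) = conv H H' p"
      unfolding e using sec J \<sigma>
      by (intro ext) (simp add: class_symbol_finsum class_symbol_mult conv_def)
    moreover have "(build H \<otimes>\<^bsub>A\<^esub> build H') p \<sigma> \<in> carrier (tan_sym \<sigma>)"
      unfolding e using sec J \<sigma> by (intro SA.finsum_closed) auto
    ultimately show "(build H \<otimes>\<^bsub>A\<^esub> build H') p \<sigma> \<in> carrier (tan_sym \<sigma>) \<and>
      Ssym \<sigma> ((build H \<otimes>\<^bsub>A\<^esub> build H') p \<sigma>) = conv H H' p" by blast
  qed (simp add: sym_section_ring_def)
qed

lemma build_add:
  assumes "graded H" "graded H'" shows "build H \<oplus>\<^bsub>A\<^esub> build H' = build (\<lambda>p a y. H p a y + H' p a y)"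
proof
  fix p
  have J: "H i \<in> J" "H' i \<in> J" for i using assms by (auto simp: graded_def)
  show "(build H \<oplus>\<^bsub>A\<^esub> build H') p = build (\<lambda>p a y. H p a y + H' p a y) p"
    unfolding build_def[of "\<lambda>p a y. H p a y + H' p a y"]
  proof (rule sec_eqI[OF J_add[OF J]])
    fix \<sigma> assume \<sigma>: "\<sigma> \<in> \<Sigma>"
    interpret framed_cone \<sigma> "V \<sigma>" "U \<sigma>" "K \<sigma>" by (rule frame[OF \<sigma>])
    have e: "(build H \<oplus>\<^bsub>A\<^esub> build H') p \<sigma> = sec (H p) \<sigma> \<oplus>\<^bsub>tan_sym \<sigma>\<^esub> sec (H' p) \<sigma>"
      using \<sigma> by (simp add: sym_section_ring_def build_def)
    show "(build H \<oplus>\<^bsub>A\<^esub> build H') p \<sigma> \<in> carrier (tan_sym \<sigma>) \<and>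
      Ssym \<sigma> ((build H \<oplus>\<^bsub>A\<^esub> build H') p \<sigma>) = (\<lambda>a y. H p a y + H' p a y)"
      unfolding e using sec J \<sigma> by (auto simp: class_symbol_add fun_eq_iff)
  qed (simp add: sym_section_ring_def)
qed

lemma build_const: "cconst A c = build (\<lambda>p a y. if p = 0 then c else 0)"
proof
  fix p
  show "cconst A c p = build (\<lambda>p a y. if p = 0 then c else 0) p"
    unfolding build_def
  proof (rule sec_eqI)
    show "(\<lambda>a y. if p = 0 then c else 0) \<in> J" using J_const[of c] J_const[of 0] by (cases "p = 0") auto
    fix \<sigma> assume \<sigma>: "\<sigma> \<in> \<Sigma>"
    interpret framed_cone \<sigma> "V \<sigma>" "U \<sigma>" "K \<sigma>" by (rule frame[OF \<sigma>])
    have c: "sym_class R M (Poly_Mapping.single {#} (lconst c)) \<in> carrier (tan_sym \<sigma>)"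
      using const_closed[OF chart_ring_lconst] by (simp add: sym_alg_carrier)
    show "cconst A c p \<sigma> \<in> carrier (tan_sym \<sigma>) \<and> Ssym \<sigma> (cconst A c p \<sigma>) = (\<lambda>a y. if p = 0 then c else 0)"
      using \<sigma> c by (auto simp: sym_section_ring_def class_symbol_const class_symbol_zero fun_eq_iff)
  qed (simp add: sym_section_ring_def)
qed

lemma build_one: "\<one>\<^bsub>A\<^esub> = build (\<lambda>p a y. if p = 0 then 1 else 0)"
proof
  fix p
  show "\<one>\<^bsub>A\<^esub> p = build (\<lambda>p a y. if p = 0 then 1 else 0) p"
    unfolding build_def
  proof (rule sec_eqI)
    show "(\<lambda>a y. if p = 0 then 1 else 0) \<in> J" using J_const[of 1] J_const[of 0] by (cases "p = 0") auto
    fix \<sigma> assume \<sigma>: "\<sigma> \<in> \<Sigma>"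
    interpret framed_cone \<sigma> "V \<sigma>" "U \<sigma>" "K \<sigma>" by (rule frame[OF \<sigma>])
    show "\<one>\<^bsub>A\<^esub> p \<sigma> \<in> carrier (tan_sym \<sigma>) \<and> Ssym \<sigma> (\<one>\<^bsub>A\<^esub> p \<sigma>) = (\<lambda>a y. if p = 0 then 1 else 0)"
      using \<sigma> by (auto simp: sym_section_ring_def class_symbol_one class_symbol_zero fun_eq_iff)
  qed (simp add: sym_section_ring_def)
qed

text \<open>The idle case distinction makes this literally the instance \<open>c = 0\<close> of
  \<open>build_const\<close>.\<close>

lemma build_zero: "\<zero>\<^bsub>A\<^esub> = build (\<lambda>p a y. if p = 0 then 0 else 0)"
  by (simp add: build_def fun_eq_iff sec_zero sym_section_ring_def)

definition section_symbol :: "(nat \<Rightarrow> (real ^ 'n) set \<Rightarrow> 'n sym_elt) \<Rightarrow> 'n symbol" where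
  "section_symbol s = total (\<lambda>p. symb (s p))"

lemma section_symbol_build: "graded H \<Longrightarrow> section_symbol (build H) = total H"
  by (simp add: section_symbol_def symb_build)

lemma sections_iso:
  "inv_into (carrier A) section_symbol \<in> ring_iso (symbol_ring J) A" "cring A"
  "\<And>c. inv_into (carrier A) section_symbol (\<lambda>a y. c) = cconst A c"
proof -
  have bij: "bij_betw section_symbol (carrier A) J"
    unfolding bij_betw_def
  proof
    show "inj_on section_symbol (carrier A)"
    proof (rule inj_onI)
      fix s t assume st: "s \<in> carrier A" "t \<in> carrier A" "section_symbol s = section_symbol t"
      then have "(\<lambda>p. symb (s p)) = (\<lambda>p. symb (t p))"
        unfolding section_symbol_def by (intro total_inj carrier_build(1))
      then show "s = t" using carrier_build(2)[OF st(1)] carrier_build(2)[OF st(2)] by simp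
    qed
    show "section_symbol ` carrier A = J"
    proof (intro equalityI subsetI)
      fix h assume "h \<in> section_symbol ` carrier A"
      then show "h \<in> J" using carrier_build(1) total_J by (auto simp: section_symbol_def)
    next
      fix h assume "h \<in> J"
      then obtain H where "graded H" "total H = h" using total_surj by blast
      then show "h \<in> section_symbol ` carrier A"
        using section_symbol_build build_carrier by (intro image_eqI[of _ _ "build H"]) auto
    qed
  qed
  have mult: "s \<otimes>\<^bsub>A\<^esub> t \<in> carrier A \<and> section_symbol (s \<otimes>\<^bsub>A\<^esub> t) = section_symbol s \<otimes>\<^bsub>symbol_ring J\<^esub> section_symbol t"
    and add: "s \<oplus>\<^bsub>A\<^esub> t \<in> carrier A \<and> section_symbol (s \<oplus>\<^bsub>A\<^esub> t) = section_symbol s \<oplus>\<^bsub>symbol_ring J\<^esub> section_symbol t"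
    if st: "s \<in> carrier A" "t \<in> carrier A" for s t
  proof -
    obtain H H' where H: "graded H" "graded H'" "s = build H" "t = build H'"
      using carrier_build[OF st(1)] carrier_build[OF st(2)] by blast
    show "s \<otimes>\<^bsub>A\<^esub> t \<in> carrier A \<and> section_symbol (s \<otimes>\<^bsub>A\<^esub> t) = section_symbol s \<otimes>\<^bsub>symbol_ring J\<^esub> section_symbol t"
      unfolding H(3,4) using H(1,2) by (simp add: build_mult build_carrier graded_conv section_symbol_build total_conv fun_eq_iff)
    show "s \<oplus>\<^bsub>A\<^esub> t \<in> carrier A \<and> section_symbol (s \<oplus>\<^bsub>A\<^esub> t) = section_symbol s \<oplus>\<^bsub>symbol_ring J\<^esub> section_symbol t"
      unfolding H(3,4) using H(1,2) by (simp add: build_add build_carrier graded_add section_symbol_build total_add fun_eq_iff)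
  qed
  have const: "cconst A c \<in> carrier A" "section_symbol (cconst A c) = (\<lambda>a y. c)" for c
    unfolding build_const
    by (simp_all add: build_carrier graded_const section_symbol_build total_const fun_eq_iff)
  have one: "\<one>\<^bsub>A\<^esub> = cconst A 1" and zero: "\<zero>\<^bsub>A\<^esub> = cconst A 0"
    unfolding build_const build_one build_zero by simp_all
  show "inv_into (carrier A) section_symbol \<in> ring_iso (symbol_ring J) A" "cring A"
    by (rule inverse_ring_iso[where f = section_symbol and R = A and S = "symbol_ring J"];
        use bij mult add const one zero cring_J in simp)+
  show "inv_into (carrier A) section_symbol (\<lambda>a y. c) = cconst A c" for c
    using inv_into_f_f[of section_symbol "carrier A" "cconst A c"] const[of c] bij by (simp add: bij_betw_def)
qed

end

section \<open>Invariants of the torus action\<close>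

lemma poly_functions_sum:
  "(\<And>k. k \<in> S \<Longrightarrow> f k \<in> poly_functions I) \<Longrightarrow> (\<lambda>x. \<Sum>k\<in>S. f k x) \<in> poly_functions I"
  by (induction S rule: infinite_finite_induct) (auto intro: poly_functions.intros)

lemma poly_functions_prod:
  "(\<And>k. k \<in> S \<Longrightarrow> f k \<in> poly_functions I) \<Longrightarrow> (\<lambda>x. \<Prod>k\<in>S. f k x) \<in> poly_functions I"
  by (induction S rule: infinite_finite_induct) (auto intro: poly_functions.intros)

lemma poly_functions_power: "f \<in> poly_functions I \<Longrightarrow> (\<lambda>x. f x ^ n) \<in> poly_functions I"
  by (induction n) (auto intro: poly_functions.intros)

lemma poly_functions_fst: "i \<in> I \<Longrightarrow> (\<lambda>x. fst x i) \<in> poly_functions I"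
  using poly_functions.coord_z[of i I] by (simp add: case_prod_beta')

lemma poly_functions_snd: "i \<in> I \<Longrightarrow> (\<lambda>x. snd x i) \<in> poly_functions I"
  using poly_functions.coord_w[of i I] by (simp add: case_prod_beta')

text \<open>A signed exponent stands for a power of z or of w but never both: on the fibre each
  product of z and w with the same index becomes a linear form in \<open>y\<close>.\<close>

definition hk_monomial :: "'i set \<Rightarrow> ('i \<Rightarrow> int) \<Rightarrow> 'i hk_pt \<Rightarrow> complex" where
  "hk_monomial I c x = (\<Prod>i\<in>I. fst x i ^ nat (c i) * snd x i ^ nat (- c i))"

lemma hk_monomial_poly: "hk_monomial I c \<in> poly_functions I"
  unfolding hk_monomial_def[abs_def]
  by (intro poly_functions_prod poly_functions.mult poly_functions_power poly_functions_fst poly_functions_snd)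

text \<open>Exponents of opposite sign leave products of z and w. One number counts both surpluses,
  because c = nat c - nat (- c).\<close>

lemma hk_monomial_mult:
  "hk_monomial I c x * hk_monomial I d x = hk_monomial I (\<lambda>i. c i + d i) x *
     (\<Prod>i\<in>I. (fst x i * snd x i) ^ (nat (c i) + nat (d i) - nat (c i + d i)))"
proof -
  have "z ^ nat c * w ^ nat (- c) * (z ^ nat d * w ^ nat (- d)) =
     z ^ nat (c + d) * w ^ nat (- (c + d)) * (z * w) ^ (nat c + nat d - nat (c + d))" for z w :: complex and c d
  proof -
    define k where "k = nat c + nat d - nat (c + d)"
    have "nat c + nat d = nat (c + d) + k" "nat (- c) + nat (- d) = nat (- (c + d)) + k"
      by (auto simp: k_def)
    then have "z ^ nat c * z ^ nat d = z ^ nat (c + d) * z ^ k" "w ^ nat (- c) * w ^ nat (- d) = w ^ nat (- (c + d)) * w ^ k"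
      by (metis power_add)+
    then show ?thesis unfolding k_def[symmetric] power_mult_distrib by (metis (no_types) mult.assoc mult.left_commute)
  qed
  then show ?thesis by (simp add: hk_monomial_def flip: prod.distrib)
qed

definition exp_weight :: "nat \<Rightarrow> (nat \<Rightarrow> int) \<Rightarrow> (nat \<Rightarrow> complex) \<Rightarrow> complex" where
  "exp_weight r e \<tau> = exp (\<Sum>j<r. of_int (e j) * \<tau> j)"

text \<open>Extensionality of the weights ensures that two different ones already differ at some
  index below \<open>r\<close>, where \<tau> can detect it.\<close>

lemma exp_weight_independent:
  assumes "finite W" "W \<subseteq> extensional {..<r}" "\<And>\<tau>. (\<Sum>e\<in>W. g e * exp_weight r e \<tau>) = 0" "e \<in> W"
  shows "g e = 0"
proof -
  have "\<exists>\<tau>. exp_weight r e \<tau> \<noteq> exp_weight r e' \<tau>" if "e \<in> W" "e' \<in> W" "e \<noteq> e'" for e e'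
  proof -
    have "\<exists>j\<in>{..<r}. e j \<noteq> e' j"
    proof (rule ccontr)
      assume "\<not> ?thesis"
      then have "e = e'" using that(1,2) assms(2) by (intro extensionalityI[of e "{..<r}" e']) auto
      then show False using that(3) by simp
    qed
    then obtain j where j: "j < r" "e j \<noteq> e' j" by auto
    have "exp_weight r e (\<lambda>i. if i = j then of_real (ln 2) else 0) = exp (of_int (e j) * of_real (ln 2))" for e
      using j by (simp add: exp_weight_def if_distrib cong: if_cong)
    then show ?thesis using exp_int_ln2_inj j(2) by metis
  qed
  moreover have "exp_weight r e (\<lambda>j. \<tau> j + \<tau>' j) = exp_weight r e \<tau> * exp_weight r e \<tau>'" for e \<tau> \<tau>'
    by (simp add: exp_weight_def distrib_left sum.distrib exp_add)
  ultimately show ?thesis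
    using characters_independent[of W "exp_weight r" "\<lambda>\<tau> \<tau>' j. \<tau> j + \<tau>' j" g] assms
    by (auto simp: exp_weight_def)
qed

text \<open>Logarithms of the coordinates lift a torus point to the Lie algebra, where weights
  become exponentials of linear forms.\<close>

lemma torus_exp:
  assumes "t \<in> torus r"
  shows "\<exists>\<tau>. \<forall>i. torus_weight A r t i = exp (\<Sum>j<r. of_int (A j i) * \<tau> j)"
proof -
  define \<tau> where "\<tau> = (\<lambda>j. Ln (t j))"
  have t: "t j = exp (\<tau> j)" if "j < r" for j
  proof -
    have "t j \<in> UNIV - {0}" using PiE_mem[OF assms[unfolded torus_def], of j] that by simp
    then show ?thesis by (simp add: \<tau>_def)
  qed
  have "torus_weight A r t i = exp (\<Sum>j<r. of_int (A j i) * \<tau> j)" for i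
    unfolding torus_weight_def exp_sum[OF finite_lessThan]
  proof (intro prod.cong refl)
    fix j assume "j \<in> {..<r}"
    then have "t j = exp (\<tau> j)" by (simp add: t)
    then show "t j powi A j i = exp (of_int (A j i) * \<tau> j)" by (simp only: exp_power_int)
  qed
  then show ?thesis by blast
qed

lemma exp_torus:
  "\<exists>t\<in>torus r. \<forall>i. torus_weight A r t i = exp (\<Sum>j<r. of_int (A j i) * \<tau> j)"
proof -
  have "torus_weight A r (\<lambda>j\<in>{..<r}. exp (\<tau> j)) i = exp (\<Sum>j<r. of_int (A j i) * \<tau> j)" for i
    by (simp add: torus_weight_def exp_sum exp_power_int mult.commute)
  moreover have "(\<lambda>j\<in>{..<r}. exp (\<tau> j)) \<in> torus r" by (auto simp: torus_def)
  ultimately show ?thesis by blast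
qed

definition weight :: "(nat \<Rightarrow> 'i \<Rightarrow> int) \<Rightarrow> nat \<Rightarrow> 'i set \<Rightarrow> ('i \<Rightarrow> int) \<Rightarrow> nat \<Rightarrow> int" where
  "weight A r I c = (\<lambda>j\<in>{..<r}. \<Sum>i\<in>I. A j i * c i)"

lemma hk_monomial_act:
  assumes "finite I" "\<And>i. torus_weight A r t i = exp (\<Sum>j<r. of_int (A j i) * \<tau> j)"
  shows "hk_monomial I c (torus_act A r I t x) = exp_weight r (weight A r I c) \<tau> * hk_monomial I c x"
proof -
  let ?s = "\<lambda>i. \<Sum>j<r. of_int (A j i) * \<tau> j"
  have "hk_monomial I c (torus_act A r I t x) =
     (\<Prod>i\<in>I. exp (of_int (c i) * ?s i) * (fst x i ^ nat (c i) * snd x i ^ nat (- c i)))"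
    unfolding hk_monomial_def
  proof (intro prod.cong refl)
    fix i assume i: "i \<in> I"
    have e: "exp s ^ nat k * inverse (exp s) ^ nat (- k) = exp (of_int k * s)" for s :: complex and k
    proof (cases "0 \<le> k")
      case True
      then show ?thesis by (simp flip: exp_of_nat_mult)
    next
      case False
      then show ?thesis by (simp add: exp_of_nat_mult[symmetric] exp_minus[symmetric])
    qed
    have "fst (torus_act A r I t x) i = exp (?s i) * fst x i" "snd (torus_act A r I t x) i = inverse (exp (?s i)) * snd x i"
      using i assms(2) by (auto simp: torus_act_def split: prod.split)
    then have "fst (torus_act A r I t x) i ^ nat (c i) * snd (torus_act A r I t x) i ^ nat (- c i) =
      (exp (?s i) ^ nat (c i) * inverse (exp (?s i)) ^ nat (- c i)) * (fst x i ^ nat (c i) * snd x i ^ nat (- c i))"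
      by (simp only: power_mult_distrib mult_ac)
    then show "fst (torus_act A r I t x) i ^ nat (c i) * snd (torus_act A r I t x) i ^ nat (- c i) =
      exp (of_int (c i) * ?s i) * (fst x i ^ nat (c i) * snd x i ^ nat (- c i))"
      unfolding e .
  qed
  also have "\<dots> = exp (\<Sum>i\<in>I. of_int (c i) * ?s i) * hk_monomial I c x"
    by (simp add: prod.distrib exp_sum assms(1) hk_monomial_def)
  also have "(\<Sum>i\<in>I. of_int (c i) * ?s i) = (\<Sum>j<r. of_int (weight A r I c j) * \<tau> j)"
    by (simp add: weight_def sum_distrib_left sum_distrib_right sum.swap[of _ I] mult_ac)
  finally show ?thesis by (simp add: exp_weight_def)
qed

text \<open>\<open>D\<close> and \<open>C\<close> split the exact sequence: \<open>D B = 1\<close> and \<open>B D + C A = 1\<close>.\<close>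

locale split_sequence =
  fixes I :: "'i set" and v :: "'i \<Rightarrow> int ^ 'n::finite" and A :: "nat \<Rightarrow> 'i \<Rightarrow> int" and r :: nat
    and D :: "'i \<Rightarrow> int ^ 'n" and C :: "'i \<Rightarrow> nat \<Rightarrow> int"
  assumes fin: "finite I" and v_nonzero: "i \<in> I \<Longrightarrow> v i \<noteq> 0"
    and split: "i \<in> I \<Longrightarrow> k \<in> I \<Longrightarrow> pair_int (v i) (D k) + (\<Sum>j<r. C i j * A j k) = (if i = k then 1 else 0)"
    and DB: "(\<Sum>i\<in>I. pair_int (v i) m *s D i) = m"
    and AB: "j < r \<Longrightarrow> (\<Sum>i\<in>I. A j i * pair_int (v i) m) = 0"
begin

abbreviation "F \<equiv> moment_fiber A r I (\<lambda>_. 0)"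

text \<open>The covector belonging to a point of the fibre: the left inverse \<open>D\<close> of
  \<open>B\<close>, extended to complex coefficients, applied to the vector of products of z and
  w.\<close>

definition Y :: "'i hk_pt \<Rightarrow> complex ^ 'n" where
  "Y x = (\<Sum>i\<in>I. (fst x i * snd x i) *s cvec (D i))"

lemma fiber_moment: "x \<in> F \<Longrightarrow> j < r \<Longrightarrow> (\<Sum>i\<in>I. of_int (A j i) * (fst x i * snd x i)) = 0"
  by (auto simp: moment_fiber_def moment_map_def mult.assoc dest!: fun_cong[of _ _ j] split: prod.splits)

text \<open>The moment map equation says that \<open>A\<close> kills the vector of products, so
  \<open>B D + C A = 1\<close> reduces to \<open>B D = 1\<close> on it.\<close>

lemma fiber_cpair:
  assumes x: "x \<in> F" and i: "i \<in> I" shows "cpair (v i) (Y x) = fst x i * snd x i"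
proof -
  let ?p = "\<lambda>k. fst x k * snd x k"
  have sp: "of_int (pair_int (v i) (D k)) = (if i = k then 1 else 0) - (\<Sum>j<r. of_int (C i j) * (of_int (A j k) :: complex))"
    if "k \<in> I" for k
    using arg_cong[OF split[OF i that], of "of_int :: int \<Rightarrow> complex"] by (auto simp: algebra_simps split: if_splits)
  have "cpair (v i) (Y x) = (\<Sum>k\<in>I. ?p k * of_int (pair_int (v i) (D k)))"
    by (simp add: Y_def cpair_sum cpair_scale cpair_cvec)
  also have "\<dots> = (\<Sum>k\<in>I. (if i = k then ?p k else 0) - (\<Sum>j<r. of_int (C i j) * (of_int (A j k) * ?p k)))"
    by (intro sum.cong refl) (simp add: sp right_diff_distrib sum_distrib_left mult_ac)
  also have "\<dots> = ?p i - (\<Sum>j<r. of_int (C i j) * (\<Sum>k\<in>I. of_int (A j k) * ?p k))"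
    using i fin by (simp add: sum_subtractf sum_distrib_left sum.swap[of _ I])
  also have "\<dots> = ?p i" using fiber_moment[OF x] by simp
  finally show ?thesis .
qed

definition param :: "complex ^ 'n \<Rightarrow> complex ^ 'n \<Rightarrow> 'i hk_pt" where
  "param a y = ((\<lambda>i\<in>I. chi (D i) a), (\<lambda>i\<in>I. cpair (v i) y / chi (D i) a))"

lemma param_simps: "i \<in> I \<Longrightarrow> fst (param a y) i = chi (D i) a" "i \<in> I \<Longrightarrow> snd (param a y) i = cpair (v i) y / chi (D i) a"
  by (simp_all add: param_def)

lemma AB_vec: assumes "j < r" shows "(\<Sum>i\<in>I. A j i *s v i) = 0"
proof (subst vec_eq_iff, intro allI)
  fix k
  show "(\<Sum>i\<in>I. A j i *s v i) $ k = 0 $ k"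
    using AB[OF assms, of "axis k 1"] by (simp add: pair_int_axis)
qed

lemma param_fiber: "param a y \<in> F"
proof -
  have "(\<Sum>i\<in>I. of_int (A j i) * chi (D i) a * (cpair (v i) y / chi (D i) a)) = 0" if "j < r" for j
  proof -
    have "(\<Sum>i\<in>I. of_int (A j i) * chi (D i) a * (cpair (v i) y / chi (D i) a)) = cpair (\<Sum>i\<in>I. A j i *s v i) y"
      by (simp add: cpair_sum cpair_scale)
    then show ?thesis by (simp add: AB_vec[OF that])
  qed
  then show ?thesis
    by (auto simp: moment_fiber_def hk_space_def moment_map_def param_def intro!: restrict_ext)
qed

lemma Y_param: "Y (param a y) = y"
proof (subst vec_eq_iff, intro allI)
  fix k
  have delta: "(\<Sum>i\<in>I. v i $ l * D i $ k) = (if k = l then 1 else 0)" for l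
    using arg_cong[OF DB[of "axis l 1"], of "\<lambda>x. x $ k"] by (simp add: pair_int_axis) (simp add: axis_def)
  have "Y (param a y) $ k = (\<Sum>i\<in>I. cpair (v i) y * of_int (D i $ k))"
    by (simp add: Y_def param_simps cvec_def)
  also have "\<dots> = (\<Sum>i\<in>I. \<Sum>l\<in>UNIV. of_int (v i $ l * D i $ k) * y $ l)"
    by (simp add: cpair_def sum_distrib_left sum_distrib_right mult_ac)
  also have "\<dots> = (\<Sum>l\<in>UNIV. of_int (\<Sum>i\<in>I. v i $ l * D i $ k) * y $ l)"
    by (subst sum.swap) (simp add: sum_distrib_right)
  also have "\<dots> = (\<Sum>l\<in>UNIV. if k = l then y $ l else 0)" unfolding delta by (intro sum.cong) auto
  finally show "Y (param a y) $ k = y $ k" by simp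
qed

definition mono :: "int ^ 'n \<Rightarrow> 'i hk_pt \<Rightarrow> complex" where
  "mono m = hk_monomial I (\<lambda>i. pair_int (v i) m)"

text \<open>A factor z contributes \<open>chi (D i) a\<close>, a factor w the linear form divided by
  it. All characters together are that of the sum of \<open>pair_int (v i) m *s D i\<close>, which
  is m by \<open>DB\<close>, and the linear forms make up the pole factor.\<close>

lemma mono_param: "mono m (param a y) = chi m a * pole_factor I v m y"
proof -
  have e: "chi w a ^ nat k * (c / chi w a) ^ nat (- k) = chi (k *s w) a * c ^ nat (- k)" for w :: "int ^ 'n" and c k
  proof (cases "0 \<le> k")
    case True
    then show ?thesis using chi_scale_nat[of "nat k" w a] by simp
  next
    case False
    then have "k *s w = - (int (nat (- k)) *s w)" by (simp add: vec_eq_iff)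
    then have "chi (k *s w) a = inverse (chi w a ^ nat (- k))"
      by (simp only: chi_uminus chi_scale_nat)
    then show ?thesis using False by (simp add: power_divide field_simps)
  qed
  have "mono m (param a y) = (\<Prod>i\<in>I. chi (pair_int (v i) m *s D i) a * cpair (v i) y ^ nat (- pair_int (v i) m))"
    unfolding mono_def hk_monomial_def by (intro prod.cong refl) (simp add: param_simps e)
  also have "\<dots> = chi (\<Sum>i\<in>I. pair_int (v i) m *s D i) a * pole_factor I v m y"
    by (simp add: prod.distrib chi_sum pole_factor_def)
  finally show ?thesis by (simp add: DB)
qed

section \<open>Expansion of polynomial functions on the fibre\<close>

definition term_sum :: "(('i \<Rightarrow> int) \<times> (complex ^ 'n \<Rightarrow> complex)) list \<Rightarrow> 'i hk_pt \<Rightarrow> complex" where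
  "term_sum xs x = (\<Sum>(c, p)\<leftarrow>xs. hk_monomial I c x * p (Y x))"

definition form :: "('i hk_pt \<Rightarrow> complex) \<Rightarrow> bool" where
  "form f \<longleftrightarrow> (\<exists>xs. (\<forall>(c, p)\<in>set xs. p \<in> ypoly) \<and> (\<forall>x\<in>F. f x = term_sum xs x))"

lemma form_term: "p \<in> ypoly \<Longrightarrow> form (\<lambda>x. hk_monomial I c x * p (Y x))"
  unfolding form_def by (intro exI[of _ "[(c, p)]"]) (simp add: term_sum_def)

lemma form_zero: "form (\<lambda>x. 0)"
  unfolding form_def by (intro exI[of _ "[]"]) (simp add: term_sum_def)

lemma form_cong: "form f \<Longrightarrow> (\<And>x. x \<in> F \<Longrightarrow> f x = g x) \<Longrightarrow> form g"
  unfolding form_def by auto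

lemma form_add: assumes "form f" "form g" shows "form (\<lambda>x. f x + g x)"
proof -
  obtain xs ys where "\<forall>(c, p)\<in>set xs. p \<in> ypoly" "\<forall>x\<in>F. f x = term_sum xs x"
    "\<forall>(c, p)\<in>set ys. p \<in> ypoly" "\<forall>x\<in>F. g x = term_sum ys x" using assms by (auto simp: form_def)
  then show ?thesis unfolding form_def by (intro exI[of _ "xs @ ys"]) (auto simp: term_sum_def)
qed

lemma form_induct:
  assumes "form f" and "\<And>f g. P f \<Longrightarrow> (\<And>x. x \<in> F \<Longrightarrow> f x = g x) \<Longrightarrow> P g" and "P (\<lambda>x. 0)"
    and "\<And>f g. P f \<Longrightarrow> P g \<Longrightarrow> P (\<lambda>x. f x + g x)"
    and "\<And>c p. p \<in> ypoly \<Longrightarrow> P (\<lambda>x. hk_monomial I c x * p (Y x))"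
  shows "P f"
proof -
  obtain xs where xs: "\<forall>(c, p)\<in>set xs. p \<in> ypoly" "\<forall>x\<in>F. f x = term_sum xs x" using assms(1) by (auto simp: form_def)
  have "P (term_sum xs)" using xs(1)
  proof (induction xs)
    case Nil
    then show ?case using assms(3) by (simp add: term_sum_def[abs_def])
  next
    case (Cons cp xs)
    obtain c p where cp: "cp = (c, p)" by (cases cp)
    have "P (\<lambda>x. hk_monomial I c x * p (Y x) + term_sum xs x)" using Cons cp by (intro assms(4,5)) auto
    then show ?case by (simp add: term_sum_def[abs_def] cp)
  qed
  then show ?thesis by (rule assms(2)) (use xs in simp)
qed

text \<open>The products of z and w left over from multiplying two monomials are linear forms in
  \<open>Y x\<close> on the fibre, so they join the polynomial factor.\<close>

lemma form_mult: assumes "form f" "form g" shows "form (\<lambda>x. f x * g x)"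
  using assms(1)
proof (rule form_induct[where P = "\<lambda>f. form (\<lambda>x. f x * g x)"])
  fix c p assume p: "p \<in> (ypoly :: (complex ^ 'n \<Rightarrow> complex) set)"
  show "form (\<lambda>x. hk_monomial I c x * p (Y x) * g x)"
    using assms(2)
  proof (rule form_induct[where P = "\<lambda>g. form (\<lambda>x. hk_monomial I c x * p (Y x) * g x)"])
    fix d q assume q: "q \<in> (ypoly :: (complex ^ 'n \<Rightarrow> complex) set)"
    define k where "k = (\<lambda>i. nat (c i) + nat (d i) - nat (c i + d i))"
    have "form (\<lambda>x. hk_monomial I (\<lambda>i. c i + d i) x * (\<lambda>y. (\<Prod>i\<in>I. cpair (v i) y ^ k i) * (p y * q y)) (Y x))"
      by (intro form_term ypoly.mult ypoly_prod ypoly_power ypoly_cpair p q)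
    then show "form (\<lambda>x. hk_monomial I c x * p (Y x) * (hk_monomial I d x * q (Y x)))"
    proof (rule form_cong)
      fix x assume x: "x \<in> F"
      have "(\<Prod>i\<in>I. cpair (v i) (Y x) ^ k i) = (\<Prod>i\<in>I. (fst x i * snd x i) ^ k i)"
        by (intro prod.cong refl) (simp add: fiber_cpair[OF x])
      then show "hk_monomial I (\<lambda>i. c i + d i) x * ((\<Prod>i\<in>I. cpair (v i) (Y x) ^ k i) * (p (Y x) * q (Y x))) =
        hk_monomial I c x * p (Y x) * (hk_monomial I d x * q (Y x))"
        using hk_monomial_mult[of I c x d] by (simp add: k_def mult_ac)
    qed
  qed (auto simp: form_zero distrib_left intro: form_add elim: form_cong)
qed (auto simp: form_zero distrib_right intro: form_add elim: form_cong)

lemma poly_functions_form: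
  assumes "f \<in> poly_functions I" shows "form f"
  using assms
proof induction
  case (const c)
  have "form (\<lambda>x. hk_monomial I (\<lambda>i. 0) x * (\<lambda>y. c) (Y x))" by (intro form_term ypoly.const)
  then show ?case by (simp add: hk_monomial_def)
next
  case (coord_z i)
  have "hk_monomial I (\<lambda>k. if k = i then 1 else 0) x = fst x i" for x
  proof -
    have "hk_monomial I (\<lambda>k. if k = i then 1 else 0) x = (\<Prod>k\<in>I. if k = i then fst x i else 1)"
      unfolding hk_monomial_def by (intro prod.cong) auto
    then show ?thesis using coord_z fin by simp
  qed
  then show ?case using form_term[OF ypoly.const[of 1], of "\<lambda>k. if k = i then 1 else 0"] by (simp add: case_prod_beta')
next
  case (coord_w i)
  have "hk_monomial I (\<lambda>k. if k = i then - 1 else 0) x = snd x i" for x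
  proof -
    have "hk_monomial I (\<lambda>k. if k = i then - 1 else 0) x = (\<Prod>k\<in>I. if k = i then snd x i else 1)"
      unfolding hk_monomial_def by (intro prod.cong) auto
    then show ?thesis using coord_w fin by simp
  qed
  then show ?case using form_term[OF ypoly.const[of 1], of "\<lambda>k. if k = i then - 1 else 0"] by (simp add: case_prod_beta')
qed (auto intro: form_add form_mult)

text \<open>Weight zero means \<open>A c = 0\<close>; by \<open>B D + C A = 1\<close> the exponent
  is then \<open>B m\<close> with \<open>m = D c\<close>.\<close>

lemma weight_zero_mono:
  assumes "weight A r I c = weight A r I (\<lambda>i. 0)"
  shows "hk_monomial I c = mono (\<Sum>k\<in>I. c k *s D k)"
proof -
  have w: "(\<Sum>k\<in>I. A j k * c k) = 0" if "j < r" for j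
    using fun_cong[OF assms, of j] that by (simp add: weight_def)
  have "pair_int (v i) (\<Sum>k\<in>I. c k *s D k) = c i" if i: "i \<in> I" for i
  proof -
    have "pair_int (v i) (\<Sum>k\<in>I. c k *s D k) = (\<Sum>k\<in>I. c k * ((if i = k then 1 else 0) - (\<Sum>j<r. C i j * A j k)))"
      unfolding pair_int_sum pair_int_scale by (intro sum.cong refl) (simp flip: split[OF i])
    also have "\<dots> = (\<Sum>k\<in>I. if i = k then c k else 0) - (\<Sum>j<r. C i j * (\<Sum>k\<in>I. A j k * c k))"
      by (simp add: right_diff_distrib sum_subtractf sum_distrib_left sum.swap[of _ I] mult_ac mult_delta_right)
    finally show ?thesis using i fin w by simp
  qed
  then show ?thesis by (auto simp: mono_def hk_monomial_def fun_eq_iff intro!: prod.cong)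
qed

lemma Y_act: "Y (torus_act A r I t x) = Y x" if "\<And>i. torus_weight A r t i \<noteq> 0"
  unfolding Y_def by (intro sum.cong refl) (use that in \<open>auto simp: torus_act_def split: prod.splits\<close>)

section \<open>Invariant functions on the fibre\<close>

definition invariant :: "('i hk_pt \<Rightarrow> complex) \<Rightarrow> bool" where
  "invariant f \<longleftrightarrow> f \<in> poly_functions I \<and> (\<forall>t\<in>torus r. \<forall>x\<in>F. f (torus_act A r I t x) = f x)"

lemma act_fiber:
  assumes "x \<in> F" "\<And>i. torus_weight A r t i \<noteq> 0" shows "torus_act A r I t x \<in> F"
proof -
  have "moment_map A r I (torus_act A r I t x) = moment_map A r I x"
    unfolding moment_map_def torus_act_def using assms(2)
    by (auto split: prod.split intro!: restrict_ext sum.cong)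
  moreover have "torus_act A r I t x \<in> hk_space I"
    by (auto simp: hk_space_def torus_act_def split: prod.split)
  ultimately show ?thesis using assms(1) by (simp add: moment_fiber_def)
qed

text \<open>Only the terms of weight zero contribute to an invariant function.\<close>

lemma invariant_expansion:
  assumes f: "invariant f"
  shows "\<exists>Ms p. finite Ms \<and> (\<forall>m. p m \<in> ypoly) \<and> (\<forall>x\<in>F. f x = (\<Sum>m\<in>Ms. mono m x * p m (Y x)))"
proof -
  obtain xs where xs: "\<forall>(c, p)\<in>set xs. p \<in> ypoly" "\<forall>x\<in>F. f x = term_sum xs x"
    using poly_functions_form[of f] f by (auto simp: form_def invariant_def)
  define n where "n = length xs"
  define c where "c = (\<lambda>i. fst (xs ! i))"
  define p where "p = (\<lambda>i. snd (xs ! i))"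
  have p: "p i \<in> ypoly" if "i < n" for i using bspec[OF xs(1) nth_mem[of i xs]] that by (simp add: p_def n_def case_prod_beta')
  have fx: "f x = (\<Sum>i<n. hk_monomial I (c i) x * p i (Y x))" if "x \<in> F" for x
    using xs(2) that by (simp add: term_sum_def sum_list_sum_nth n_def c_def p_def case_prod_beta' atLeast0LessThan)
  define wt where "wt = (\<lambda>i. weight A r I (c i))"
  define w0 where "w0 = weight A r I (\<lambda>i. 0)"
  \<comment> \<open>The zero weight is included even if no term has it, so that its coefficient can
    be read off in every case.\<close>
  define W where "W = insert w0 (wt ` {..<n})"
  define S where "S = {i \<in> {..<n}. wt i = w0}"
  have w0: "exp_weight r w0 \<tau> = 1" for \<tau> by (simp add: exp_weight_def w0_def weight_def)
  have f_S: "f x = (\<Sum>i\<in>S. hk_monomial I (c i) x * p i (Y x))" if x: "x \<in> F" for x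
  proof -
    \<comment> \<open>The coefficient of weight \<open>e\<close> in f(t x) - f(x) for t the
      exponential of \<tau>, the constant f(x) being counted under the zero weight. Vanishing at
      \<open>w0\<close> says that f(x) is its own weight-zero part.\<close>
    define g where "g = (\<lambda>e. (\<Sum>i\<in>{i \<in> {..<n}. wt i = e}. hk_monomial I (c i) x * p i (Y x)) - (if e = w0 then f x else 0))"
    have "(\<Sum>e\<in>W. g e * exp_weight r e \<tau>) = 0" for \<tau>
    proof -
      obtain t where t: "t \<in> torus r" "\<And>i. torus_weight A r t i = exp (\<Sum>j<r. of_int (A j i) * \<tau> j)"
        using exp_torus by blast
      have nz: "torus_weight A r t i \<noteq> 0" for i by (simp add: t(2))
      have "f x = f (torus_act A r I t x)" using f t(1) x by (simp add: invariant_def)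
      also have "\<dots> = (\<Sum>i<n. exp_weight r (wt i) \<tau> * (hk_monomial I (c i) x * p i (Y x)))"
        by (simp add: fx[OF act_fiber[OF x nz]] Y_act[OF nz] hk_monomial_act[OF fin t(2)] wt_def mult.assoc)
      also have "\<dots> = (\<Sum>e\<in>W. \<Sum>i\<in>{i \<in> {..<n}. wt i = e}. exp_weight r (wt i) \<tau> * (hk_monomial I (c i) x * p i (Y x)))"
        by (rule sum.group[symmetric]) (auto simp: W_def)
      also have "\<dots> = (\<Sum>e\<in>W. (g e + (if e = w0 then f x else 0)) * exp_weight r e \<tau>)"
        by (intro sum.cong refl) (simp add: g_def sum_distrib_left mult.commute)
      also have "\<dots> = (\<Sum>e\<in>W. g e * exp_weight r e \<tau>) + (\<Sum>e\<in>W. if e = w0 then f x else 0)"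
        unfolding distrib_right sum.distrib by (intro arg_cong2[of _ _ _ _ "(+)"] sum.cong refl) (simp add: w0)
      also have "(\<Sum>e\<in>W. if e = w0 then f x else 0) = f x" by (simp add: W_def)
      finally show ?thesis by simp
    qed
    then have z: "\<And>\<tau>. (\<Sum>e\<in>W. g e * exp_weight r e \<tau>) = 0" .
    have "g w0 = 0" by (rule exp_weight_independent[of W r g, OF _ _ z]) (auto simp: W_def wt_def w0_def weight_def)
    then show ?thesis by (simp add: g_def S_def)
  qed
  define mm where "mm = (\<lambda>i. \<Sum>k\<in>I. c i k *s D k)"
  define q where "q = (\<lambda>m y. \<Sum>i\<in>{i \<in> S. mm i = m}. p i y)"
  have "q m \<in> ypoly" for m unfolding q_def by (intro ypoly_sum p) (simp add: S_def)
  moreover have "f x = (\<Sum>m\<in>mm ` S. mono m x * q m (Y x))" if "x \<in> F" for x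
  proof -
    have "f x = (\<Sum>i\<in>S. mono (mm i) x * p i (Y x))"
      unfolding f_S[OF that]
      by (intro sum.cong refl) (simp add: S_def mm_def wt_def w0_def weight_zero_mono)
    also have "\<dots> = (\<Sum>m\<in>mm ` S. \<Sum>i\<in>{i \<in> S. mm i = m}. mono (mm i) x * p i (Y x))"
      by (rule sum.group[symmetric]) (auto simp: S_def)
    also have "\<dots> = (\<Sum>m\<in>mm ` S. mono m x * q m (Y x))"
      by (intro sum.cong refl) (simp add: q_def sum_distrib_left)
    finally show ?thesis .
  qed
  moreover have "finite (mm ` S)" by (simp add: S_def)
  ultimately show ?thesis by blast
qed

lemma invariant_param:
  assumes "invariant f" shows "(\<lambda>a y. f (param a y)) \<in> symbol_algebra I v"
proof -
  obtain Ms p where *: "finite Ms" "\<And>m. p m \<in> ypoly" "\<And>x. x \<in> F \<Longrightarrow> f x = (\<Sum>m\<in>Ms. mono m x * p m (Y x))"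
    using invariant_expansion[OF assms] by blast
  have "(\<lambda>a y. \<Sum>m\<in>Ms. chi m a * pole_factor I v m y * p m y) \<in> symbol_algebra I v"
    by (intro symbol_algebra_sum symbol_algebra_gen *)
  then show ?thesis by (simp add: *(3)[OF param_fiber] mono_param Y_param)
qed

text \<open>The parametrized points need not exhaust the fibre. But the values there determine the
  coefficient polynomials \<open>p m\<close>, since characters are independent and pole factors can
  be cancelled, and these polynomials give \<open>f\<close> everywhere.\<close>

lemma invariant_zero:
  assumes f: "invariant f" and zero: "\<And>a y. f (param a y) = 0" and x: "x \<in> F"
  shows "f x = 0"
proof -
  obtain Ms p where *: "finite Ms" "\<And>m. p m \<in> ypoly" "\<And>x. x \<in> F \<Longrightarrow> f x = (\<Sum>m\<in>Ms. mono m x * p m (Y x))"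
    using invariant_expansion[OF f] by blast
  have "p m y = 0" if m: "m \<in> Ms" for m y
  proof -
    have "pole_factor I v m y * p m y = 0" for y
    proof (rule symbol_coefficients_unique[OF *(1) _ m, where p = "\<lambda>m y. pole_factor I v m y * p m y"])
      fix a
      show "(\<Sum>m\<in>Ms. chi m a * (pole_factor I v m y * p m y)) = 0"
        using zero[of a y] by (simp add: *(3)[OF param_fiber] mono_param Y_param mult.assoc)
    qed
    then have z0: "pole_factor I v m y * p m y = pole_factor I v m y * 0" for y by simp
    obtain z where z: "pole_factor I v m z \<noteq> 0" using pole_factor_nonzero[of I v m, OF fin] v_nonzero by blast
    show ?thesis by (rule ypoly_cancel[OF pole_factor_ypoly *(2) ypoly.const z z0])
  qed
  then show ?thesis by (simp add: *(3)[OF x])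
qed

lemma Y_poly: "q \<in> ypoly \<Longrightarrow> (\<lambda>x. q (Y x)) \<in> poly_functions I"
proof (induction rule: ypoly.induct)
  case (coord i)
  have "(\<lambda>x. \<Sum>k\<in>I. (fst x k * snd x k) * of_int (D k $ i)) \<in> poly_functions I"
    by (intro poly_functions_sum poly_functions.mult poly_functions.const poly_functions_fst poly_functions_snd)
  then show ?case by (simp add: Y_def cvec_def)
qed (auto intro: poly_functions.intros)

lemma invariant_add: "invariant f \<Longrightarrow> invariant g \<Longrightarrow> invariant (\<lambda>x. f x + g x)"
  by (auto simp: invariant_def intro: poly_functions.add)

lemma invariant_mult: "invariant f \<Longrightarrow> invariant g \<Longrightarrow> invariant (\<lambda>x. f x * g x)"
  by (auto simp: invariant_def intro: poly_functions.mult)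

lemma invariant_const: "invariant (\<lambda>x. c)"
  by (auto simp: invariant_def intro: poly_functions.const)

text \<open>A term of the symbol algebra lifts to \<open>mono m x * q (Y x)\<close>, which is
  invariant because \<open>A B = 0\<close> gives its monomial weight zero and \<open>Y\<close> is
  unchanged by the action.\<close>

lemma symbol_algebra_invariant:
  assumes "h \<in> symbol_algebra I v"
  shows "\<exists>f. invariant f \<and> h = (\<lambda>a y. f (param a y))"
  using assms
proof induction
  case zero
  then show ?case using invariant_const[of 0] by blast
next
  case (step h q m)
  then obtain f where f: "invariant f" "h = (\<lambda>a y. f (param a y))" by blast
  let ?g = "\<lambda>x. mono m x * q (Y x)"
  have w: "weight A r I (\<lambda>i. pair_int (v i) m) = weight A r I (\<lambda>i. 0)"
    using AB by (auto simp: weight_def intro!: restrict_ext)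
  have "invariant ?g"
    unfolding invariant_def
  proof (intro conjI ballI)
    show "?g \<in> poly_functions I"
      unfolding mono_def by (intro poly_functions.mult hk_monomial_poly Y_poly step)
    fix t x assume "t \<in> torus r" "x \<in> F"
    then obtain \<tau> where \<tau>: "\<And>i. torus_weight A r t i = exp (\<Sum>j<r. of_int (A j i) * \<tau> j)"
      using torus_exp by metis
    have nz: "torus_weight A r t i \<noteq> 0" for i by (simp add: \<tau>)
    have "exp_weight r (weight A r I (\<lambda>i. pair_int (v i) m)) \<tau> = 1"
      unfolding w by (simp add: exp_weight_def weight_def)
    then show "mono m (torus_act A r I t x) * q (Y (torus_act A r I t x)) = mono m x * q (Y x)"
      by (simp add: mono_def hk_monomial_act[OF fin \<tau>] Y_act[OF nz])
  qed
  then have "invariant (\<lambda>x. f x + ?g x)" by (intro invariant_add f)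
  moreover have "(\<lambda>a y. h a y + chi m a * pole_factor I v m y * q y) = (\<lambda>a y. f (param a y) + ?g (param a y))"
    by (simp add: f(2) mono_param Y_param)
  ultimately show ?case by blast
qed

section \<open>The ring of invariants as a ring of symbols\<close>

abbreviation "H \<equiv> hk_invariants A r I (\<lambda>_. 0)"

lemma hk_carrier: "carrier H = {restrict f F | f. invariant f}"
  by (simp add: hk_invariants_def Let_def invariant_def)

lemma hk_simps:
  "f \<otimes>\<^bsub>H\<^esub> g = (\<lambda>x\<in>F. f x * g x)" "f \<oplus>\<^bsub>H\<^esub> g = (\<lambda>x\<in>F. f x + g x)"
  "\<one>\<^bsub>H\<^esub> = (\<lambda>x\<in>F. 1)" "\<zero>\<^bsub>H\<^esub> = (\<lambda>x\<in>F. 0)" "cconst H c = (\<lambda>x\<in>F. c)"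
  by (simp_all add: hk_invariants_def Let_def)

definition pullback :: "('i hk_pt \<Rightarrow> complex) \<Rightarrow> 'n symbol" where
  "pullback f = (\<lambda>a y. f (param a y))"

lemma invariants_bij: "bij_betw pullback (carrier H) (symbol_algebra I v)"
  unfolding bij_betw_def
proof
  show "inj_on pullback (carrier H)"
  proof (rule inj_onI)
    fix f g assume "f \<in> carrier H" "g \<in> carrier H" and eq: "pullback f = pullback g"
    then obtain f' g' where f: "invariant f'" "f = restrict f' F" and g: "invariant g'" "g = restrict g' F"
      by (auto simp: hk_carrier)
    have inv: "invariant (\<lambda>x. f' x + (- 1) * g' x)"
      by (intro invariant_add invariant_mult invariant_const f g)
    have "f' (param a y) = g' (param a y)" for a y
      using fun_cong[OF fun_cong[OF eq], of a y] by (simp add: pullback_def f g param_fiber)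
    then have "f' x + (- 1) * g' x = 0" if "x \<in> F" for x
      by (intro invariant_zero[OF inv _ that]) simp
    then show "f = g" unfolding f(2) g(2) by (intro restrict_ext) simp
  qed
  show "pullback ` carrier H = symbol_algebra I v"
  proof (intro equalityI subsetI)
    fix h assume "h \<in> pullback ` carrier H"
    then obtain f where "invariant f" "h = pullback (restrict f F)" by (auto simp: hk_carrier)
    then show "h \<in> symbol_algebra I v" using invariant_param[of f] by (simp add: pullback_def param_fiber)
  next
    fix h assume "h \<in> symbol_algebra I v"
    then obtain f where f: "invariant f" "h = (\<lambda>a y. f (param a y))" using symbol_algebra_invariant by blast
    then have "h = pullback (restrict f F)" by (simp add: pullback_def param_fiber)
    then show "h \<in> pullback ` carrier H" using f(1) by (auto simp: hk_carrier)
  qed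
qed

lemma hk_mult_closed: "f \<in> carrier H \<Longrightarrow> g \<in> carrier H \<Longrightarrow> f \<otimes>\<^bsub>H\<^esub> g \<in> carrier H"
proof -
  assume "f \<in> carrier H" "g \<in> carrier H"
  then obtain f' g' where f: "invariant f'" "f = restrict f' F" and g: "invariant g'" "g = restrict g' F"
    by (auto simp: hk_carrier)
  have "f \<otimes>\<^bsub>H\<^esub> g = restrict (\<lambda>x. f' x * g' x) F" by (auto simp: hk_simps f g intro!: restrict_ext)
  then show ?thesis using invariant_mult[OF f(1) g(1)] by (auto simp: hk_carrier)
qed

lemma hk_add_closed: "f \<in> carrier H \<Longrightarrow> g \<in> carrier H \<Longrightarrow> f \<oplus>\<^bsub>H\<^esub> g \<in> carrier H"
proof -
  assume "f \<in> carrier H" "g \<in> carrier H"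
  then obtain f' g' where f: "invariant f'" "f = restrict f' F" and g: "invariant g'" "g = restrict g' F"
    by (auto simp: hk_carrier)
  have "f \<oplus>\<^bsub>H\<^esub> g = restrict (\<lambda>x. f' x + g' x) F" by (auto simp: hk_simps f g intro!: restrict_ext)
  then show ?thesis using invariant_add[OF f(1) g(1)] by (auto simp: hk_carrier)
qed

lemma hk_const_closed: "(\<lambda>x\<in>F. c) \<in> carrier H"
  using invariant_const by (auto simp: hk_carrier)

lemma pullback_simps:
  "pullback (f \<otimes>\<^bsub>H\<^esub> g) = (\<lambda>a y. pullback f a y * pullback g a y)"
  "pullback (f \<oplus>\<^bsub>H\<^esub> g) = (\<lambda>a y. pullback f a y + pullback g a y)"
  "pullback (\<lambda>x\<in>F. c) = (\<lambda>a y. c)"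
  by (simp_all add: pullback_def hk_simps param_fiber)

end

section \<open>Splitting the exact sequence and gluing the charts\<close>

text \<open>Surjectivity gives a right inverse \<open>C\<close> of \<open>A\<close>. The columns of
  \<open>1 - C A\<close> lie in the kernel of \<open>A\<close>, hence equal \<open>B D\<close> for
  some \<open>D\<close>; and \<open>D B = 1\<close> may be tested after applying the injective map
  \<open>B\<close>.\<close>

lemma exact_ray_sequence_split:
  fixes \<Sigma> :: "(real ^ 'n) set set"
  assumes exact: "exact_ray_sequence \<Sigma> r A" and fin: "finite (rays \<Sigma>)"
    and nz: "\<And>\<rho>. \<rho> \<in> rays \<Sigma> \<Longrightarrow> prim_gen \<rho> \<noteq> 0"
  shows "\<exists>D C. split_sequence (rays \<Sigma>) prim_gen A r D C"
proof -
  let ?I = "rays \<Sigma>"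
  have carrier: "carrier (int_power_group S) = (S \<rightarrow>\<^sub>E UNIV)" for S :: "'k set"
    by (simp add: int_power_group_def)
  have one: "\<one>\<^bsub>int_power_group {..<r}\<^esub> = (\<lambda>i\<in>{..<r}. 0)"
    by (simp add: int_power_group_def product_group_def)
  have inj: "inj (ray_map \<Sigma>)"
    and ker: "range (ray_map \<Sigma>) = {x \<in> ?I \<rightarrow>\<^sub>E UNIV. matrix_map r ?I A x = (\<lambda>i\<in>{..<r}. 0)}"
    and surj: "matrix_map r ?I A ` (?I \<rightarrow>\<^sub>E UNIV) = ({..<r} \<rightarrow>\<^sub>E UNIV)"
    using exact by (auto simp: exact_ray_sequence_def kernel_def carrier one)
  have "\<exists>c. matrix_map r ?I A c = (\<lambda>i\<in>{..<r}. if i = j then 1 else 0)" for j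
  proof -
    have "(\<lambda>i\<in>{..<r}. if i = j then 1 else 0 :: int) \<in> {..<r} \<rightarrow>\<^sub>E UNIV" by simp
    then show ?thesis unfolding surj[symmetric] by (auto simp: image_iff)
  qed
  then obtain c where c: "\<And>j. matrix_map r ?I A (c j) = (\<lambda>i\<in>{..<r}. if i = j then 1 else 0)" by metis
  define C where "C = (\<lambda>i j. c j i)"
  have AC: "(\<Sum>i\<in>?I. A l i * C i j) = (if l = j then 1 else 0)" if "l < r" for l j
    using fun_cong[OF c[of j], of l] that by (simp add: matrix_map_def C_def)
  \<comment> \<open>The \<open>k\<close>-th column of \<open>1 - C A\<close>.\<close>
  define X where "X = (\<lambda>k. \<lambda>i\<in>?I. (if i = k then 1 else 0) - (\<Sum>j<r. C i j * A j k))"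
  have "X k \<in> range (ray_map \<Sigma>)" if k: "k \<in> ?I" for k
  proof -
    have "(\<Sum>i\<in>?I. A l i * X k i) = 0" if l: "l < r" for l
    proof -
      have "(\<Sum>i\<in>?I. A l i * X k i) = (\<Sum>i\<in>?I. (if i = k then A l k else 0) - (\<Sum>j<r. A l i * C i j * A j k))"
        by (intro sum.cong refl) (simp add: X_def right_diff_distrib sum_distrib_left mult.assoc)
      also have "\<dots> = A l k - (\<Sum>j<r. (\<Sum>i\<in>?I. A l i * C i j) * A j k)"
        using k fin by (simp add: sum_subtractf sum_distrib_right sum.swap[of _ ?I])
      also have "\<dots> = 0" using l by (simp add: AC mult_delta_left)
      finally show ?thesis .
    qed
    then show ?thesis unfolding ker by (auto simp: X_def matrix_map_def intro!: restrict_ext)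
  qed
  then have "\<forall>k\<in>?I. \<exists>d. X k = ray_map \<Sigma> d" by blast
  from bchoice[OF this] obtain D where D: "\<forall>k\<in>?I. X k = ray_map \<Sigma> (D k)" ..
  have split: "pair_int (prim_gen i) (D k) = (if i = k then 1 else 0) - (\<Sum>j<r. C i j * A j k)"
    if "i \<in> ?I" "k \<in> ?I" for i k
    using fun_cong[OF bspec[OF D that(2)], of i] that by (simp add: X_def ray_map_def)
  have AB: "(\<Sum>i\<in>?I. A j i * pair_int (prim_gen i) m) = 0" if "j < r" for j m
  proof -
    have "ray_map \<Sigma> m \<in> range (ray_map \<Sigma>)" by simp
    then have "matrix_map r ?I A (ray_map \<Sigma> m) j = 0" unfolding ker using that by simp
    then show ?thesis using that by (simp add: matrix_map_def ray_map_def)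
  qed
  have DB: "(\<Sum>k\<in>?I. pair_int (prim_gen k) m *s D k) = m" for m
  proof (rule injD[OF inj])
    have "pair_int (prim_gen i) (\<Sum>k\<in>?I. pair_int (prim_gen k) m *s D k) = pair_int (prim_gen i) m"
      if i: "i \<in> ?I" for i
    proof -
      have "pair_int (prim_gen i) (\<Sum>k\<in>?I. pair_int (prim_gen k) m *s D k) =
        (\<Sum>k\<in>?I. (if i = k then pair_int (prim_gen k) m else 0) - (\<Sum>j<r. C i j * (A j k * pair_int (prim_gen k) m)))"
        unfolding pair_int_sum pair_int_scale
        by (intro sum.cong refl) (simp add: split[OF i] right_diff_distrib sum_distrib_left mult_ac)
      also have "\<dots> = pair_int (prim_gen i) m - (\<Sum>j<r. C i j * (\<Sum>k\<in>?I. A j k * pair_int (prim_gen k) m))"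
        using i fin by (simp add: sum_subtractf sum_distrib_left sum.swap[of _ ?I])
      also have "\<dots> = pair_int (prim_gen i) m" by (simp add: AB)
      finally show ?thesis .
    qed
    then show "ray_map \<Sigma> (\<Sum>k\<in>?I. pair_int (prim_gen k) m *s D k) = ray_map \<Sigma> m"
      by (auto simp: ray_map_def intro!: restrict_ext)
  qed
  have "split_sequence ?I prim_gen A r D C"
    by unfold_locales (simp_all add: fin nz split AB DB)
  then show ?thesis by blast
qed

section \<open>Distinct rays and the final comparison\<close>

lemma framed_singleton:
  assumes "framed \<rho> v u {i}" "x \<in> \<rho>"
  shows "x = (x \<bullet> lat (u i)) *\<^sub>R lat (v i)" "0 \<le> x \<bullet> lat (u i)"
proof -
  have uni: "unimodular v u" and x: "0 \<le> x \<bullet> lat (u i)" "\<And>j. j \<noteq> i \<Longrightarrow> x \<bullet> lat (u j) = 0"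
    using assms by (auto simp: framed_def)
  have "x = (\<Sum>j\<in>UNIV. (x \<bullet> lat (u j)) *\<^sub>R lat (v j))" by (rule unimodular_expand_real[OF uni])
  also have "\<dots> = (\<Sum>j\<in>UNIV. if j = i then (x \<bullet> lat (u i)) *\<^sub>R lat (v i) else 0)"
    by (intro sum.cong refl) (simp add: x(2))
  finally show "x = (x \<bullet> lat (u i)) *\<^sub>R lat (v i)" by simp
  show "0 \<le> x \<bullet> lat (u i)" by (rule x)
qed

text \<open>If the second form vanished on the hyperplane of the first, its generator would be a
  multiple \<open>k *s v i\<close>. Negative pairings with the same \<open>m\<close> force
  \<open>k > 0\<close>, so the rays would coincide; opposite rays are excluded by this sign
  condition alone.\<close>

lemma framed_rays_independent:
  assumes f: "framed \<rho> v u {i}" and f': "framed \<rho>' v' u' {i'}" and ne: "\<rho> \<noteq> \<rho>'"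
    and neg: "pair_int (v i) m < 0" "pair_int (v' i') m < 0"
  shows "\<exists>y. cpair (v i) y = 0 \<and> cpair (v' i') y \<noteq> 0"
proof (rule ccontr)
  assume no: "\<not> ?thesis"
  have uni: "unimodular v u" using f by (simp add: framed_def)
  have "pair_int (v' i') (u j) = 0" if "j \<noteq> i" for j
  proof -
    have "cpair (v i) (cvec (u j)) = 0" using uni that by (simp add: cpair_cvec unimodular_def)
    then have "cpair (v' i') (cvec (u j)) = 0" using no by blast
    then show ?thesis by (simp add: cpair_cvec)
  qed
  then have "(\<Sum>j\<in>UNIV. pair_int (u j) (v' i') *s v j) = (\<Sum>j\<in>UNIV. if j = i then pair_int (u i) (v' i') *s v i else 0)"
    by (intro sum.cong refl) (simp add: pair_int_commute[of _ "v' i'"])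
  then obtain k where k: "v' i' = k *s v i"
    using unimodular_expand[OF unimodular_sym[OF uni], of "v' i'"] by auto
  then have "k > 0" using neg by (auto simp: pair_int_scale mult_less_0_iff)
  have k': "lat (v' i') = of_int k *\<^sub>R lat (v i)" by (simp add: k lat_scale)
  have "\<rho> = \<rho>'"
  proof (intro equalityI subsetI)
    fix x assume x: "x \<in> \<rho>"
    note e = framed_singleton[OF f x]
    have "x = ((x \<bullet> lat (u i)) / of_int k) *\<^sub>R lat (v' i')"
      using \<open>k > 0\<close> by (subst e(1)) (simp add: k')
    moreover have "((x \<bullet> lat (u i)) / of_int k) *\<^sub>R lat (v' i') \<in> \<rho>'"
      using \<open>k > 0\<close> e(2) by (intro framed_gen[OF f']) auto
    ultimately show "x \<in> \<rho>'" by simp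
  next
    fix x assume x: "x \<in> \<rho>'"
    note e = framed_singleton[OF f' x]
    have "x = ((x \<bullet> lat (u' i')) * of_int k) *\<^sub>R lat (v i)"
      by (subst e(1)) (simp add: k')
    moreover have "((x \<bullet> lat (u' i')) * of_int k) *\<^sub>R lat (v i) \<in> \<rho>"
      using \<open>k > 0\<close> e(2) by (intro framed_gen[OF f]) auto
    ultimately show "x \<in> \<rho>" by simp
  qed
  then show False using ne by simp
qed

lemma framed_ray_dim1:
  assumes "framed \<rho> v u K" "\<rho> \<in> rays \<Sigma>"
  shows "\<exists>i. K = {i} \<and> prim_gen \<rho> = v i"
proof -
  have "card K = 1" using framed_dim[OF assms(1)] assms(2) by (simp add: rays_def)
  then obtain i where i: "K = {i}" by (rule card_1_singletonE)
  then show ?thesis using framed_prim_gen assms(1) by blast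
qed

theorem theorem1p4:
  fixes \<Sigma> :: "(real ^ 'n) set set"
    and A :: "nat \<Rightarrow> (real ^ 'n) set \<Rightarrow> int"
    and \<phi> :: "'n chart_pt set line_bundle set \<Rightarrow> (nat \<Rightarrow> int)"
    and r :: nat
  assumes "CARD('n) \<ge> 2"
    and "fan \<Sigma>"
    and "smooth_toric \<Sigma>"
    and "projective (toric_variety \<Sigma>)"
    and "r = card (rays \<Sigma>) - CARD('n)"
    and "\<phi> \<in> iso (Pic (toric_variety \<Sigma>)) (int_power_group {..<r})"
    and "\<forall>\<rho>\<in>rays \<Sigma>. \<phi> (divisor_class (toric_variety \<Sigma>) (toric_divisor \<Sigma> \<rho>)) = (\<lambda>j\<in>{..<r}. A j \<rho>)"
    and "exact_ray_sequence \<Sigma> r A"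
  shows "ringed_space_iso (Z_scheme \<Sigma>) (toric_hyperkaehler A r (rays \<Sigma>) (\<lambda>_. 0))"
proof -
  note fan = assms(2) and smooth = assms(3) and exact = assms(8)
  have cones: "finite \<Sigma>" "\<Sigma> \<noteq> {}" "\<And>\<sigma>. \<sigma> \<in> \<Sigma> \<Longrightarrow> rational_cone \<sigma>"
    "\<And>\<sigma> \<tau>. \<sigma> \<in> \<Sigma> \<Longrightarrow> \<tau> face_of \<sigma> \<Longrightarrow> \<tau> \<noteq> {} \<Longrightarrow> \<tau> \<in> \<Sigma>"
    "\<And>\<sigma> \<tau>. \<sigma> \<in> \<Sigma> \<Longrightarrow> \<tau> \<in> \<Sigma> \<Longrightarrow> (\<sigma> \<inter> \<tau>) face_of \<sigma>"
    using fan by (auto simp: fan_def)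
  \<comment> \<open>The three parts of a frame are packed into one value, so that a single choice
    selects them together.\<close>
  have "\<forall>\<sigma>\<in>\<Sigma>. \<exists>p. framed \<sigma> (fst p) (fst (snd p)) (snd (snd p))"
  proof
    fix \<sigma> assume "\<sigma> \<in> \<Sigma>"
    then obtain v u K where "framed \<sigma> v u K" using fan_framed[OF fan smooth] by blast
    then show "\<exists>p. framed \<sigma> (fst p) (fst (snd p)) (snd (snd p))" by (intro exI[of _ "(v, u, K)"]) simp
  qed
  from bchoice[OF this] obtain frame where
    frame: "\<forall>\<sigma>\<in>\<Sigma>. framed \<sigma> (fst (frame \<sigma>)) (fst (snd (frame \<sigma>))) (snd (snd (frame \<sigma>)))" ..
  define V where "V = (\<lambda>\<sigma>. fst (frame \<sigma>))"
  define U where "U = (\<lambda>\<sigma>. fst (snd (frame \<sigma>)))"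
  define K where "K = (\<lambda>\<sigma>. snd (snd (frame \<sigma>)))"
  have framed: "framed \<sigma> (V \<sigma>) (U \<sigma>) (K \<sigma>)" if "\<sigma> \<in> \<Sigma>" for \<sigma>
    using frame that by (simp add: V_def U_def K_def)
  have zero: "0 \<in> \<sigma>" if "\<sigma> \<in> \<Sigma>" for \<sigma>
    using cones(3)[OF that] cone_gen_zero by (auto simp: rational_cone_gen)
  interpret FF: framed_fan \<Sigma> V U K
  proof
    show "\<exists>K'. framed_cone (\<sigma> \<inter> \<tau>) (V \<sigma>) (U \<sigma>) K'" if "\<sigma> \<in> \<Sigma>" "\<tau> \<in> \<Sigma>" for \<sigma> \<tau>
    proof -
      \<comment> \<open>All cones contain 0, so the intersection is a nonempty face and belongs to
        the fan; as a face of \<sigma> it inherits the frame of \<sigma>.\<close>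
      have "\<sigma> \<inter> \<tau> \<in> \<Sigma>" using cones(4)[OF that(1) cones(5)[OF that]] zero that by blast
      then show ?thesis
        using framed_face[OF framed[OF that(1)] cones(5)[OF that] cones(3)] by (blast intro: framed_cone.intro)
    qed
  qed (use cones framed in \<open>auto intro: framed_cone.intro\<close>)
  have fin: "finite (rays \<Sigma>)" using cones(1) by (simp add: rays_def)
  have ray: "\<exists>i. framed \<rho> (V \<rho>) (U \<rho>) {i} \<and> K \<rho> = {i} \<and> prim_gen \<rho> = V \<rho> i" if "\<rho> \<in> rays \<Sigma>" for \<rho>
  proof -
    have f: "framed \<rho> (V \<rho>) (U \<rho>) (K \<rho>)" using framed that by (simp add: rays_def)
    then show ?thesis using framed_ray_dim1[OF f that] by auto
  qed
  have nz: "prim_gen \<rho> \<noteq> 0" if \<rho>: "\<rho> \<in> rays \<Sigma>" for \<rho>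
  proof -
    obtain i where i: "framed \<rho> (V \<rho>) (U \<rho>) {i}" "prim_gen \<rho> = V \<rho> i" using ray[OF \<rho>] by blast
    then have "pair_int (prim_gen \<rho>) (U \<rho> i) = 1" by (simp add: framed_def unimodular_def)
    then show ?thesis by auto
  qed
  \<comment> \<open>Without rays \<open>ray_map\<close> would be constant, contrary to its
    injectivity.\<close>
  have rays_ne: "rays \<Sigma> \<noteq> {}"
  proof
    assume "rays \<Sigma> = {}"
    then have "ray_map \<Sigma> 0 = ray_map \<Sigma> 1" by (simp add: ray_map_def restrict_def)
    then have "(0 :: int ^ 'n) = 1" using exact by (auto simp: exact_ray_sequence_def dest: injD)
    then show False by simp
  qed
  \<comment> \<open>The charts of the rays already impose all conditions, and coprimality combines
    them into one. Conversely the rays of any cone are among all rays, so its chart demands fewer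
    linear factors.\<close>
  have J: "FF.J = symbol_algebra (rays \<Sigma>) prim_gen"
  proof (intro equalityI subsetI)
    fix h assume h: "h \<in> FF.J"
    show "h \<in> symbol_algebra (rays \<Sigma>) prim_gen"
    proof (rule symbol_algebra_Int[OF fin rays_ne nz])
      fix \<rho> assume \<rho>: "\<rho> \<in> rays \<Sigma>"
      obtain i where i: "K \<rho> = {i}" "prim_gen \<rho> = V \<rho> i" using ray[OF \<rho>] by blast
      have "h \<in> symbol_algebra {i} (V \<rho>)" using h \<rho> i by (auto simp: FF.J_def rays_def)
      also have "\<dots> \<subseteq> symbol_algebra {\<rho>} prim_gen"
        by (rule symbol_algebra_mono[where f = "\<lambda>_. i"]) (simp_all add: i)
      finally show "h \<in> symbol_algebra {\<rho>} prim_gen" .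
    next
      fix \<rho> \<rho>' m assume \<rho>: "\<rho> \<in> rays \<Sigma>" "\<rho>' \<in> rays \<Sigma>" "\<rho> \<noteq> \<rho>'"
        and neg: "pair_int (prim_gen \<rho>) m < 0" "pair_int (prim_gen \<rho>') m < 0"
      obtain i i' where i: "framed \<rho> (V \<rho>) (U \<rho>) {i}" "prim_gen \<rho> = V \<rho> i"
        "framed \<rho>' (V \<rho>') (U \<rho>') {i'}" "prim_gen \<rho>' = V \<rho>' i'" using ray[OF \<rho>(1)] ray[OF \<rho>(2)] by blast
      show "\<exists>y. cpair (prim_gen \<rho>) y = 0 \<and> cpair (prim_gen \<rho>') y \<noteq> 0"
        using framed_rays_independent[OF i(1,3) \<rho>(3)] neg unfolding i(2,4) by blast
    qed
  next
    fix h assume h: "h \<in> symbol_algebra (rays \<Sigma>) prim_gen"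
    show "h \<in> FF.J" unfolding FF.J_def
    proof
      fix \<sigma> assume \<sigma>: "\<sigma> \<in> \<Sigma>"
      define \<rho> where "\<rho> = (\<lambda>i. {x. 0 \<le> x \<bullet> lat (U \<sigma> i) \<and> (\<forall>j. j \<noteq> i \<longrightarrow> x \<bullet> lat (U \<sigma> j) = 0)})"
      have f: "framed (\<rho> i) (V \<sigma>) (U \<sigma>) {i}" "\<rho> i face_of \<sigma>" if "i \<in> K \<sigma>" for i
        using framed_ray[OF framed[OF \<sigma>] that] by (simp_all add: \<rho>_def)
      have rays: "\<rho> i \<in> rays \<Sigma>" if "i \<in> K \<sigma>" for i
      proof -
        have "0 \<in> \<rho> i" by (simp add: \<rho>_def)
        then have "\<rho> i \<in> \<Sigma>" using cones(4)[OF \<sigma> f(2)[OF that]] by blast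
        then show ?thesis using framed_dim[OF f(1)[OF that]] by (simp add: rays_def)
      qed
      have gen: "prim_gen (\<rho> i) = V \<sigma> i" if "i \<in> K \<sigma>" for i by (rule framed_prim_gen[OF f(1)[OF that]])
      have "inj_on \<rho> (K \<sigma>)"
      proof (rule inj_onI)
        fix i j assume ij: "i \<in> K \<sigma>" "j \<in> K \<sigma>" "\<rho> i = \<rho> j"
        then have "V \<sigma> i = V \<sigma> j" using gen by metis
        moreover have "unimodular (V \<sigma>) (U \<sigma>)" using framed[OF \<sigma>] by (simp add: framed_def)
        ultimately have "(if i = i then 1 else 0 :: int) = (if j = i then 1 else 0)" unfolding unimodular_def by metis
        then show "i = j" by (simp split: if_splits)
      qed
      then have "symbol_algebra (rays \<Sigma>) prim_gen \<subseteq> symbol_algebra (K \<sigma>) (V \<sigma>)"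
        by (intro symbol_algebra_mono[OF fin]) (use rays gen in auto)
      then show "h \<in> symbol_algebra (K \<sigma>) (V \<sigma>)" using h by blast
    qed
  qed
  obtain D C where "split_sequence (rays \<Sigma>) prim_gen A r D C"
    using exact_ray_sequence_split[OF exact fin nz] by blast
  then interpret SS: split_sequence "rays \<Sigma>" prim_gen A r D C .
  define k1 where "k1 = inv_into (carrier FF.A) FF.section_symbol"
  define k2 where "k2 = inv_into (carrier SS.H) SS.pullback"
  have k1: "k1 \<in> ring_iso (symbol_ring FF.J) FF.A" "cring FF.A" "\<And>c. k1 (\<lambda>a y. c) = cconst FF.A c"
    unfolding k1_def by (rule FF.sections_iso)+
  have k2: "k2 \<in> ring_iso (symbol_ring FF.J) SS.H" "cring SS.H"
    unfolding k2_def
    by (rule inverse_ring_iso[where f = SS.pullback and R = SS.H and S = "symbol_ring FF.J"];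
        use SS.invariants_bij SS.hk_mult_closed SS.hk_add_closed SS.hk_const_closed SS.pullback_simps FF.cring_J J
        in \<open>simp add: SS.hk_simps(3,4)\<close>)+
  have k2_const: "k2 (\<lambda>a y. c) = cconst SS.H c" for c
    using inv_into_f_f[OF bij_betw_imp_inj_on[OF SS.invariants_bij] SS.hk_const_closed[of c]]
    by (simp add: k2_def SS.pullback_simps SS.hk_simps)
  \<comment> \<open>The spectrum reverses arrows, so the map goes from invariants to sections,
    through the common ring of symbols.\<close>
  define f where "f = k1 \<circ> inv_into FF.J k2"
  have "inv_into FF.J k2 \<in> ring_iso SS.H (symbol_ring FF.J)"
    using ring_iso_set_sym[OF _ k2(1)] cring.axioms(1)[OF FF.cring_J] by simp
  then have f: "f \<in> ring_iso SS.H FF.A"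
    unfolding f_def by (rule ring_iso_set_trans[OF _ k1(1)])
  have "inj_on k2 FF.J" using k2(1) by (auto simp: ring_iso_def bij_betw_def)
  then have "f (cconst SS.H c) = cconst FF.A c" for c
    using FF.J_const[of c] by (simp add: f_def k1(3) flip: k2_const)
  then have "ringed_space_iso (Spec FF.A) (Spec SS.H)"
    by (intro Spec_iso[OF k2(2) k1(2) f]) (simp_all add: SS.hk_const_closed SS.hk_simps)
  then show ?thesis by (simp add: Z_scheme_def toric_hyperkaehler_def)
qed

end
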